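(* Let $k$ be an algebraically closed field of arbitrary characteristic, $R=k[[X_1,\ldots,X_n]]$ with maximal ideal $\mathfrak m$, and let $f\in\mathfrak m$. Let $u=\alpha_0+\alpha_1X_1+\cdots+\alpha_nX_n+(\text{terms in }\mathfrak m^2)$, with $\alpha_i\in k$ and $\alpha_0\neq 0$, be a unit in $R$. Then $uf\in\overline{J(uf)}$ if and only if there exists $G\in\mathcal N_{T(f)}$ such that $G(\alpha_0,-\alpha_1,\ldots,-\alpha_n)\neq 0$. In particular, $uf\in\overline{J(uf)}$ holds for generic $(\alpha_0:\cdots:\alpha_n)\in\mathbb P^n_k$, i.e. there is a nonempty Zariski open subset of $\mathbb P^n_k$ such that $uf\in\overline{J(uf)}$ for every unit $u=\alpha_0+\alpha_1X_1+\cdots+\alpha_nX_n+(\text{terms in }\mathfrak m^2)$ of $R$, with $\alpha_i\in k$ and $\alpha_0\neq 0$, with $(\alpha_0:\cdots:\alpha_n)$ in that subset.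
   Context: For $h\in R$, $J(h)=\langle h_{X_1},\ldots,h_{X_n}\rangle$ is the ideal of partial derivatives of $h$ and $T(h)=\langle h\rangle+J(h)$. $\overline I$ denotes the integral closure of an ideal $I$ of $R$. Null-forms: a homogeneous polynomial $\varphi\in k[Y_0,\ldots,Y_n]$ of some degree $s$ is a null-form for $T(f)$ (with respect to the generators $f,f_{X_1},\ldots,f_{X_n}$) if there exists $F\in R[Y_0,\ldots,Y_n]$ homogeneous of degree $s$ with $F\equiv\varphi\bmod\mathfrak m$ and $F(f,f_{X_1},\ldots,f_{X_n})\in\mathfrak m\,T(f)^s$ (this is independent of the choice of $F$). $\mathcal N_{T(f)}$ is the homogeneous ideal of $k[Y_0,\ldots,Y_n]$ generated by all null-forms of $T(f)$. *)

theory Defs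
  imports
    "HOL-Computational_Algebra.Polynomial"
    "HOL-Library.FuncSet"
    "HOL-Library.Poly_Mapping"
begin

section \<open>Formal power series in finitely many variables\<close>

text \<open>
  The variables are indexed by a finite type \<open>'n\<close>, so \<open>('k, 'n) mfps\<close> is
  \<open>k[[X\<^sub>1, \<dots>, X\<^sub>n]]\<close> with \<open>n = CARD('n) \<ge> 1\<close>. Exponents are the
  elements of \<open>'n \<Rightarrow>\<^sub>0 nat\<close>, as for the polynomials below.
\<close>

typedef ('k, 'n) mfps = "UNIV :: (('n::finite \<Rightarrow>\<^sub>0 nat) \<Rightarrow> 'k) set"
  morphisms mfps_nth Abs_mfps
  by simp

lemma mfps_nth_Abs [simp]: "mfps_nth (Abs_mfps a) = a"
  by (simp add: Abs_mfps_inverse)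

lemma mfps_eqI: "(\<And>e. mfps_nth g e = mfps_nth h e) \<Longrightarrow> g = h"
  by (metis ext mfps_nth_inject)

lemma finite_add_decomps: "finite {(p, q). p + q = (e :: 'n::finite \<Rightarrow>\<^sub>0 nat)}"
proof -
  let ?S = "{p :: 'n \<Rightarrow>\<^sub>0 nat. \<forall>i. Poly_Mapping.lookup p i \<le> Poly_Mapping.lookup e i}"
  have "finite (PiE UNIV (\<lambda>i. {..Poly_Mapping.lookup e i}))"
    by (rule finite_PiE) auto
  moreover have "Poly_Mapping.lookup ` ?S \<subseteq> PiE UNIV (\<lambda>i. {..Poly_Mapping.lookup e i})"
    by (auto simp: PiE_def)
  ultimately have "finite (Poly_Mapping.lookup ` ?S)"
    by (rule rev_finite_subset)
  then have "finite ?S"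
    by (rule finite_imageD) (auto intro!: inj_onI poly_mapping_eqI)
  moreover have "{(p, q). p + q = e} \<subseteq> ?S \<times> ?S"
    by (auto simp: Poly_Mapping.lookup_add)
  ultimately show ?thesis
    by (meson finite_SigmaI finite_subset)
qed

instantiation mfps :: (comm_ring_1, finite) comm_ring_1
begin

definition "0 = Abs_mfps (\<lambda>_. 0)"

definition "1 = Abs_mfps (\<lambda>e. if e = 0 then 1 else 0)"

definition "g + h = Abs_mfps (\<lambda>e. mfps_nth g e + mfps_nth h e)"

definition "g - h = Abs_mfps (\<lambda>e. mfps_nth g e - mfps_nth h e)"

definition "- h = Abs_mfps (\<lambda>e. - mfps_nth h e)"

definition "g * h = Abs_mfps (\<lambda>e. \<Sum>(p, q) | p + q = e. mfps_nth g p * mfps_nth h q)"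

lemma mfps_nth_simps [simp]:
  fixes g h :: "('a, 'b) mfps"
  shows "mfps_nth 0 e = (0 :: 'a)"
    and "mfps_nth (g + h) e = mfps_nth g e + mfps_nth h e"
    and "mfps_nth (g - h) e = mfps_nth g e - mfps_nth h e"
    and "mfps_nth (- h) e = - mfps_nth h e"
  by (simp_all add: zero_mfps_def plus_mfps_def minus_mfps_def uminus_mfps_def)

lemma mfps_nth_one: "mfps_nth (1 :: ('a, 'b) mfps) e = (if e = 0 then 1 else 0)"
  by (simp add: one_mfps_def)

lemma mfps_nth_mult:
  fixes g h :: "('a, 'b) mfps"
  shows "mfps_nth (g * h) e = (\<Sum>(p, q) | p + q = e. mfps_nth g p * mfps_nth h q)"
  by (simp add: times_mfps_def)

instance
proof
  fix a b c :: "('a, 'b) mfps"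
  show "a * b * c = a * (b * c)"
  proof (rule mfps_eqI)
    fix e :: "'b \<Rightarrow>\<^sub>0 nat"
    let ?D = "\<lambda>e :: 'b \<Rightarrow>\<^sub>0 nat. {(p, q). p + q = e}"
    have "mfps_nth (a * b * c) e =
      (\<Sum>x\<in>?D e. \<Sum>y\<in>?D (fst x). mfps_nth a (fst y) * mfps_nth b (snd y) * mfps_nth c (snd x))"
      by (simp add: mfps_nth_mult case_prod_unfold sum_distrib_right)
    also have "\<dots> = (\<Sum>(x, y)\<in>Sigma (?D e) (\<lambda>x. ?D (fst x)).
        mfps_nth a (fst y) * mfps_nth b (snd y) * mfps_nth c (snd x))"
      by (rule sum.Sigma) (auto simp: finite_add_decomps)
    also have "\<dots> = (\<Sum>(x, y)\<in>Sigma (?D e) (\<lambda>x. ?D (snd x)).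
        mfps_nth a (fst x) * (mfps_nth b (fst y) * mfps_nth c (snd y)))"
      by (rule sum.reindex_bij_witness[where
            i = "\<lambda>(x, y). ((fst x + fst y, snd y), (fst x, fst y))" and
            j = "\<lambda>(x, y). ((fst y, snd y + snd x), (snd y, snd x))"])
         (auto simp: ac_simps)
    also have "\<dots> =
      (\<Sum>x\<in>?D e. \<Sum>y\<in>?D (snd x). mfps_nth a (fst x) * (mfps_nth b (fst y) * mfps_nth c (snd y)))"
      by (rule sum.Sigma[symmetric]) (auto simp: finite_add_decomps)
    also have "\<dots> = mfps_nth (a * (b * c)) e"
      by (simp add: mfps_nth_mult case_prod_unfold sum_distrib_left)
    finally show "mfps_nth (a * b * c) e = mfps_nth (a * (b * c)) e" .
  qed
  show "a * b = b * a"
  proof (rule mfps_eqI)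
    fix e :: "'b \<Rightarrow>\<^sub>0 nat"
    show "mfps_nth (a * b) e = mfps_nth (b * a) e"
      unfolding mfps_nth_mult
      by (rule sum.reindex_bij_witness[where i = prod.swap and j = prod.swap])
         (auto simp: ac_simps)
  qed
  show "1 * a = a"
  proof (rule mfps_eqI)
    fix e :: "'b \<Rightarrow>\<^sub>0 nat"
    have "mfps_nth (1 * a) e =
        (\<Sum>(p, q)\<in>{(0, e)}. mfps_nth (1 :: ('a, 'b) mfps) p * mfps_nth a q)"
      unfolding mfps_nth_mult
      by (rule sum.mono_neutral_right) (auto simp: finite_add_decomps mfps_nth_one split: if_splits)
    then show "mfps_nth (1 * a) e = mfps_nth a e"
      by (simp add: mfps_nth_one)
  qed
  show "(a + b) * c = a * c + b * c"
    by (rule mfps_eqI)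
       (simp add: mfps_nth_mult case_prod_unfold distrib_right sum.distrib)
  have "mfps_nth 0 0 \<noteq> mfps_nth (1 :: ('a, 'b) mfps) 0"
    by (simp add: mfps_nth_one)
  then show "0 \<noteq> (1 :: ('a, 'b) mfps)"
    by metis
qed (auto intro!: mfps_eqI simp: ac_simps)

end

definition mfps_const :: "'k::comm_ring_1 \<Rightarrow> ('k, 'n::finite) mfps" where
  "mfps_const c = Abs_mfps (\<lambda>e. if e = 0 then c else 0)"

definition mfps_X :: "'n::finite \<Rightarrow> ('k::comm_ring_1, 'n) mfps" where
  "mfps_X i = Abs_mfps (\<lambda>e. if e = Poly_Mapping.single i 1 then 1 else 0)"

definition mfps_pderiv :: "'n::finite \<Rightarrow> ('k::comm_ring_1, 'n) mfps \<Rightarrow> ('k, 'n) mfps" where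
  "mfps_pderiv i h =
    Abs_mfps (\<lambda>e. of_nat (Poly_Mapping.lookup e i + 1) * mfps_nth h (e + Poly_Mapping.single i 1))"


section \<open>Ideals of a commutative ring\<close>

interpretation ideal: module "(*) :: 'a::comm_ring_1 \<Rightarrow> 'a \<Rightarrow> 'a"
  by standard (simp_all add: algebra_simps)

abbreviation ideal_gen :: "'a::comm_ring_1 set \<Rightarrow> 'a set" where
  "ideal_gen \<equiv> module.span (*)"

definition ideal_sum :: "'a::comm_ring_1 set \<Rightarrow> 'a set \<Rightarrow> 'a set" where
  "ideal_sum I J = {a + b | a b. a \<in> I \<and> b \<in> J}"

definition ideal_mult :: "'a::comm_ring_1 set \<Rightarrow> 'a set \<Rightarrow> 'a set" where
  "ideal_mult I J = ideal_gen {a * b | a b. a \<in> I \<and> b \<in> J}"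

primrec ideal_power :: "'a::comm_ring_1 set \<Rightarrow> nat \<Rightarrow> 'a set" where
  "ideal_power I 0 = UNIV"
| "ideal_power I (Suc s) = ideal_mult I (ideal_power I s)"

definition integral_closure :: "'a::comm_ring_1 set \<Rightarrow> 'a set" where
  "integral_closure I =
    {x. \<exists>d a. d > 0 \<and> (\<forall>i\<in>{1..d}. a i \<in> ideal_power I i) \<and>
          x ^ d + (\<Sum>i=1..d. a i * x ^ (d - i)) = 0}"


section \<open>Ideals attached to a power series\<close>

definition mfps_max_ideal :: "('k::comm_ring_1, 'n::finite) mfps set" where
  "mfps_max_ideal = ideal_gen (range mfps_X)"

definition jacobian_ideal :: "('k::comm_ring_1, 'n::finite) mfps \<Rightarrow> ('k, 'n) mfps set" where
  "jacobian_ideal h = ideal_gen (range (\<lambda>i. mfps_pderiv i h))"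

definition tjurina_ideal :: "('k::comm_ring_1, 'n::finite) mfps \<Rightarrow> ('k, 'n) mfps set" where
  "tjurina_ideal h = ideal_sum (ideal_gen {h}) (jacobian_ideal h)"

text \<open>
  Tuples indexed by \<open>0, 1, \<dots>, n\<close> are functions on \<open>'n option\<close>, where
  \<open>None\<close> is the index \<open>0\<close> and \<open>Some i\<close> are the indices \<open>1, \<dots>, n\<close>.
\<close>

definition tjurina_gens ::
  "('k::comm_ring_1, 'n::finite) mfps \<Rightarrow> 'n option \<Rightarrow> ('k, 'n) mfps" where
  "tjurina_gens h j = (case j of None \<Rightarrow> h | Some i \<Rightarrow> mfps_pderiv i h)"

text \<open>\<open>u = \<alpha>\<^sub>0 + \<alpha>\<^sub>1 X\<^sub>1 + \<dots> + \<alpha>\<^sub>n X\<^sub>n\<close> plus terms in the square of the maximal ideal.\<close>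

definition has_linear_part ::
  "('k::comm_ring_1, 'n::finite) mfps \<Rightarrow> ('n option \<Rightarrow> 'k) \<Rightarrow> bool" where
  "has_linear_part u \<alpha> \<longleftrightarrow>
    u - (mfps_const (\<alpha> None) + (\<Sum>i\<in>UNIV. mfps_const (\<alpha> (Some i)) * mfps_X i))
      \<in> ideal_power mfps_max_ideal 2"


section \<open>Polynomials and null-forms\<close>

text \<open>Polynomials over \<open>'a\<close> in variables indexed by \<open>'v\<close>: finitely supported maps on exponents.\<close>

type_synonym ('a, 'v) mpoly = "('v \<Rightarrow>\<^sub>0 nat) \<Rightarrow>\<^sub>0 'a"

definition mpoly_eval :: "('a::comm_ring_1, 'v) mpoly \<Rightarrow> ('v \<Rightarrow> 'a) \<Rightarrow> 'a" where
  "mpoly_eval P x =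
    (\<Sum>e\<in>Poly_Mapping.keys P. Poly_Mapping.lookup P e *
      (\<Prod>v\<in>Poly_Mapping.keys e. x v ^ Poly_Mapping.lookup e v))"

definition mpoly_homogeneous :: "nat \<Rightarrow> ('a::comm_ring_1, 'v) mpoly \<Rightarrow> bool" where
  "mpoly_homogeneous s P \<longleftrightarrow>
    (\<forall>e\<in>Poly_Mapping.keys P. (\<Sum>v\<in>Poly_Mapping.keys e. Poly_Mapping.lookup e v) = s)"

text \<open>The congruence of \<open>F\<close> and \<open>\<phi>\<close> modulo the maximal ideal is coefficientwise.\<close>

definition null_form ::
  "('k::comm_ring_1, 'n::finite) mfps \<Rightarrow> nat \<Rightarrow> ('k, 'n option) mpoly \<Rightarrow> bool" where
  "null_form h s \<phi> \<longleftrightarrow> mpoly_homogeneous s \<phi> \<and>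
    (\<exists>F :: (('k, 'n) mfps, 'n option) mpoly. mpoly_homogeneous s F \<and>
      (\<forall>e. Poly_Mapping.lookup F e - mfps_const (Poly_Mapping.lookup \<phi> e) \<in> mfps_max_ideal) \<and>
      mpoly_eval F (tjurina_gens h)
        \<in> ideal_mult mfps_max_ideal (ideal_power (tjurina_ideal h) s))"

definition null_form_ideal ::
  "('k::comm_ring_1, 'n::finite) mfps \<Rightarrow> ('k, 'n option) mpoly set" where
  "null_form_ideal h = ideal_gen {\<phi>. \<exists>s. null_form h s \<phi>}"


section \<open>Projective space and its Zariski topology\<close>

text \<open>A point of projective space is a set of nonzero vectors, a class modulo nonzero scalars.\<close>

definition proj_point :: "('v \<Rightarrow> 'k::field) \<Rightarrow> ('v \<Rightarrow> 'k) set" where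
  "proj_point x = {\<lambda>v. c * x v | c. c \<noteq> 0}"

definition proj_space :: "('v \<Rightarrow> 'k::field) set set" where
  "proj_space = {proj_point x | x. x \<noteq> (\<lambda>_. 0)}"

definition proj_zero_set :: "('k::field, 'v) mpoly set \<Rightarrow> ('v \<Rightarrow> 'k) set set" where
  "proj_zero_set S = {p \<in> proj_space. \<forall>P\<in>S. \<forall>x\<in>p. mpoly_eval P x = 0}"

definition proj_zariski_open :: "('v \<Rightarrow> 'k::field) set set \<Rightarrow> bool" where
  "proj_zariski_open U \<longleftrightarrow>
    (\<exists>S. (\<forall>P\<in>S. \<exists>s. mpoly_homogeneous s P) \<and> U = proj_space - proj_zero_set S)"

end

theory Submission
  imports
    Defs
    "HOL-Computational_Algebra.Primes"
    "HOL-Computational_Algebra.Formal_Power_Series"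
begin

text \<open>
  The partial derivatives of \<open>u f\<close> are \<open>u f\<^sub>i + u\<^sub>i f\<close>, so \<open>u f\<close> is integral over
  \<open>J = J(u f)\<close> iff \<open>f\<^sup>s \<in> J (J + \<langle>f\<rangle>)\<^bsup>s-1\<^esup>\<close> for some \<open>s > 0\<close>. Modulo the maximal ideal these
  generators are \<open>\<alpha>\<^sub>0 Y\<^sub>i + \<alpha>\<^sub>i Y\<^sub>0\<close>, whose only common zero in projective space is
  \<open>(\<alpha>\<^sub>0 : -\<alpha>\<^sub>1 : \<dots> : -\<alpha>\<^sub>n)\<close>; hence the criterion.

  For the generic statement one needs a nonzero null-form, that is, a homogeneous relation
  between \<open>n + 1\<close> power series \<open>a\<^sub>0, \<dots>, a\<^sub>n\<close> in \<open>n\<close> variables having a unit coefficient. If there is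
  none, then in \<open>k[[X\<^sub>1, \<dots>, X\<^sub>n, Y\<^sub>0, \<dots>, Y\<^sub>n]]\<close> the relation ideal is contained in \<open>\<langle>X\<^sub>1, \<dots>, X\<^sub>n\<rangle>\<close>.
  Below the former there is a chain of \<open>n\<close> primes, obtained by imposing
  \<open>a\<^sub>0 Y\<^sub>i = a\<^sub>i Y\<^sub>0\<close> for one \<open>i\<close> after the other; above the latter there is a chain of \<open>n + 1\<close> primes,
  obtained by adding the \<open>Y\<^sub>j\<close>. The resulting chain has length \<open>2 n + 2\<close>, exceeding the dimension
  \<open>2 n + 1\<close> of the ring, which is bounded by Weierstrass division and induction.
\<close>

section \<open>Exponents and monomials\<close>

text \<open>The criterion compares two readings of one form. Modulo J(u f) the product rule gives
  f_i = -(u_i/u) f, so a form F of degree s, evaluated at f, f_1, ..., f_n, equals F(1, -u_1/u, ...,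
  -u_n/u) f^s up to an element of J (J + <f>)^(s-1). If the value also lies in m T(f)^s, it is a
  non-unit times f^s up to the same error. The difference of the two coefficients is a unit exactly
  when the reduced form is nonzero at the point. Conversely, an integral equation for u f becomes an
  exact relation between the generators once u f and u f_i + u_i f are read as u Y_0 and u Y_i + u_i
  Y_0. Derivatives enter only through the product rule, which is why the characteristic is
  arbitrary.

  Every member of the long chain of primes is the kernel of an explicit ring map into a domain, so
  primality is inherited. The field has to be infinite for the linear change of coordinates that
  precedes Weierstrass division, and again to find a point where a nonzero form does not
  vanish.\<close>

definition exp_of :: "('v::finite \<Rightarrow> nat) \<Rightarrow> ('v \<Rightarrow>\<^sub>0 nat)" where
  "exp_of = Abs_poly_mapping"

lemma lookup_exp_of [simp]: "Poly_Mapping.lookup (exp_of h) = h"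
  by (simp add: exp_of_def)

definition edeg :: "('v::finite \<Rightarrow>\<^sub>0 nat) \<Rightarrow> nat" where
  "edeg e = (\<Sum>v\<in>UNIV. Poly_Mapping.lookup e v)"

lemma edeg_add [simp]: "edeg (e + g) = edeg e + edeg g"
  by (simp add: edeg_def lookup_add sum.distrib)

lemma edeg_zero [simp]: "edeg 0 = 0"
  by (simp add: edeg_def)

lemma edeg_single [simp]: "edeg (Poly_Mapping.single v n) = n"
  by (simp add: edeg_def lookup_single when_def)

lemma edeg_eq_0_iff [simp]: "edeg e = 0 \<longleftrightarrow> e = 0"
  by (auto simp: edeg_def poly_mapping_eq_iff fun_eq_iff)

lemma edeg_keys: "edeg e = (\<Sum>v\<in>Poly_Mapping.keys e. Poly_Mapping.lookup e v)"
  unfolding edeg_def by (rule sum.mono_neutral_right) (auto simp: in_keys_iff)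

lemma lookup_le_edeg: "Poly_Mapping.lookup e v \<le> edeg e"
  unfolding edeg_def by (rule member_le_sum) auto

lemma finite_edeg_le: "finite {e :: 'v::finite \<Rightarrow>\<^sub>0 nat. edeg e \<le> N}"
proof -
  have "finite (PiE UNIV (\<lambda>i::'v. {..N}))"
    by (rule finite_PiE) auto
  moreover have "Poly_Mapping.lookup ` {e :: 'v \<Rightarrow>\<^sub>0 nat. edeg e \<le> N} \<subseteq> PiE UNIV (\<lambda>i. {..N})"
    by (auto simp: PiE_def intro: order_trans[OF lookup_le_edeg])
  ultimately have "finite (Poly_Mapping.lookup ` {e :: 'v \<Rightarrow>\<^sub>0 nat. edeg e \<le> N})"
    by (rule rev_finite_subset)
  then show ?thesis
    by (rule finite_imageD) (auto intro!: inj_onI poly_mapping_eqI)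
qed

lemma finite_edeg_eq: "finite {e :: 'v::finite \<Rightarrow>\<^sub>0 nat. edeg e = N}"
  by (rule finite_subset[OF _ finite_edeg_le[of N]]) auto

lemma sum_single_lookup:
  "(\<Sum>v\<in>UNIV. Poly_Mapping.single v (Poly_Mapping.lookup e v)) = (e :: 'v::finite \<Rightarrow>\<^sub>0 nat)"
  by (rule poly_mapping_eqI) (simp add: lookup_sum lookup_single when_def)

lemma keys_add_nat: "Poly_Mapping.keys (e + g :: 'v \<Rightarrow>\<^sub>0 nat) = Poly_Mapping.keys e \<union> Poly_Mapping.keys g"
  by (auto simp: in_keys_iff lookup_add)

lemma exp_single_split:
  fixes e :: "'v::finite \<Rightarrow>\<^sub>0 nat"
  assumes "n \<le> Poly_Mapping.lookup e v"
  shows "\<exists>g. e = g + Poly_Mapping.single v n"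
proof
  show "e = (e - Poly_Mapping.single v n) + Poly_Mapping.single v n"
    using assms by (intro poly_mapping_eqI) (auto simp: lookup_add lookup_minus lookup_single when_def)
qed

definition mon :: "('v::finite \<Rightarrow> 'a::comm_ring_1) \<Rightarrow> ('v \<Rightarrow>\<^sub>0 nat) \<Rightarrow> 'a" where
  "mon x e = (\<Prod>v\<in>UNIV. x v ^ Poly_Mapping.lookup e v)"

lemma mon_add: "mon x (e + g) = mon x e * mon x g"
  by (simp add: mon_def lookup_add power_add prod.distrib)

lemma mon_zero [simp]: "mon x 0 = 1"
  by (simp add: mon_def)

lemma mon_single [simp]: "mon x (Poly_Mapping.single v n) = x v ^ n"
proof -
  have "mon x (Poly_Mapping.single v n) = (\<Prod>w\<in>UNIV. if w = v then x v ^ n else 1)"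
    unfolding mon_def by (rule prod.cong) (auto simp: lookup_single when_def)
  then show ?thesis by simp
qed

lemma mon_keys: "mon x e = (\<Prod>v\<in>Poly_Mapping.keys e. x v ^ Poly_Mapping.lookup e v)"
  unfolding mon_def by (rule prod.mono_neutral_right) (auto simp: in_keys_iff)

lemma mon_scale: "mon (\<lambda>v. c * x v) e = c ^ edeg e * mon x e"
  by (simp add: mon_def edeg_def power_mult_distrib prod.distrib power_sum)

lemma mon_induct [case_names zero step]:
  fixes e :: "'v::finite \<Rightarrow>\<^sub>0 nat"
  assumes "P 0" and "\<And>e v. P e \<Longrightarrow> P (e + Poly_Mapping.single v 1)"
  shows "P e"
proof (induction "edeg e" arbitrary: e)
  case 0
  then show ?case using assms(1) by simp
next
  case (Suc n)
  then have "e \<noteq> 0" by auto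
  then obtain v where "Poly_Mapping.lookup e v \<noteq> 0"
    by (auto simp: poly_mapping_eq_iff fun_eq_iff)
  then obtain g where g: "e = g + Poly_Mapping.single v 1"
    using exp_single_split[of 1 e v] by force
  with Suc(2) have "n = edeg g" by simp
  then show ?case using Suc(1) assms(2) g by simp
qed

section \<open>Power series in finitely many variables\<close>

lemma mfps_nth_const: "mfps_nth (mfps_const c :: ('k::comm_ring_1, 'v::finite) mfps) e = (if e = 0 then c else 0)"
  by (simp add: mfps_const_def)

lemma mfps_nth_sum: "mfps_nth (\<Sum>i\<in>I. F i :: ('k::comm_ring_1, 'v::finite) mfps) e = (\<Sum>i\<in>I. mfps_nth (F i) e)"
  by (induction I rule: infinite_finite_induct) auto

lemma mfps_nth_mult_0: "mfps_nth (F * G :: ('k::comm_ring_1, 'v::finite) mfps) 0 = mfps_nth F 0 * mfps_nth G 0"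
proof -
  have "{(p, q). p + q = (0 :: 'v \<Rightarrow>\<^sub>0 nat)} = {(0, 0)}"
  proof -
    have "p + q = 0 \<longleftrightarrow> p = 0 \<and> q = 0" for p q :: "'v \<Rightarrow>\<^sub>0 nat"
      unfolding edeg_eq_0_iff[symmetric] by simp
    then show ?thesis by simp
  qed
  then show ?thesis by (simp add: mfps_nth_mult)
qed

lemma mfps_nth_power_0: "mfps_nth (F ^ n :: ('k::comm_ring_1, 'v::finite) mfps) 0 = mfps_nth F 0 ^ n"
  by (induction n) (auto simp: mfps_nth_mult_0 mfps_nth_one)

lemma mfps_nth_prod_0: "mfps_nth (\<Prod>i\<in>I. F i :: ('k::comm_ring_1, 'v::finite) mfps) 0 = (\<Prod>i\<in>I. mfps_nth (F i) 0)"
  by (induction I rule: infinite_finite_induct) (auto simp: mfps_nth_mult_0 mfps_nth_one)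

definition mfps_monom :: "('v::finite \<Rightarrow>\<^sub>0 nat) \<Rightarrow> ('k::comm_ring_1, 'v) mfps" where
  "mfps_monom g = Abs_mfps (\<lambda>e. if e = g then 1 else 0)"

lemma mfps_nth_monom: "mfps_nth (mfps_monom g) e = (if e = g then 1 else 0)"
  by (simp add: mfps_monom_def)

lemma mfps_nth_monom_mult:
  "mfps_nth (mfps_monom g * A) e = (\<Sum>(p, q) | p + q = e. if p = g then mfps_nth A q else 0)"
  unfolding mfps_nth_mult by (rule sum.cong) (auto simp: mfps_nth_monom)

lemma mfps_nth_monom_mult_add [simp]:
  "mfps_nth (mfps_monom g * A) (g + e) = mfps_nth A e"
proof -
  have "mfps_nth (mfps_monom g * A) (g + e) = (\<Sum>(p, q)\<in>{(g, e)}. if p = g then mfps_nth A q else 0)"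
    unfolding mfps_nth_monom_mult
    by (rule sum.mono_neutral_right) (auto simp: finite_add_decomps split: if_splits)
  then show ?thesis by simp
qed

lemma mfps_nth_monom_mult_0:
  assumes "\<And>h. e \<noteq> g + h"
  shows "mfps_nth (mfps_monom g * A) e = 0"
  unfolding mfps_nth_monom_mult by (rule sum.neutral) (use assms in auto)

lemma mfps_monom_add: "mfps_monom (g + h) = mfps_monom g * mfps_monom h"
proof (rule mfps_eqI)
  fix e
  show "mfps_nth (mfps_monom (g + h)) e = mfps_nth (mfps_monom g * mfps_monom h) e"
  proof (cases "\<exists>q. e = g + q")
    case True
    then show ?thesis by (auto simp: mfps_nth_monom)
  next
    case False
    then show ?thesis by (subst mfps_nth_monom_mult_0) (auto simp: mfps_nth_monom)
  qed
qed

lemma mfps_monom_zero [simp]: "mfps_monom 0 = 1"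
  by (rule mfps_eqI) (auto simp: mfps_nth_monom mfps_nth_one)

lemma mfps_monom_single_1: "mfps_monom (Poly_Mapping.single v 1) = mfps_X v"
  by (simp add: mfps_monom_def mfps_X_def)

lemma mon_mfps_X: "mon mfps_X e = mfps_monom e"
proof (induction e rule: mon_induct)
  case (step e v)
  then show ?case
    unfolding mon_add mfps_monom_add mfps_monom_single_1 by (simp only: mon_single power_one_right)
qed simp

lemma mfps_nth_X: "mfps_nth (mfps_X v) e = (if e = Poly_Mapping.single v 1 then 1 else 0)"
  by (simp add: mfps_X_def)

lemma mfps_nth_const_mult [simp]:
  fixes F :: "('k::comm_ring_1, 'v::finite) mfps"
  shows "mfps_nth (mfps_const c * F) e = c * mfps_nth F e"
proof -
  have "mfps_nth (mfps_const c * F) e =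
      (\<Sum>(p, q)\<in>{(0, e)}. mfps_nth (mfps_const c :: ('k, 'v) mfps) p * mfps_nth F q)"
    unfolding mfps_nth_mult
    by (rule sum.mono_neutral_right) (auto simp: finite_add_decomps mfps_nth_const split: if_splits)
  then show ?thesis by (simp add: mfps_nth_const)
qed

lemma mfps_const_mult: "mfps_const (a * b) = mfps_const a * mfps_const b"
  by (rule mfps_eqI) (auto simp: mfps_nth_const)

lemma mfps_const_0 [simp]: "mfps_const 0 = 0"
  by (rule mfps_eqI) (auto simp: mfps_nth_const)

lemma mfps_const_1 [simp]: "mfps_const 1 = 1"
  by (rule mfps_eqI) (auto simp: mfps_nth_const mfps_nth_one)

lemma mfps_const_mon: "mfps_const (mon x e) = mon (\<lambda>v. mfps_const (x v)) e"
  by (induction e rule: mon_induct) (auto simp: mon_add mfps_const_mult)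

text \<open>The filtration by powers of the maximal ideal, read off coefficients; it decides which
  terms of an infinite sum can reach a given coefficient.\<close>

definition mfps_order_ge :: "nat \<Rightarrow> ('k::comm_ring_1, 'v::finite) mfps set" where
  "mfps_order_ge N = {F. \<forall>e. edeg e < N \<longrightarrow> mfps_nth F e = 0}"

lemma mfps_order_geD: "F \<in> mfps_order_ge N \<Longrightarrow> edeg e < N \<Longrightarrow> mfps_nth F e = 0"
  by (auto simp: mfps_order_ge_def)

lemma mfps_order_ge_1_iff: "F \<in> mfps_order_ge 1 \<longleftrightarrow> mfps_nth F 0 = 0"
  by (auto simp: mfps_order_ge_def)

lemma mfps_order_ge_mult:
  assumes "F \<in> mfps_order_ge M" "G \<in> mfps_order_ge N"
  shows "F * G \<in> mfps_order_ge (M + N)"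
  unfolding mfps_order_ge_def
proof safe
  fix e :: "'b \<Rightarrow>\<^sub>0 nat" assume e: "edeg e < M + N"
  have "mfps_nth F p * mfps_nth G q = 0" if "p + q = e" for p q
  proof -
    have "edeg p + edeg q < M + N" using e that by auto
    then have "edeg p < M \<or> edeg q < N" by linarith
    then show ?thesis using assms by (auto simp: mfps_order_geD)
  qed
  then show "mfps_nth (F * G) e = 0"
    unfolding mfps_nth_mult by (intro sum.neutral) auto
qed

lemma mfps_order_ge_mon:
  assumes "\<And>v. x v \<in> mfps_order_ge 1"
  shows "mon x e \<in> mfps_order_ge (edeg e)"
proof (induction e rule: mon_induct)
  case zero
  then show ?case by (simp add: mfps_order_ge_def)
next
  case (step e v)
  then show ?case using mfps_order_ge_mult[OF step assms[of v]] by (simp add: mon_add)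
qed

subsection \<open>Substitution\<close>

text \<open>Only meaningful when every \<open>x v\<close> has zero constant term; then \<open>mon x g\<close> does not
  contribute to coefficients of degree below \<open>edeg g\<close>.\<close>

definition mfps_subst ::
  "('v::finite \<Rightarrow> ('k::comm_ring_1, 'w::finite) mfps) \<Rightarrow> ('k, 'v) mfps \<Rightarrow> ('k, 'w) mfps" where
  "mfps_subst x F = Abs_mfps (\<lambda>e. \<Sum>g | edeg g \<le> edeg e. mfps_nth F g * mfps_nth (mon x g) e)"

locale substitution =
  fixes x :: "'v::finite \<Rightarrow> ('k::comm_ring_1, 'w::finite) mfps"
  assumes x_order: "\<And>v. x v \<in> mfps_order_ge 1"
begin

lemma nth_mon_eq_0: "edeg e < edeg g \<Longrightarrow> mfps_nth (mon x g) e = 0"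
  by (rule mfps_order_geD[OF mfps_order_ge_mon[where x = x, OF x_order]])

text \<open>Only exponents of degree at most \<open>edeg e\<close> contribute, so any larger finite
  index set gives the same value. Coefficients at different exponents can thus be compared over one
  common index set.\<close>

lemma nth_subst:
  assumes "finite B" "{g. edeg g \<le> edeg e} \<subseteq> B"
  shows "mfps_nth (mfps_subst x F) e = (\<Sum>g\<in>B. mfps_nth F g * mfps_nth (mon x g) e)"
proof -
  have "mfps_nth (mfps_subst x F) e = (\<Sum>g | edeg g \<le> edeg e. mfps_nth F g * mfps_nth (mon x g) e)"
    by (simp add: mfps_subst_def)
  also have "\<dots> = (\<Sum>g\<in>B. mfps_nth F g * mfps_nth (mon x g) e)"
    by (rule sum.mono_neutral_left[OF assms])
       (auto simp: nth_mon_eq_0)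
  finally show ?thesis .
qed

lemma nth_subst_le:
  assumes "edeg e \<le> N"
  shows "mfps_nth (mfps_subst x F) e = (\<Sum>g | edeg g \<le> N. mfps_nth F g * mfps_nth (mon x g) e)"
  by (rule nth_subst[OF finite_edeg_le]) (use assms in auto)

lemma subst_add: "mfps_subst x (F + G) = mfps_subst x F + mfps_subst x G"
  by (rule mfps_eqI) (simp add: nth_subst_le[OF order_refl] distrib_right sum.distrib)

lemma subst_0 [simp]: "mfps_subst x 0 = 0"
  by (rule mfps_eqI) (simp add: nth_subst_le[OF order_refl])

lemma subst_sum: "mfps_subst x (\<Sum>i\<in>I. F i) = (\<Sum>i\<in>I. mfps_subst x (F i))"
  by (induction I rule: infinite_finite_induct) (auto simp: subst_add)

lemma subst_const_mult: "mfps_subst x (mfps_const c * F) = mfps_const c * mfps_subst x F"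
proof (rule mfps_eqI)
  fix e
  show "mfps_nth (mfps_subst x (mfps_const c * F)) e = mfps_nth (mfps_const c * mfps_subst x F) e"
    unfolding mfps_nth_const_mult nth_subst_le[OF order_refl] sum_distrib_left by (simp only: mult.assoc)
qed

lemma subst_monom: "mfps_subst x (mfps_monom g) = mon x g"
proof (rule mfps_eqI)
  fix e :: "'w \<Rightarrow>\<^sub>0 nat"
  let ?B = "insert g {h. edeg h \<le> edeg e}"
  have "mfps_nth (mfps_subst x (mfps_monom g)) e = (\<Sum>h\<in>?B. mfps_nth (mfps_monom g) h * mfps_nth (mon x h) e)"
    by (rule nth_subst) (auto simp: finite_edeg_le)
  also have "\<dots> = (\<Sum>h\<in>?B. if h = g then mfps_nth (mon x g) e else 0)"
    by (rule sum.cong) (auto simp: mfps_nth_monom)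
  also have "\<dots> = mfps_nth (mon x g) e"
    by (subst sum.delta) (auto simp: finite_edeg_le)
  finally show "mfps_nth (mfps_subst x (mfps_monom g)) e = mfps_nth (mon x g) e" .
qed

lemma subst_1 [simp]: "mfps_subst x 1 = 1"
  using subst_monom[of 0] by simp

lemma subst_X [simp]: "mfps_subst x (mfps_X v) = x v"
  using subst_monom[of "Poly_Mapping.single v 1"] unfolding mfps_monom_single_1 by simp

lemma subst_mult: "mfps_subst x (F * G) = mfps_subst x F * mfps_subst x G"
proof (rule mfps_eqI)
  fix e :: "'w \<Rightarrow>\<^sub>0 nat"
  let ?B = "{g :: 'v \<Rightarrow>\<^sub>0 nat. edeg g \<le> edeg e}"
  let ?D = "\<lambda>g :: 'v \<Rightarrow>\<^sub>0 nat. {(p, q). p + q = g}"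
  let ?t = "\<lambda>(p, q). mfps_nth F p * mfps_nth G q * mfps_nth (mon x (p + q)) e"
  have "mfps_nth (mfps_subst x (F * G)) e
      = (\<Sum>g\<in>?B. \<Sum>y\<in>?D g. ?t y)"
    unfolding nth_subst_le[OF order_refl] mfps_nth_mult sum_distrib_right
    by (intro sum.cong) auto
  also have "\<dots> = (\<Sum>(g, y)\<in>Sigma ?B ?D. ?t y)"
    by (rule sum.Sigma) (auto simp: finite_add_decomps finite_edeg_le)
  also have "\<dots> = (\<Sum>y | fst y + snd y \<in> ?B. ?t y)"
    by (rule sum.reindex_bij_witness[where i = "\<lambda>y. (fst y + snd y, y)" and j = snd]) auto
  \<comment> \<open>The pairs added here have total degree above \<open>edeg e\<close>, where the
    substituted monomials have no coefficient at \<open>e\<close>; over the full square the sum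
    factors.\<close>
  also have "\<dots> = (\<Sum>y\<in>?B \<times> ?B. ?t y)"
  proof (rule sum.mono_neutral_left)
    have "?t y = 0" if "fst y + snd y \<notin> ?B" for y
      using nth_mon_eq_0[of e "fst y + snd y"] that by (simp add: case_prod_unfold)
    then show "\<forall>y\<in>?B \<times> ?B - {y. fst y + snd y \<in> ?B}. ?t y = 0"
      by blast
  qed (auto simp: finite_edeg_le)
  also have "\<dots> = (\<Sum>g\<in>?B. \<Sum>h\<in>?B. mfps_nth F g * mfps_nth G h * mfps_nth (mon x g * mon x h) e)"
    unfolding sum.cartesian_product by (rule sum.cong) (auto simp: mon_add)
  also have "\<dots> = (\<Sum>g\<in>?B. \<Sum>h\<in>?B. \<Sum>(p, q) | p + q = e.
      (mfps_nth F g * mfps_nth (mon x g) p) * (mfps_nth G h * mfps_nth (mon x h) q))"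
    unfolding mfps_nth_mult sum_distrib_left by (intro sum.cong refl) (simp only: case_prod_unfold mult_ac)
  also have "\<dots> = (\<Sum>g\<in>?B. \<Sum>(p, q) | p + q = e. \<Sum>h\<in>?B.
      (mfps_nth F g * mfps_nth (mon x g) p) * (mfps_nth G h * mfps_nth (mon x h) q))"
    unfolding case_prod_unfold by (intro sum.cong refl sum.swap)
  also have "\<dots> = (\<Sum>(p, q) | p + q = e. \<Sum>g\<in>?B. \<Sum>h\<in>?B.
      (mfps_nth F g * mfps_nth (mon x g) p) * (mfps_nth G h * mfps_nth (mon x h) q))"
    unfolding case_prod_unfold by (rule sum.swap)
  also have "\<dots> = (\<Sum>(p, q) | p + q = e. mfps_nth (mfps_subst x F) p * mfps_nth (mfps_subst x G) q)"
  proof (rule sum.cong[OF refl])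
    fix y assume "y \<in> {(p, q). p + q = e}"
    then obtain p q where y: "y = (p, q)" and "p + q = e" by auto
    then have pq: "edeg p \<le> edeg e" "edeg q \<le> edeg e" by auto
    show "(case y of (p, q) \<Rightarrow> \<Sum>g\<in>?B. \<Sum>h\<in>?B.
        (mfps_nth F g * mfps_nth (mon x g) p) * (mfps_nth G h * mfps_nth (mon x h) q))
      = (case y of (p, q) \<Rightarrow> mfps_nth (mfps_subst x F) p * mfps_nth (mfps_subst x G) q)"
      unfolding y prod.case nth_subst_le[OF pq(1)] nth_subst_le[OF pq(2)] by (rule sum_product[symmetric])
  qed
  also have "\<dots> = mfps_nth (mfps_subst x F * mfps_subst x G) e"
    by (rule mfps_nth_mult[symmetric])
  finally show "mfps_nth (mfps_subst x (F * G)) e = mfps_nth (mfps_subst x F * mfps_subst x G) e" .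
qed

lemma subst_mon: "mfps_subst x (mon y g) = mon (\<lambda>v. mfps_subst x (y v)) g"
  by (induction g rule: mon_induct) (auto simp: mon_add subst_mult)

lemma subst_order_ge:
  assumes "F \<in> mfps_order_ge N"
  shows "mfps_subst x F \<in> mfps_order_ge N"
  unfolding mfps_order_ge_def
proof safe
  fix e :: "'w \<Rightarrow>\<^sub>0 nat" assume "edeg e < N"
  then show "mfps_nth (mfps_subst x F) e = 0"
    unfolding nth_subst_le[OF order_refl]
    by (intro sum.neutral) (auto simp: mfps_order_geD[OF assms])
qed

lemma subst_minus: "mfps_subst x (F - G) = mfps_subst x F - mfps_subst x G"
  by (rule mfps_eqI) (simp add: nth_subst_le[OF order_refl] left_diff_distrib sum_subtractf)

end

lemma mfps_truncate:
  fixes F :: "('k::comm_ring_1, 'v::finite) mfps"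
  obtains F0 where "F0 = (\<Sum>g | edeg g < N. mfps_const (mfps_nth F g) * mfps_monom g)"
    and "F - F0 \<in> mfps_order_ge N"
proof
  have fin: "finite {g :: 'v \<Rightarrow>\<^sub>0 nat. edeg g < N}"
    by (rule finite_subset[OF _ finite_edeg_le[of N]]) auto
  have "(\<Sum>g | edeg g < N. mfps_nth F g * (if e = g then 1 else 0)) = mfps_nth F e" if "edeg e < N" for e
  proof -
    have "(\<Sum>g | edeg g < N. mfps_nth F g * (if e = g then 1 else 0))
        = (\<Sum>g | edeg g < N. if e = g then mfps_nth F e else 0)"
      by (rule sum.cong) auto
    then show ?thesis using that fin by (simp add: sum.delta')
  qed
  then show "F - (\<Sum>g | edeg g < N. mfps_const (mfps_nth F g) * mfps_monom g) \<in> mfps_order_ge N"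
    by (auto simp: mfps_order_ge_def mfps_nth_sum mfps_nth_monom)
qed simp

text \<open>For polynomials the identity is formal. Truncation just above degree
  \<open>edeg e\<close> leaves a tail that no substitution can bring down to the coefficient at
  \<open>e\<close>.\<close>

lemma subst_compose:
  fixes F :: "('k::comm_ring_1, 'v::finite) mfps" and y :: "'w::finite \<Rightarrow> ('k, 'u::finite) mfps"
  assumes "substitution x" "substitution y"
  shows "mfps_subst y (mfps_subst x F) = mfps_subst (\<lambda>v. mfps_subst y (x v)) F"
proof (rule mfps_eqI)
  fix e :: "'u \<Rightarrow>\<^sub>0 nat"
  interpret x: substitution x by fact
  interpret y: substitution y by fact
  interpret z: substitution "\<lambda>v. mfps_subst y (x v)"
    by standard (rule y.subst_order_ge[OF x.x_order])
  obtain F0 where F0: "F0 = (\<Sum>g | edeg g < Suc (edeg e). mfps_const (mfps_nth F g) * mfps_monom g)"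
    and d: "F - F0 \<in> mfps_order_ge (Suc (edeg e))"
    by (rule mfps_truncate)
  have "mfps_subst y (mfps_subst x F0) = mfps_subst (\<lambda>v. mfps_subst y (x v)) F0"
    unfolding F0 x.subst_sum y.subst_sum z.subst_sum x.subst_const_mult y.subst_const_mult
      z.subst_const_mult x.subst_monom y.subst_mon z.subst_monom ..
  moreover have "mfps_nth (mfps_subst y (mfps_subst x (F - F0))) e = 0"
    by (rule mfps_order_geD[OF y.subst_order_ge[OF x.subst_order_ge[OF d]]]) simp
  moreover have "mfps_nth (mfps_subst (\<lambda>v. mfps_subst y (x v)) (F - F0)) e = 0"
    by (rule mfps_order_geD[OF z.subst_order_ge[OF d]]) simp
  ultimately show "mfps_nth (mfps_subst y (mfps_subst x F)) e
      = mfps_nth (mfps_subst (\<lambda>v. mfps_subst y (x v)) F) e"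
    by (simp add: x.subst_minus y.subst_minus z.subst_minus)
qed

lemma nth_mult_monom_expansion:
  fixes H A :: "('k::comm_ring_1, 'v::finite) mfps"
  assumes "edeg e \<le> N"
  shows "mfps_nth (H * A) e = (\<Sum>g | edeg g \<le> N. mfps_nth H g * mfps_nth (mfps_monom g * A) e)"
proof -
  let ?G = "{g :: 'v \<Rightarrow>\<^sub>0 nat. edeg g \<le> N}" and ?D = "{(p, q). p + q = e}"
  have "(\<Sum>g\<in>?G. mfps_nth H g * mfps_nth (mfps_monom g * A) e)
      = (\<Sum>g\<in>?G. \<Sum>y\<in>?D. if fst y = g then mfps_nth H (fst y) * mfps_nth A (snd y) else 0)"
    unfolding mfps_nth_monom_mult sum_distrib_left by (intro sum.cong refl) auto
  also have "\<dots> = (\<Sum>y\<in>?D. \<Sum>g\<in>?G. if fst y = g then mfps_nth H (fst y) * mfps_nth A (snd y) else 0)"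
    by (rule sum.swap)
  also have "\<dots> = (\<Sum>y\<in>?D. mfps_nth H (fst y) * mfps_nth A (snd y))"
    using assms by (intro sum.cong refl) (auto simp: finite_edeg_le)
  finally show ?thesis by (simp add: mfps_nth_mult case_prod_unfold)
qed

lemma substitution_X: "substitution (mfps_X :: 'v::finite \<Rightarrow> ('k::comm_ring_1, 'v) mfps)"
proof
  fix v :: 'v
  have "Poly_Mapping.single v (Suc 0) \<noteq> 0" by (simp flip: edeg_eq_0_iff)
  then show "mfps_X v \<in> (mfps_order_ge 1 :: ('k, 'v) mfps set)"
    by (auto simp: mfps_order_ge_def mfps_nth_X)
qed

lemma subst_X_id:
  fixes F :: "('k::comm_ring_1, 'v::finite) mfps"
  shows "mfps_subst mfps_X F = F"
proof (rule mfps_eqI)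
  fix e :: "'v \<Rightarrow>\<^sub>0 nat"
  interpret substitution "mfps_X :: 'v \<Rightarrow> ('k, 'v) mfps" by (rule substitution_X)
  have "mfps_nth (mfps_subst mfps_X F) e = (\<Sum>g | edeg g \<le> edeg e. if g = e then mfps_nth F e else 0)"
    unfolding nth_subst_le[OF order_refl] mon_mfps_X by (intro sum.cong) (auto simp: mfps_nth_monom)
  then show "mfps_nth (mfps_subst mfps_X F) e = mfps_nth F e" by (simp add: finite_edeg_le)
qed

lemma subst_subst_eq:
  assumes "substitution x" "substitution y" "\<And>v. mfps_subst y (x v) = mfps_X v"
  shows "mfps_subst y (mfps_subst x F) = F"
  unfolding subst_compose[OF assms(1,2)] assms(3) by (rule subst_X_id)

subsection \<open>Absence of zero divisors\<close>

text \<open>A distinct prime for each variable turns exponents into numbers, injectively by unique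
  factorization. The order of the numbers then serves as a monomial order compatible with
  addition.\<close>

lemma exp_weight_exists:
  "\<exists>wt :: ('v::finite \<Rightarrow>\<^sub>0 nat) \<Rightarrow> nat.
    inj wt \<and> (\<forall>e g. wt (e + g) = wt e * wt g) \<and> (\<forall>e. wt e > 0)"
proof -
  obtain S :: "nat set" where S: "S \<subseteq> {p. prime p}" "finite S" "card S = card (UNIV :: 'v set)"
    using infinite_arbitrarily_large[OF primes_infinite] by metis
  then obtain p :: "'v \<Rightarrow> nat" where p: "bij_betw p UNIV S"
    using finite_same_card_bij[of "UNIV :: 'v set" S] by auto
  define wt where "wt = (\<lambda>e :: 'v \<Rightarrow>\<^sub>0 nat. \<Prod>v\<in>UNIV. p v ^ Poly_Mapping.lookup e v)"
  have prime: "prime (p v)" for v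
    using p S(1) by (auto simp: bij_betw_def)
  have wt_S: "wt e = (\<Prod>q\<in>S. q ^ Poly_Mapping.lookup e (inv p q))" for e
    unfolding wt_def prod.reindex_bij_betw[OF p, symmetric] using p by (simp add: bij_betw_def)
  have mult: "multiplicity (p v) (wt e) = Poly_Mapping.lookup e v" for e v
  proof -
    have "p v \<in> S" "inv p (p v) = v" using p by (auto simp: bij_betw_def)
    then show ?thesis unfolding wt_S
      by (subst multiplicity_prod_prime_powers) (use S prime in auto)
  qed
  show ?thesis
  proof (intro exI conjI allI)
    show "inj wt"
      by (rule injI, rule poly_mapping_eqI) (metis mult)
    show "wt (e + g) = wt e * wt g" for e g
      by (simp add: wt_def lookup_add power_add prod.distrib)
    show "wt e > 0" for e
      unfolding wt_def by (intro prod_pos ballI zero_less_power prime_gt_0_nat prime)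
  qed
qed

text \<open>Each nonzero factor has a term of least weight. No other pair of terms reaches the
  product of these two monomials, so its coefficient cannot cancel.\<close>

lemma mfps_mult_eq_0:
  fixes F G :: "('k::idom, 'v::finite) mfps"
  assumes "F * G = 0"
  shows "F = 0 \<or> G = 0"
proof (rule ccontr)
  assume "\<not> (F = 0 \<or> G = 0)"
  then have ex: "\<exists>e. mfps_nth F e \<noteq> 0" "\<exists>e. mfps_nth G e \<noteq> 0"
    by (metis mfps_eqI mfps_nth_simps(1))+
  obtain wt :: "('v \<Rightarrow>\<^sub>0 nat) \<Rightarrow> nat"
    where wt: "inj wt" "\<And>e g. wt (e + g) = wt e * wt g" "\<And>e. wt e > 0"
    using exp_weight_exists by blast
  obtain e where e: "mfps_nth F e \<noteq> 0" "\<And>e'. mfps_nth F e' \<noteq> 0 \<Longrightarrow> wt e \<le> wt e'"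
    using ex(1) ex_has_least_nat[of "\<lambda>e. mfps_nth F e \<noteq> 0" _ wt] by blast
  obtain g where g: "mfps_nth G g \<noteq> 0" "\<And>g'. mfps_nth G g' \<noteq> 0 \<Longrightarrow> wt g \<le> wt g'"
    using ex(2) ex_has_least_nat[of "\<lambda>e. mfps_nth G e \<noteq> 0" _ wt] by blast
  have "p = e \<and> q = g" if "p + q = e + g" "mfps_nth F p \<noteq> 0" "mfps_nth G q \<noteq> 0" for p q
  proof -
    have eq: "wt p * wt q = wt e * wt g"
      using that(1) wt(2) by metis
    have "wt p = wt e"
    proof (rule ccontr)
      assume "wt p \<noteq> wt e"
      with e(2)[OF that(2)] have "wt e < wt p" by simp
      then have "wt e * wt g < wt p * wt q"
        using g(2)[OF that(3)] wt(3) by (intro mult_less_le_imp_less) auto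
      with eq show False by simp
    qed
    then have "p = e" using wt(1) by (simp add: inj_eq)
    then show ?thesis using that(1) by simp
  qed
  then have "mfps_nth (F * G) (e + g) = (\<Sum>(p, q)\<in>{(e, g)}. mfps_nth F p * mfps_nth G q)"
    unfolding mfps_nth_mult
    by (intro sum.mono_neutral_right) (auto simp: finite_add_decomps)
  with e(1) g(1) assms show False by simp
qed

subsection \<open>Power series in a subset of the variables\<close>

definition is_subring :: "'a::comm_ring_1 set \<Rightarrow> bool" where
  "is_subring A \<longleftrightarrow> 0 \<in> A \<and> 1 \<in> A \<and> (\<forall>a\<in>A. \<forall>b\<in>A. a + b \<in> A \<and> a - b \<in> A \<and> a * b \<in> A)"

lemma is_subringD:
  assumes "is_subring A"
  shows "0 \<in> A" "1 \<in> A" "\<And>a b. a \<in> A \<Longrightarrow> b \<in> A \<Longrightarrow> a + b \<in> A"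
    "\<And>a b. a \<in> A \<Longrightarrow> b \<in> A \<Longrightarrow> a - b \<in> A" "\<And>a b. a \<in> A \<Longrightarrow> b \<in> A \<Longrightarrow> a * b \<in> A"
  using assms by (auto simp: is_subring_def)

lemma is_subring_sum:
  assumes "is_subring A" "\<And>i. i \<in> I \<Longrightarrow> f i \<in> A"
  shows "sum f I \<in> A"
  using assms(2) by (induction I rule: infinite_finite_induct) (auto simp: is_subringD[OF assms(1)])

lemma is_subring_power:
  assumes "is_subring A" "a \<in> A"
  shows "a ^ n \<in> A"
  by (induction n) (auto simp: is_subringD[OF assms(1)] assms(2))

text \<open>The ring in the variables \<open>V\<close>, kept inside the type of all variables, so
  that an induction on the number of variables can run over finite sets.\<close>

definition mfps_on :: "'v set \<Rightarrow> ('k::comm_ring_1, 'v::finite) mfps set" where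
  "mfps_on V = {F. \<forall>e. mfps_nth F e \<noteq> 0 \<longrightarrow> Poly_Mapping.keys e \<subseteq> V}"

lemma mfps_onD: "F \<in> mfps_on V \<Longrightarrow> \<not> Poly_Mapping.keys e \<subseteq> V \<Longrightarrow> mfps_nth F e = 0"
  by (auto simp: mfps_on_def)

lemma mfps_on_UNIV [simp]: "mfps_on UNIV = UNIV"
  by (auto simp: mfps_on_def)

lemma mfps_on_mono: "V \<subseteq> W \<Longrightarrow> mfps_on V \<subseteq> mfps_on W"
  by (auto simp: mfps_on_def)

lemma mfps_on_mult:
  assumes "F \<in> mfps_on V" "G \<in> mfps_on V"
  shows "F * G \<in> mfps_on V"
  unfolding mfps_on_def
proof safe
  fix e v assume "mfps_nth (F * G) e \<noteq> 0" "v \<in> Poly_Mapping.keys e"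
  then obtain p q where "p + q = e" "mfps_nth F p * mfps_nth G q \<noteq> 0"
    unfolding mfps_nth_mult by (auto elim: sum.not_neutral_contains_not_neutral)
  moreover from this(2) have "mfps_nth F p \<noteq> 0" "mfps_nth G q \<noteq> 0" by auto
  then have "Poly_Mapping.keys p \<subseteq> V" "Poly_Mapping.keys q \<subseteq> V"
    using assms by (auto simp: mfps_on_def)
  ultimately show "v \<in> V"
    using \<open>v \<in> Poly_Mapping.keys e\<close> keys_add_nat[of p q] by auto
qed

lemma is_subring_mfps_on: "is_subring (mfps_on V)"
  unfolding is_subring_def
proof (intro conjI ballI)
  fix F G :: "('a, 'b) mfps" assume FG: "F \<in> mfps_on V" "G \<in> mfps_on V"
  then show "F * G \<in> mfps_on V" by (rule mfps_on_mult)
  show "F + G \<in> mfps_on V" "F - G \<in> mfps_on V"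
    using FG unfolding mfps_on_def by auto (metis add.left_neutral subsetD diff_self)+
qed (auto simp: mfps_on_def mfps_nth_one split: if_splits)

lemma mfps_const_on: "mfps_const c \<in> mfps_on V"
  by (auto simp: mfps_on_def mfps_nth_const split: if_splits)

lemma mfps_X_on: "v \<in> V \<Longrightarrow> mfps_X v \<in> mfps_on V"
  by (auto simp: mfps_on_def mfps_nth_X split: if_splits)

lemma mfps_on_empty:
  assumes "F \<in> mfps_on {}"
  shows "F = mfps_const (mfps_nth F 0)"
  by (rule mfps_eqI) (use assms in \<open>auto simp: mfps_on_def mfps_nth_const\<close>)

subsection \<open>Weierstrass division\<close>

text \<open>The quotient is found coefficient by coefficient: since \<open>g\<close> has a nonzero
  coefficient at \<open>single v d\<close>, the choice of the quotient at \<open>e\<close> can kill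
  the remainder at \<open>e + single v d\<close>. Regularity of \<open>g\<close> in \<open>v\<close>
  ensures that all other quotient coefficients in that equation come earlier.\<close>

lemma weierstrass_division:
  fixes F g :: "('k::field, 'v::finite) mfps"
  assumes F: "F \<in> mfps_on V" and g: "g \<in> mfps_on V" and v: "v \<in> V"
    and gd: "mfps_nth g (Poly_Mapping.single v d) \<noteq> 0"
    and gj: "\<And>j. j < d \<Longrightarrow> mfps_nth g (Poly_Mapping.single v j) = 0"
  obtains q where "q \<in> mfps_on V" "\<And>e. mfps_nth (F - q * g) (e + Poly_Mapping.single v d) = 0"
proof -
  let ?s = "Poly_Mapping.single v d"
  define rest where "rest = (\<lambda>e :: 'v \<Rightarrow>\<^sub>0 nat. edeg e - Poly_Mapping.lookup e v)"
  \<comment> \<open>Earlier means a smaller total degree in the other variables, then a smaller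
    exponent of \<open>v\<close>.\<close>
  define R where "R = inv_image (less_than <*lex*> less_than) (\<lambda>e. (rest e, Poly_Mapping.lookup e v))"
  have wf: "wf R" unfolding R_def by (intro wf_inv_image wf_lex_prod wf_less_than)
  have rest_add: "rest (p + q) = rest p + rest q" for p q
    using lookup_le_edeg[of p v] lookup_le_edeg[of q v] by (simp add: rest_def lookup_add)
  have rest_s: "rest (Poly_Mapping.single v j) = 0" for j by (simp add: rest_def)
  have rest_0: "q = Poly_Mapping.single v (Poly_Mapping.lookup q v)" if "rest q = 0" for q
  proof -
    obtain h where h: "q = h + Poly_Mapping.single v (Poly_Mapping.lookup q v)"
      using exp_single_split by blast
    have "edeg q = edeg h + Poly_Mapping.lookup q v" using arg_cong[OF h, of edeg] by simp
    with that lookup_le_edeg[of q v] have "edeg h = 0" by (simp add: rest_def)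
    with h show ?thesis by simp
  qed
  \<comment> \<open>The equation at \<open>e + ?s\<close> solved for the coefficient at
    \<open>e\<close>; the value 0 outside \<open>V\<close> keeps the quotient in
    \<open>mfps_on V\<close>.\<close>
  define Phi where "Phi = (\<lambda>h e. if Poly_Mapping.keys e \<subseteq> V then
      (mfps_nth F (e + ?s) - (\<Sum>(p, q) | p + q = e + ?s \<and> (p, e) \<in> R. h p * mfps_nth g q)) / mfps_nth g ?s
      else 0)"
  define h where "h = wfrec R Phi"
  have "adm_wf R Phi"
    unfolding adm_wf_def
  proof (intro allI impI)
    fix h1 h2 :: "('v \<Rightarrow>\<^sub>0 nat) \<Rightarrow> 'k" and e
    assume eq: "\<forall>z. (z, e) \<in> R \<longrightarrow> h1 z = h2 z"
    have "(\<Sum>(p, q) | p + q = e + ?s \<and> (p, e) \<in> R. h1 p * mfps_nth g q)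
      = (\<Sum>(p, q) | p + q = e + ?s \<and> (p, e) \<in> R. h2 p * mfps_nth g q)"
      by (rule sum.cong) (use eq in auto)
    then show "Phi h1 e = Phi h2 e" by (simp only: Phi_def)
  qed
  then have h: "h e = Phi h e" for e
    unfolding h_def by (metis wfrec_fixpoint[OF wf])
  let ?q = "Abs_mfps h"
  have qV: "?q \<in> mfps_on V"
    unfolding mfps_on_def using h by (auto simp: Phi_def split: if_splits)
  have "mfps_nth (F - ?q * g) (e + ?s) = 0" for e
  proof (cases "Poly_Mapping.keys e \<subseteq> V")
    case False
    then have "\<not> Poly_Mapping.keys (e + ?s) \<subseteq> V" by (auto simp: keys_add_nat)
    moreover have "F - ?q * g \<in> mfps_on V"
      using is_subringD(4,5)[OF is_subring_mfps_on] F g qV by blast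
    ultimately show ?thesis by (metis mfps_onD)
  next
    case True
    let ?D = "{(p, q). p + q = e + ?s}"
    let ?E = "{(p, q). p + q = e + ?s \<and> (p, e) \<in> R}"
    have fin: "finite ?D" by (rule finite_add_decomps)
    have "(e, e) \<notin> R" using wf by auto
    have small: "(p, e) \<in> R" if pq: "p + q = e + ?s" "p \<noteq> e" "mfps_nth g q \<noteq> 0" for p q
    proof -
      have r: "rest p + rest q = rest e" using arg_cong[OF pq(1), of rest] by (simp add: rest_add rest_s)
      show ?thesis
      proof (cases "rest q = 0")
        case False
        then show ?thesis using r by (simp add: R_def)
      next
        case True
        \<comment> \<open>When only \<open>v\<close> occurs in \<open>q\<close>, regularity gives
          \<open>j >= d\<close>, and \<open>j = d\<close> would force \<open>p = e\<close>; so
          \<open>j > d\<close>, and \<open>p\<close> has a smaller exponent of \<open>v\<close> than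
          \<open>e\<close>.\<close>
        define j where "j = Poly_Mapping.lookup q v"
        have q: "q = Poly_Mapping.single v j" using rest_0[OF True] j_def by simp
        have "j \<ge> d" using gj pq(3) q not_le by blast
        moreover have "j \<noteq> d" using pq(1,2) q by auto
        moreover have "Poly_Mapping.lookup p v + j = Poly_Mapping.lookup e v + d"
          using arg_cong[OF pq(1), of "\<lambda>x. Poly_Mapping.lookup x v"] q by (simp add: lookup_add)
        ultimately show ?thesis using True r by (simp add: R_def)
      qed
    qed
    have "mfps_nth (?q * g) (e + ?s) = (\<Sum>(p, q)\<in>?D. h p * mfps_nth g q)"
      by (simp add: mfps_nth_mult)
    also have "\<dots> = (\<Sum>(p, q)\<in>insert (e, ?s) ?E. h p * mfps_nth g q)"
    proof (rule sum.mono_neutral_right[OF fin])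
      show "\<forall>y\<in>?D - insert (e, ?s) ?E. (case y of (p, q) \<Rightarrow> h p * mfps_nth g q) = 0"
      proof
        fix y assume y: "y \<in> ?D - insert (e, ?s) ?E"
        obtain p q where [simp]: "y = (p, q)" by (cases y)
        from y have pq: "p + q = e + ?s" "(p, e) \<notin> R" "p \<noteq> e" by auto
        then have "mfps_nth g q = 0" using small by blast
        then show "(case y of (p, q) \<Rightarrow> h p * mfps_nth g q) = 0" by simp
      qed
    qed auto
    also have "\<dots> = h e * mfps_nth g ?s + (\<Sum>(p, q)\<in>?E. h p * mfps_nth g q)"
      by (subst sum.insert) (use \<open>(e, e) \<notin> R\<close> in \<open>auto intro: finite_subset[OF _ fin]\<close>)
    also have "h e * mfps_nth g ?s = mfps_nth F (e + ?s) - (\<Sum>(p, q)\<in>?E. h p * mfps_nth g q)"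
      using gd True by (subst h) (simp add: Phi_def)
    finally show ?thesis by simp
  qed
  with qV show ?thesis by (rule that)
qed

text \<open>Division of 1 by a series with nonzero constant term is the case \<open>d = 0\<close>,
  in which the remainder has no coefficient left.\<close>

lemma mfps_unit:
  fixes F :: "('k::field, 'v::finite) mfps"
  assumes "mfps_nth F 0 \<noteq> 0"
  obtains G where "G * F = 1"
proof -
  obtain q where "\<And>e. mfps_nth (1 - q * F) (e + Poly_Mapping.single (undefined :: 'v) 0) = 0"
    using weierstrass_division[of 1 UNIV F undefined 0] assms by auto
  then have "1 - q * F = 0" by (intro mfps_eqI) simp
  then show ?thesis using that by simp
qed

text \<open>Turns a Weierstrass remainder into a polynomial in \<open>v\<close>; this makes the
  quotient by a regular series finite over \<open>mfps_on V\<close>.\<close>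

lemma mfps_on_polynomial:
  fixes r :: "('k::field, 'v::finite) mfps"
  assumes r: "r \<in> mfps_on (insert v V)" and v: "v \<notin> V"
    and rd: "\<And>e. mfps_nth r (e + Poly_Mapping.single v d) = 0"
  obtains c where "\<And>j. c j \<in> mfps_on V" "r = (\<Sum>j<d. c j * mfps_X v ^ j)"
proof
  define c where "c = (\<lambda>j. Abs_mfps (\<lambda>e. if Poly_Mapping.lookup e v = 0
      then mfps_nth r (e + Poly_Mapping.single v j) else 0))"
  show "c j \<in> mfps_on V" for j
    unfolding mfps_on_def
  proof safe
    fix e w assume e: "mfps_nth (c j) e \<noteq> 0" "w \<in> Poly_Mapping.keys e"
    then have "Poly_Mapping.lookup e v = 0" "mfps_nth r (e + Poly_Mapping.single v j) \<noteq> 0"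
      by (auto simp: c_def split: if_splits)
    then have "v \<notin> Poly_Mapping.keys e" "Poly_Mapping.keys (e + Poly_Mapping.single v j) \<subseteq> insert v V"
      using r mfps_onD by (simp add: in_keys_iff, blast)
    with e(2) show "w \<in> V" unfolding keys_add_nat by blast
  qed
  show "r = (\<Sum>j<d. c j * mfps_X v ^ j)"
  proof (rule mfps_eqI)
    fix e
    have "mfps_nth (c j * mfps_X v ^ j) e = (if j = Poly_Mapping.lookup e v then mfps_nth r e else 0)" for j
    proof -
      have eq: "c j * mfps_X v ^ j = mfps_monom (Poly_Mapping.single v j) * c j"
        unfolding mon_mfps_X[symmetric] by (simp add: mult.commute)
      show ?thesis
      proof (cases "j \<le> Poly_Mapping.lookup e v")
        case True
        then obtain h where h: "e = Poly_Mapping.single v j + h"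
          using exp_single_split by (metis add.commute)
        then have "Poly_Mapping.lookup e v = j + Poly_Mapping.lookup h v" by (simp add: lookup_add)
        moreover have "mfps_nth (c j * mfps_X v ^ j) e = mfps_nth (c j) h"
          unfolding eq h by (rule mfps_nth_monom_mult_add)
        ultimately show ?thesis
          using h by (auto simp: c_def add.commute)
      next
        case False
        then have "mfps_nth (mfps_monom (Poly_Mapping.single v j) * c j) e = 0"
          by (intro mfps_nth_monom_mult_0) (auto simp: lookup_add)
        with False eq show ?thesis by simp
      qed
    qed
    then have "mfps_nth (\<Sum>j<d. c j * mfps_X v ^ j) e = (if Poly_Mapping.lookup e v < d then mfps_nth r e else 0)"
      by (simp add: mfps_nth_sum)
    moreover have "mfps_nth r e = 0" if "\<not> Poly_Mapping.lookup e v < d"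
      using exp_single_split[of d e v] that rd by auto
    ultimately show "mfps_nth r e = mfps_nth (\<Sum>j<d. c j * mfps_X v ^ j) e" by auto
  qed
qed

subsection \<open>The dimension of a power series ring\<close>

definition prime_in :: "'a::comm_ring_1 set \<Rightarrow> 'a set \<Rightarrow> bool" where
  "prime_in A Q \<longleftrightarrow> Q \<subseteq> A \<and> 0 \<in> Q \<and> (\<forall>a\<in>Q. \<forall>b\<in>Q. a + b \<in> Q) \<and> (\<forall>a\<in>A. \<forall>b\<in>Q. a * b \<in> Q) \<and>
    1 \<notin> Q \<and> (\<forall>a\<in>A. \<forall>b\<in>A. a * b \<in> Q \<longrightarrow> a \<in> Q \<or> b \<in> Q)"

lemma prime_inD:
  assumes "prime_in A Q"
  shows "\<And>a. a \<in> Q \<Longrightarrow> a \<in> A" "0 \<in> Q" "\<And>a b. a \<in> Q \<Longrightarrow> b \<in> Q \<Longrightarrow> a + b \<in> Q"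
    "\<And>a b. a \<in> A \<Longrightarrow> b \<in> Q \<Longrightarrow> a * b \<in> Q" "1 \<notin> Q"
    "\<And>a b. a \<in> A \<Longrightarrow> b \<in> A \<Longrightarrow> a * b \<in> Q \<Longrightarrow> a \<in> Q \<or> b \<in> Q"
  using assms by (auto simp: prime_in_def)

lemma prime_in_sum:
  assumes "prime_in A Q" "\<And>i. i \<in> I \<Longrightarrow> f i \<in> Q"
  shows "sum f I \<in> Q"
  using assms(2) by (induction I rule: infinite_finite_induct) (auto simp: prime_inD(2,3)[OF assms(1)])

lemma prime_in_diff:
  assumes "is_subring A" "prime_in A Q" "a \<in> Q" "b \<in> Q"
  shows "a - b \<in> Q"
proof -
  have "0 - 1 \<in> A" using is_subringD[OF assms(1)] by blast
  then have "(0 - 1) * b \<in> Q" using prime_inD(4)[OF assms(2)] assms(4) by blast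
  then have "a + (0 - 1) * b \<in> Q" using prime_inD(3)[OF assms(2)] assms(3) by blast
  then show ?thesis by simp
qed

lemma prime_in_power:
  assumes "is_subring A" "prime_in A Q" "a \<in> A" "a ^ n \<in> Q"
  shows "a \<in> Q"
  using assms(4)
proof (induction n)
  case 0
  then show ?case using prime_inD(5)[OF assms(2)] by simp
next
  case (Suc n)
  then show ?case using prime_inD(6)[OF assms(2,3) is_subring_power[OF assms(1,3)]] by auto
qed

text \<open>There are more rows than columns over the fraction field of A/Q. Gaussian elimination is
  done without fractions, so that all coefficients stay in \<open>A\<close>.\<close>

lemma linear_dependence_mod_prime:
  assumes A: "is_subring A" and Q: "prime_in A Q"
    and "finite I" "card I > d" "\<And>i j. i \<in> I \<Longrightarrow> M i j \<in> A"
  shows "\<exists>c. (\<forall>i\<in>I. c i \<in> A) \<and> (\<exists>i\<in>I. c i \<notin> Q) \<and> (\<forall>j<d. (\<Sum>i\<in>I. c i * M i j) \<in> Q)"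
  using assms(3-)
proof (induction d arbitrary: I M)
  case 0
  then obtain i where "i \<in> I" by fastforce
  then show ?case
    using is_subringD(2)[OF A] prime_inD(5)[OF Q] by (intro exI[of _ "\<lambda>_. 1"]) auto
next
  case (Suc d)
  note A' = is_subringD[OF A] and sum_A = is_subring_sum[OF A]
  note sum_Q = prime_in_sum[OF Q]
  note Q' = prime_inD[OF Q]
  show ?case
  proof (cases "\<forall>i\<in>I. M i d \<in> Q")
    case True
    obtain c where c: "\<forall>i\<in>I. c i \<in> A" "\<exists>i\<in>I. c i \<notin> Q" "\<forall>j<d. (\<Sum>i\<in>I. c i * M i j) \<in> Q"
      using Suc.IH[of I M] Suc.prems by auto
    have "(\<Sum>i\<in>I. c i * M i d) \<in> Q"
      using c(1) True by (intro sum_Q Q'(4)) auto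
    with c show ?thesis by (auto simp: less_Suc_eq)
  next
    case False
    then obtain p where p: "p \<in> I" "M p d \<notin> Q" by auto
    let ?I = "I - {p}"
    \<comment> \<open>Column \<open>d\<close> is cleared with the pivot \<open>M p d\<close>, which
      is nonzero modulo \<open>Q\<close>; multiplying the rows by it replaces division.\<close>
    define N where "N = (\<lambda>i j. M p d * M i j - M i d * M p j)"
    have card: "card ?I > d" "finite ?I" using Suc.prems p by auto
    moreover have "N i j \<in> A" if "i \<in> ?I" for i j
      unfolding N_def using that p Suc.prems(3) by (auto intro!: A')
    ultimately obtain c where c: "\<forall>i\<in>?I. c i \<in> A" "\<exists>i\<in>?I. c i \<notin> Q" "\<forall>j<d. (\<Sum>i\<in>?I. c i * N i j) \<in> Q"
      using Suc.IH[of ?I N] by auto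
    \<comment> \<open>The relation between the rows of \<open>N\<close>, rewritten for the rows of
      \<open>M\<close>: the pivot row absorbs all subtracted multiples.\<close>
    define c' where "c' = (\<lambda>i. if i = p then - (\<Sum>i\<in>?I. c i * M i d) else c i * M p d)"
    have sA: "(\<Sum>i\<in>?I. c i * M i d) \<in> A"
      using c(1) Suc.prems(3) by (intro sum_A A') auto
    have "0 - (\<Sum>i\<in>?I. c i * M i d) \<in> A" by (rule A'(4)[OF A'(1) sA])
    then have c'A: "\<forall>i\<in>I. c' i \<in> A"
      using c(1) p(1) Suc.prems(3) by (auto simp: c'_def intro!: A'(5))
    obtain i where i: "i \<in> ?I" "c i \<notin> Q" using c(2) by blast
    have "c i * M p d \<notin> Q" using Q'(6)[of "c i" "M p d"] i p c(1) Suc.prems(3) by blast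
    then have ex: "\<exists>i\<in>I. c' i \<notin> Q" using i by (intro bexI[of _ i]) (auto simp: c'_def)
    have eq: "(\<Sum>i\<in>I. c' i * M i j) = (\<Sum>i\<in>?I. c i * N i j)" for j
    proof -
      have "(\<Sum>i\<in>I. c' i * M i j) = c' p * M p j + (\<Sum>i\<in>?I. c' i * M i j)"
        using p(1) Suc.prems(1) by (simp add: sum.remove)
      also have "(\<Sum>i\<in>?I. c' i * M i j) = (\<Sum>i\<in>?I. c i * M p d * M i j)"
        by (rule sum.cong) (auto simp: c'_def)
      also have "c' p * M p j + \<dots> = (\<Sum>i\<in>?I. c i * M p d * M i j - c i * M i d * M p j)"
        by (simp add: c'_def sum_subtractf sum_distrib_right)
      also have "\<dots> = (\<Sum>i\<in>?I. c i * N i j)"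
        by (rule sum.cong) (auto simp: N_def algebra_simps simp del: ideal.scale_scale)
      finally show ?thesis .
    qed
    have "(\<Sum>i\<in>I. c' i * M i j) \<in> Q" if "j < Suc d" for j
    proof (cases "j = d")
      case True
      then have "(\<Sum>i\<in>I. c' i * M i j) = (\<Sum>i\<in>?I. c i * 0)"
        unfolding eq by (intro sum.cong) (auto simp: N_def)
      then show ?thesis using Q'(2) by simp
    next
      case False
      then show ?thesis unfolding eq using c(3) that by auto
    qed
    with c'A ex show ?thesis by (intro exI[of _ c']) auto
  qed
qed

text \<open>Over a base modulo which the ring is finitely generated as a module, two comparable
  primes with the same contraction coincide: a nontrivial relation of minimal order
  satisfied by an element of the difference has its lowest coefficient in the contraction.\<close>

lemma contraction_psubset:
  assumes A: "is_subring A" and B: "is_subring B" and AB: "A \<subseteq> B"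
    and Q: "prime_in B Q" and Q': "prime_in B Q'" and sub: "Q \<subset> Q'" and z: "z \<in> B"
    and fin: "\<And>x. x \<in> B \<Longrightarrow> \<exists>c. (\<forall>j. c j \<in> A) \<and> x - (\<Sum>j<d. c j * z ^ j) \<in> Q"
  shows "Q \<inter> A \<subset> Q' \<inter> A"
proof (rule ccontr)
  assume "\<not> Q \<inter> A \<subset> Q' \<inter> A"
  with sub have eq: "Q' \<inter> A = Q \<inter> A" by blast
  have QA: "prime_in A (Q \<inter> A)"
    unfolding prime_in_def
  proof (intro conjI ballI impI)
    show "1 \<notin> Q \<inter> A" "0 \<in> Q \<inter> A" "Q \<inter> A \<subseteq> A"
      using prime_inD[OF Q] is_subringD[OF A] by auto
    show "a + b \<in> Q \<inter> A" if "a \<in> Q \<inter> A" "b \<in> Q \<inter> A" for a b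
      using that prime_inD(3)[OF Q] is_subringD(3)[OF A] by auto
    show "a * b \<in> Q \<inter> A" if "a \<in> A" "b \<in> Q \<inter> A" for a b
      using that AB prime_inD(4)[OF Q, of a b] is_subringD(5)[OF A] by auto
    show "a \<in> Q \<inter> A \<or> b \<in> Q \<inter> A" if "a \<in> A" "b \<in> A" "a * b \<in> Q \<inter> A" for a b
      using that AB prime_inD(6)[OF Q, of a b] by auto
  qed
  obtain x where x: "x \<in> Q'" "x \<notin> Q" using sub by blast
  then have xB: "x \<in> B" using prime_inD(1)[OF Q'] by blast
  have xB': "x ^ n \<in> B" "z ^ n \<in> B" for n using is_subring_power B xB z by blast+
  have "\<forall>i. \<exists>c. (\<forall>j. c j \<in> A) \<and> x ^ i - (\<Sum>j<d. c j * z ^ j) \<in> Q"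
    using fin xB' by blast
  then obtain M where M: "\<And>i j. M i j \<in> A" "\<And>i. x ^ i - (\<Sum>j<d. M i j * z ^ j) \<in> Q"
    by metis
  \<comment> \<open>The powers \<open>x ^ 0\<close> to \<open>x ^ d\<close> give
    \<open>d + 1\<close> rows, the powers of \<open>z\<close> below \<open>d\<close> only
    \<open>d\<close> columns.\<close>
  obtain c where c: "\<forall>i\<in>{..d}. c i \<in> A" "\<exists>i\<in>{..d}. c i \<notin> Q \<inter> A"
    "\<forall>j<d. (\<Sum>i\<le>d. c i * M i j) \<in> Q \<inter> A"
    using linear_dependence_mod_prime[OF A QA, of "{..d}" d M] M(1) by auto
  have "(\<Sum>i\<le>d. c i * x ^ i) =
      (\<Sum>i\<le>d. c i * (x ^ i - (\<Sum>j<d. M i j * z ^ j))) + (\<Sum>j<d. z ^ j * (\<Sum>i\<le>d. c i * M i j))"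
  proof -
    have "(\<Sum>j<d. z ^ j * (\<Sum>i\<le>d. c i * M i j)) = (\<Sum>j<d. \<Sum>i\<le>d. c i * (M i j * z ^ j))"
      unfolding sum_distrib_left by (intro sum.cong refl) (simp only: mult_ac)
    also have "\<dots> = (\<Sum>i\<le>d. c i * (\<Sum>j<d. M i j * z ^ j))"
      unfolding sum_distrib_left by (rule sum.swap)
    finally show ?thesis by (simp add: right_diff_distrib sum_subtractf)
  qed
  also have "\<dots> \<in> Q"
  proof (intro prime_inD(3)[OF Q] prime_in_sum[OF Q])
    show "c i * (x ^ i - (\<Sum>j<d. M i j * z ^ j)) \<in> Q" if "i \<in> {..d}" for i
      using c(1) that AB M(2) by (intro prime_inD(4)[OF Q]) auto
    show "z ^ j * (\<Sum>i\<le>d. c i * M i j) \<in> Q" if "j \<in> {..<d}" for j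
      using c(3) that xB' by (intro prime_inD(4)[OF Q]) auto
  qed
  finally have rel: "(\<Sum>i\<le>d. c i * x ^ i) \<in> Q" .
  \<comment> \<open>The terms below \<open>m\<close> lie in \<open>Q\<close> and are dropped. The
    rest has the factor \<open>x ^ m\<close>, and since \<open>x\<close> is not in \<open>Q\<close>,
    primality leaves \<open>c m + x * y\<close> in \<open>Q\<close>.\<close>
  define m where "m = (LEAST i. i \<le> d \<and> c i \<notin> Q)"
  have m: "m \<le> d" "c m \<notin> Q" and min: "\<And>i. i < m \<Longrightarrow> i \<le> d \<Longrightarrow> c i \<in> Q"
  proof -
    have ex: "\<exists>i. i \<le> d \<and> c i \<notin> Q" using c(1,2) by auto
    show "m \<le> d" "c m \<notin> Q" using LeastI_ex[OF ex] by (auto simp: m_def)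
    show "c i \<in> Q" if "i < m" "i \<le> d" for i using not_less_Least[of i] that by (auto simp: m_def)
  qed
  define y where "y = (\<Sum>i\<in>{Suc m..d}. c i * x ^ (i - Suc m))"
  have yB: "y \<in> B"
    unfolding y_def using c(1) AB xB' by (intro is_subring_sum[OF B] is_subringD(5)[OF B]) auto
  have "{..d} = {..<m} \<union> {m..d}" using m by auto
  then have "(\<Sum>i\<le>d. c i * x ^ i) = (\<Sum>i<m. c i * x ^ i) + (\<Sum>i=m..d. c i * x ^ i)"
    by (simp add: sum.union_disjoint ivl_disj_int)
  moreover have "(\<Sum>i<m. c i * x ^ i) \<in> Q"
  proof (rule prime_in_sum[OF Q])
    show "c i * x ^ i \<in> Q" if "i \<in> {..<m}" for i
      using prime_inD(4)[OF Q xB'(1)[of i] min[of i]] that m by (simp add: mult.commute)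
  qed
  ultimately have "(\<Sum>i=m..d. c i * x ^ i) \<in> Q"
    using prime_in_diff[OF B Q rel] by fastforce
  also have "(\<Sum>i=m..d. c i * x ^ i) = x ^ m * (c m + x * y)"
  proof -
    have "(\<Sum>i=m..d. c i * x ^ i) = c m * x ^ m + (\<Sum>i=Suc m..d. c i * x ^ i)"
      using m(1) by (rule sum.atLeast_Suc_atMost)
    also have "(\<Sum>i=Suc m..d. c i * x ^ i) = (\<Sum>i=Suc m..d. x ^ Suc m * (c i * x ^ (i - Suc m)))"
    proof (rule sum.cong[OF refl])
      fix i assume "i \<in> {Suc m..d}"
      then have "x ^ i = x ^ Suc m * x ^ (i - Suc m)" by (simp only: power_add[symmetric]) simp
      then show "c i * x ^ i = x ^ Suc m * (c i * x ^ (i - Suc m))" by (simp only: mult_ac)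
    qed
    also have "\<dots> = x ^ Suc m * y" by (simp add: y_def sum_distrib_left)
    finally show ?thesis by (simp add: algebra_simps del: ideal.scale_scale)
  qed
  finally have "x ^ m \<in> Q \<or> c m + x * y \<in> Q"
    using xB' yB xB c(1) m(1) AB
    by (intro prime_inD(6)[OF Q] is_subringD[OF B]) auto
  then have "c m + x * y \<in> Q'"
    using prime_in_power[OF B Q xB] x(2) sub by blast
  moreover have "x * y \<in> Q'" using prime_inD(4)[OF Q' yB x(1)] by (simp add: mult.commute)
  \<comment> \<open>As \<open>x\<close> lies in \<open>Q'\<close>, so does \<open>c m\<close>; being
    in \<open>A\<close>, it lies in \<open>Q\<close> by equality of the contractions, against the
    choice of \<open>m\<close>.\<close>
  ultimately have "c m \<in> Q'" using prime_in_diff[OF B Q', of "c m + x * y" "x * y"] by simp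
  with eq c(1) m show False by auto
qed

text \<open>Only the lowest member and the number of strict inclusions are recorded: chains are
  extended downwards, and only their length is bounded.\<close>

inductive prime_chain :: "'a::comm_ring_1 set \<Rightarrow> 'a set \<Rightarrow> nat \<Rightarrow> bool" for A where
  zero: "prime_in A Q \<Longrightarrow> prime_chain A Q 0"
| Suc: "prime_in A Q \<Longrightarrow> Q \<subset> Q' \<Longrightarrow> prime_chain A Q' l \<Longrightarrow> prime_chain A Q (Suc l)"

lemma prime_chain_prime: "prime_chain A Q l \<Longrightarrow> prime_in A Q"
  by (cases rule: prime_chain.cases) auto

subsection \<open>Polynomials over infinite fields\<close>

text \<open>Over a finite field, the product of all X - a, increased by 1, is nonconstant without a
  root.\<close>

lemma infinite_UNIV_alg_closed: "infinite (UNIV :: 'k::alg_closed_field set)"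
proof
  assume fin: "finite (UNIV :: 'k set)"
  let ?q = "\<Prod>a\<in>(UNIV :: 'k set). [:- a, 1:]"
  have "degree ?q = card (UNIV :: 'k set)"
    by (subst degree_prod_eq_sum_degree) auto
  then have "degree ?q > 0" using fin by (simp add: card_gt_0_iff)
  then have "degree (?q + [:1:]) > 0"
    by (subst degree_add_eq_left) auto
  then obtain x where "poly (?q + [:1:]) x = 0"
    using alg_closed_imp_poly_has_root by blast
  moreover have "poly ?q x = 0" using fin by (auto simp: poly_prod)
  ultimately show False by simp
qed

text \<open>Reduction modulo \<open>D\<close> isolates the lowest digit; the other digits follow by
  induction.\<close>

lemma radix_inject:
  fixes a b :: "nat \<Rightarrow> nat"
  assumes "\<And>i. i < n \<Longrightarrow> a i < D" "\<And>i. i < n \<Longrightarrow> b i < D"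
    and "(\<Sum>i<n. a i * D ^ i) = (\<Sum>i<n. b i * D ^ i)" and "i < n"
  shows "a i = b i"
  using assms
proof (induction n arbitrary: a b i)
  case (Suc n)
  have split: "(\<Sum>i<Suc n. c i * D ^ i) = c 0 + D * (\<Sum>i<n. c (Suc i) * D ^ i)" for c
    unfolding sum.lessThan_Suc_shift by (simp add: sum_distrib_left mult_ac del: ideal.scale_scale)
  have ab: "a 0 < D" "b 0 < D" using Suc.prems by auto
  have eq: "a 0 + D * (\<Sum>i<n. a (Suc i) * D ^ i) = b 0 + D * (\<Sum>i<n. b (Suc i) * D ^ i)"
    using Suc.prems(3) unfolding split .
  have 0: "a 0 = b 0" using arg_cong[OF eq, of "\<lambda>x. x mod D"] ab by simp
  then have "(\<Sum>i<n. a (Suc i) * D ^ i) = (\<Sum>i<n. b (Suc i) * D ^ i)" using eq ab by simp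
  then have "j < n \<Longrightarrow> a (Suc j) = b (Suc j)" for j
    using Suc.IH[of "\<lambda>i. a (Suc i)" "\<lambda>i. b (Suc i)" j] Suc.prems(1,2) by simp
  with 0 Suc.prems(4) show ?case by (cases i) auto
qed simp

text \<open>Kronecker substitution: \<open>x v = t ^ D ^ h v\<close> separates the monomials in \<open>E\<close>.\<close>

lemma exists_nonvanishing:
  fixes c :: "('v::finite \<Rightarrow>\<^sub>0 nat) \<Rightarrow> 'k::field"
  assumes "infinite (UNIV :: 'k set)" "finite E" "e \<in> E" "c e \<noteq> 0"
  obtains x where "\<And>v. x v \<noteq> 0" "(\<Sum>e\<in>E. c e * mon x e) \<noteq> 0"
proof -
  \<comment> \<open>Larger than every exponent occurring in \<open>E\<close>, so that the exponents
    are the digits of \<open>code e\<close> in base \<open>D\<close>.\<close>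
  define D where "D = Suc (\<Sum>e\<in>E. edeg e)"
  have D: "Poly_Mapping.lookup e v < D" if "e \<in> E" for e v
    using lookup_le_edeg[of e v] member_le_sum[OF that, of edeg] assms(2) by (simp add: D_def)
  obtain h :: "'v \<Rightarrow> nat" where h: "bij_betw h UNIV {..<card (UNIV :: 'v set)}"
    using ex_bij_betw_finite_nat[of "UNIV :: 'v set"] by (auto simp: atLeast0LessThan)
  define code where "code = (\<lambda>e :: 'v \<Rightarrow>\<^sub>0 nat. \<Sum>v\<in>UNIV. Poly_Mapping.lookup e v * D ^ h v)"
  have inv_h: "inv h (h v) = v" for v using h by (simp add: bij_betw_def)
  have code: "code e = (\<Sum>i<card (UNIV :: 'v set). Poly_Mapping.lookup e (inv h i) * D ^ i)" for e
    unfolding code_def sum.reindex_bij_betw[OF h, symmetric] by (simp add: inv_h)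
  have inj: "inj_on code E"
  proof (rule inj_onI, rule poly_mapping_eqI)
    fix e g v assume eg: "e \<in> E" "g \<in> E" "code e = code g"
    have "h v < card (UNIV :: 'v set)" using h by (auto simp: bij_betw_def)
    then have "Poly_Mapping.lookup e (inv h (h v)) = Poly_Mapping.lookup g (inv h (h v))"
      using radix_inject[of "card (UNIV :: 'v set)" "\<lambda>i. Poly_Mapping.lookup e (inv h i)" D
          "\<lambda>i. Poly_Mapping.lookup g (inv h i)" "h v"] D eg code by auto
    then show "Poly_Mapping.lookup e v = Poly_Mapping.lookup g v" by (simp add: inv_h)
  qed
  define p where "p = (\<Sum>e\<in>E. Polynomial.monom (c e) (code e))"
  have "poly.coeff p (code e) = (\<Sum>g\<in>E. if g = e then c e else 0)"
    unfolding p_def coeff_sum using inj assms(3) by (intro sum.cong) (auto simp: inj_on_def)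
  then have "p \<noteq> 0" using assms(2-4) by auto
  then have "finite ({t. poly p t = 0} \<union> {0})" using poly_roots_finite by blast
  then obtain t where t: "poly p t \<noteq> 0" "t \<noteq> 0"
    using ex_new_if_finite[OF assms(1)] by blast
  define x where "x = (\<lambda>v. t ^ (D ^ h v))"
  have "mon x e = t ^ code e" for e
    by (simp add: mon_def x_def code_def power_sum power_mult[symmetric] mult.commute del: ideal.scale_scale)
  then have "(\<Sum>e\<in>E. c e * mon x e) = poly p t"
    by (simp add: p_def poly_sum poly_monom)
  with t that[of x] show ?thesis by (simp add: x_def)
qed

subsection \<open>Noether normalization\<close>

lemma mon_on:
  assumes "\<And>v. v \<in> V \<Longrightarrow> x v \<in> mfps_on W" "Poly_Mapping.keys g \<subseteq> V"
  shows "mon x g \<in> mfps_on W"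
proof -
  have "(\<Prod>v\<in>K. x v ^ Poly_Mapping.lookup g v) \<in> mfps_on W" if "K \<subseteq> V" for K
    using finite[of K] that
    by (induction K rule: finite_induct)
       (auto intro!: is_subringD[OF is_subring_mfps_on] is_subring_power[OF is_subring_mfps_on] assms(1))
  then show ?thesis using assms(2) by (simp add: mon_keys)
qed

lemma (in substitution) subst_on:
  assumes "\<And>v. v \<in> V \<Longrightarrow> x v \<in> mfps_on W" "F \<in> mfps_on V"
  shows "mfps_subst x F \<in> mfps_on W"
  unfolding mfps_on_def
proof (intro CollectI allI impI)
  fix e assume "mfps_nth (mfps_subst x F) e \<noteq> 0"
  then obtain g where "mfps_nth F g * mfps_nth (mon x g) e \<noteq> 0"
    unfolding nth_subst_le[OF order_refl] by (metis (no_types, lifting) sum.neutral)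
  then have g: "mfps_nth F g \<noteq> 0" "mfps_nth (mon x g) e \<noteq> 0" by auto
  have "Poly_Mapping.keys g \<subseteq> V" using g(1) assms(2) mfps_onD by blast
  with assms(1) have "mon x g \<in> mfps_on W" by (rule mon_on)
  with g(2) show "Poly_Mapping.keys e \<subseteq> W" by (auto simp: mfps_on_def)
qed

lemma prime_in_vimage:
  assumes "prime_in B Q" "is_subring A" "\<And>a. a \<in> A \<Longrightarrow> h a \<in> B"
    and "h 0 = 0" "h 1 = 1" "\<And>a b. h (a + b) = h a + h b" "\<And>a b. h (a * b) = h a * h b"
  shows "prime_in A {a \<in> A. h a \<in> Q}"
  unfolding prime_in_def
proof (intro conjI ballI impI)
  show "a + b \<in> {a \<in> A. h a \<in> Q}" if "a \<in> {a \<in> A. h a \<in> Q}" "b \<in> {a \<in> A. h a \<in> Q}" for a b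
    using that prime_inD(3)[OF assms(1)] is_subringD(3)[OF assms(2)] by (auto simp: assms(6))
  show "a * b \<in> {a \<in> A. h a \<in> Q}" if "a \<in> A" "b \<in> {a \<in> A. h a \<in> Q}" for a b
    using that prime_inD(4)[OF assms(1)] is_subringD(5)[OF assms(2)] assms(3) by (auto simp: assms(7))
  show "a \<in> {a \<in> A. h a \<in> Q} \<or> b \<in> {a \<in> A. h a \<in> Q}"
    if "a \<in> A" "b \<in> A" "a * b \<in> {a \<in> A. h a \<in> Q}" for a b
    using that prime_inD(6)[OF assms(1), of "h a" "h b"] assms(3) by (auto simp: assms(7))
qed (use prime_inD(2,5)[OF assms(1)] is_subringD(1)[OF assms(2)] assms(4,5) in auto)

text \<open>Setting all variables other than \<open>v\<close> to 0 is a ring homomorphism to series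
  in one variable, because a power of \<open>v\<close> splits only into powers of \<open>v\<close>.
  Hence it commutes with \<open>mon\<close>.\<close>

lemma fps_along_variable:
  fixes x :: "'w::finite \<Rightarrow> ('k::comm_ring_1, 'v::finite) mfps"
  shows "Abs_fps (\<lambda>n. mfps_nth (mon x g) (Poly_Mapping.single v n))
    = mon (\<lambda>w. Abs_fps (\<lambda>n. mfps_nth (x w) (Poly_Mapping.single v n))) g"
proof -
  let ?h = "\<lambda>F :: ('k, 'v) mfps. Abs_fps (\<lambda>n. mfps_nth F (Poly_Mapping.single v n))"
  have one: "?h 1 = 1"
    by (rule fps_ext) (auto simp: mfps_nth_one poly_mapping_eq_iff fun_eq_iff lookup_single when_def)
  have mult: "?h (F * G) = ?h F * ?h G" for F G
  proof (rule fps_ext)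
    fix n
    let ?s = "Poly_Mapping.single v :: nat \<Rightarrow> 'v \<Rightarrow>\<^sub>0 nat"
    have "(\<Sum>(p, q) | p + q = ?s n. mfps_nth F p * mfps_nth G q)
      = (\<Sum>i=0..n. mfps_nth F (?s i) * mfps_nth G (?s (n - i)))"
    proof (rule sum.reindex_bij_witness[where i = "\<lambda>i. (?s i, ?s (n - i))" and j = "\<lambda>(p, q). edeg p"])
      fix y assume "y \<in> {(p, q). p + q = ?s n}"
      then obtain p q where y: "y = (p, q)" "p + q = ?s n" by auto
      have "Poly_Mapping.lookup p w + Poly_Mapping.lookup q w = (if w = v then n else 0)" for w
        using arg_cong[OF y(2), of "\<lambda>e. Poly_Mapping.lookup e w"]
        by (auto simp: lookup_add lookup_single when_def)
      then have "p = ?s (Poly_Mapping.lookup p v)" "q = ?s (Poly_Mapping.lookup q v)"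
        by (auto intro!: poly_mapping_eqI simp: lookup_single when_def)
          (metis add_is_0)+
      then obtain i j where ij: "p = ?s i" "q = ?s j" by blast
      have "i + j = n" using arg_cong[OF y(2), of edeg] ij by simp
      then show "(case y of (p, q) \<Rightarrow> edeg p) \<in> {0..n}"
        "(?s (case y of (p, q) \<Rightarrow> edeg p), ?s (n - (case y of (p, q) \<Rightarrow> edeg p))) = y"
        "mfps_nth F (?s (case y of (p, q) \<Rightarrow> edeg p)) * mfps_nth G (?s (n - (case y of (p, q) \<Rightarrow> edeg p)))
          = (case y of (p, q) \<Rightarrow> mfps_nth F p * mfps_nth G q)"
        using y ij by auto
    qed (auto simp: single_add[symmetric])
    then show "fps_nth (?h (F * G)) n = fps_nth (?h F * ?h G) n"
      by (simp add: mfps_nth_mult fps_mult_nth)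
  qed
  show ?thesis
    by (induction g rule: mon_induct) (simp_all add: one mon_add mult)
qed


text \<open>The lowest form of \<open>f\<close> is nonzero at some point \<open>x\<close>, the field
  being infinite. A linear change that puts \<open>x\<close> on the axis of \<open>v\<close> turns
  this value into the coefficient of a pure power of \<open>v\<close>.\<close>

lemma regular_after_coordinate_change:
  fixes f :: "('k::field, 'v::finite) mfps"
  assumes "infinite (UNIV :: 'k set)" "f \<noteq> 0" "f \<in> mfps_on (insert v V)"
  obtains t t' :: "'v \<Rightarrow> ('k, 'v) mfps" and d
  where "substitution t" "substitution t'" "\<And>F. mfps_subst t' (mfps_subst t F) = F"
    and "\<And>F. F \<in> mfps_on (insert v V) \<Longrightarrow> mfps_subst t F \<in> mfps_on (insert v V)"
    and "\<And>F. F \<in> mfps_on (insert v V) \<Longrightarrow> mfps_subst t' F \<in> mfps_on (insert v V)"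
    and "mfps_nth (mfps_subst t f) (Poly_Mapping.single v d) \<noteq> 0"
    and "\<And>j. j < d \<Longrightarrow> mfps_nth (mfps_subst t f) (Poly_Mapping.single v j) = 0"
proof -
  let ?V = "insert v V"
  have ex: "\<exists>d e. edeg e = d \<and> mfps_nth f e \<noteq> 0"
    using assms(2) mfps_eqI[of f 0] by auto
  define d where "d = (LEAST d. \<exists>e. edeg e = d \<and> mfps_nth f e \<noteq> 0)"
  obtain e where e: "edeg e = d" "mfps_nth f e \<noteq> 0"
    using LeastI_ex[OF ex] by (auto simp: d_def)
  have low: "mfps_nth f e = 0" if "edeg e < d" for e
    using not_less_Least[of "edeg e" "\<lambda>d. \<exists>e. edeg e = d \<and> mfps_nth f e \<noteq> 0"] that unfolding d_def by blast
  obtain x where x: "\<And>w. x w \<noteq> 0" "(\<Sum>e | edeg e = d. mfps_nth f e * mon x e) \<noteq> 0"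
    using exists_nonvanishing[OF assms(1) finite_edeg_eq, of e d "mfps_nth f"] e by blast
  define t :: "'v \<Rightarrow> ('k, 'v) mfps" where "t = (\<lambda>w. if w = v then mfps_const (x v) * mfps_X v
      else if w \<in> V then mfps_X w + mfps_const (x w) * mfps_X v else mfps_X w)"
  \<comment> \<open>The inverse of \<open>t\<close>; it divides by \<open>x v\<close>, which is why
    \<open>x\<close> is chosen with nonzero coordinates.\<close>
  define t' :: "'v \<Rightarrow> ('k, 'v) mfps" where "t' = (\<lambda>w. if w = v then mfps_const (1 / x v) * mfps_X v
      else if w \<in> V then mfps_X w - mfps_const (x w / x v) * mfps_X v else mfps_X w)"
  have single_neq: "Poly_Mapping.single w (Suc 0) \<noteq> (0 :: 'v \<Rightarrow>\<^sub>0 nat)" for w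
    by (simp flip: edeg_eq_0_iff)
  interpret t: substitution t
    by standard (use single_neq in \<open>auto simp: mfps_order_ge_def t_def mfps_nth_X\<close>)
  interpret t': substitution t'
    by standard (use single_neq in \<open>auto simp: mfps_order_ge_def t'_def mfps_nth_X\<close>)
  note sub = is_subringD[OF is_subring_mfps_on[of ?V]] mfps_const_on mfps_X_on
  have t_on: "t w \<in> mfps_on ?V" "t' w \<in> mfps_on ?V" if "w \<in> ?V" for w
    using that by (auto simp: t_def t'_def intro!: sub)
  have inverse: "mfps_subst t' (t w) = mfps_X w" for w
  proof -
    have [simp]: "mfps_const (x v) * (mfps_const (1 / x v) * mfps_X v) = mfps_X v"
      "mfps_const (x w) * (mfps_const (1 / x v) * mfps_X v) = mfps_const (x w / x v) * mfps_X v" for w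
      by (rule mfps_eqI, simp add: x(1) del: ideal.scale_scale)+
    show ?thesis
      by (auto simp: t_def t'.subst_add t'.subst_const_mult simp del: ideal.scale_scale)
        (auto simp: t'_def x(1) simp del: ideal.scale_scale)
  qed
  \<comment> \<open>On the axis of \<open>v\<close> each \<open>t w\<close> restricts to
    \<open>x w\<close> times the variable, so a monomial contributes its value at \<open>x\<close>,
    and only in its own degree.\<close>
  have mon_t: "mfps_nth (mon t g) (Poly_Mapping.single v j) = (if edeg g = j then mon x g else 0)"
    if g: "Poly_Mapping.keys g \<subseteq> ?V" for g j
  proof -
    have "Abs_fps (\<lambda>n. mfps_nth (t w) (Poly_Mapping.single v n)) = fps_X * fps_const (x w)" if "w \<in> ?V" for w
    proof (rule fps_ext)
      fix n
      have "Poly_Mapping.single v n = Poly_Mapping.single w (1::nat) \<longleftrightarrow> n = 1 \<and> w = v"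
        by (auto simp: poly_mapping_eq_iff fun_eq_iff lookup_single when_def split: if_splits)
      moreover have "Poly_Mapping.single v n = Poly_Mapping.single v (1::nat) \<longleftrightarrow> n = 1"
        by (auto simp: poly_mapping_eq_iff fun_eq_iff lookup_single when_def split: if_splits)
      ultimately show "fps_nth (Abs_fps (\<lambda>n. mfps_nth (t w) (Poly_Mapping.single v n))) n
          = fps_nth (fps_X * fps_const (x w)) n"
        using that by (auto simp: t_def mfps_nth_X)
    qed
    then have "Abs_fps (\<lambda>n. mfps_nth (mon t g) (Poly_Mapping.single v n))
        = mon (\<lambda>w. fps_X * fps_const (x w)) g"
      unfolding fps_along_variable unfolding mon_keys using g by (intro prod.cong) auto
    also have "\<dots> = fps_X ^ edeg g * mon (\<lambda>w. fps_const (x w)) g" by (rule mon_scale)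
    also have "mon (\<lambda>w. fps_const (x w)) g = fps_const (mon x g)"
      by (induction g rule: mon_induct) (simp_all add: mon_add)
    finally have "fps_nth (Abs_fps (\<lambda>n. mfps_nth (mon t g) (Poly_Mapping.single v n))) j
        = fps_nth (fps_X ^ edeg g * fps_const (mon x g)) j" by simp
    then show ?thesis by auto
  qed
  have coeff: "mfps_nth (mfps_subst t f) (Poly_Mapping.single v j)
      = (\<Sum>g | edeg g = j. mfps_nth f g * mon x g)" for j
  proof -
    have "mfps_nth (mfps_subst t f) (Poly_Mapping.single v j)
        = (\<Sum>g | edeg g \<le> j. mfps_nth f g * mfps_nth (mon t g) (Poly_Mapping.single v j))"
      by (rule t.nth_subst_le) simp
    also have "\<dots> = (\<Sum>g | edeg g \<le> j. if edeg g = j then mfps_nth f g * mon x g else 0)"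
    proof (rule sum.cong[OF refl])
      fix g
      have "mfps_nth f g = 0 \<or> Poly_Mapping.keys g \<subseteq> ?V" using mfps_onD[OF assms(3)] by blast
      then show "mfps_nth f g * mfps_nth (mon t g) (Poly_Mapping.single v j)
          = (if edeg g = j then mfps_nth f g * mon x g else 0)"
        by (elim disjE) (simp_all only: mon_t, simp_all)
    qed
    also have "\<dots> = (\<Sum>g | edeg g = j. mfps_nth f g * mon x g)"
      by (subst sum.inter_filter[symmetric]) (auto simp: finite_edeg_le intro!: sum.cong)
    finally show ?thesis .
  qed
  show ?thesis
  proof
    show "mfps_subst t' (mfps_subst t F) = F" for F
      by (rule subst_subst_eq) (fact t.substitution_axioms t'.substitution_axioms inverse)+
    show "mfps_nth (mfps_subst t f) (Poly_Mapping.single v d) \<noteq> 0"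
      using x(2) by (simp add: coeff)
    show "mfps_nth (mfps_subst t f) (Poly_Mapping.single v j) = 0" if "j < d" for j
      using that by (simp add: coeff low)
    show "mfps_subst t F \<in> mfps_on ?V" "mfps_subst t' F \<in> mfps_on ?V" if "F \<in> mfps_on ?V" for F
      using that t_on by (intro t.subst_on t'.subst_on; blast)+
  qed (fact t.substitution_axioms t'.substitution_axioms)+
qed

text \<open>After the change of coordinates \<open>f\<close> is regular in \<open>v\<close>, so
  modulo \<open>f\<close> every series is a polynomial in \<open>v\<close> of degree below
  \<open>d\<close> over \<open>mfps_on V\<close>. All members of the chain contain \<open>f\<close>,
  so its strict inclusions survive contraction.\<close>

lemma prime_chain_contraction:
  fixes f :: "('k::field, 'v::finite) mfps"
  assumes "infinite (UNIV :: 'k set)" "v \<notin> V" "f \<noteq> 0"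
    and "prime_chain (mfps_on (insert v V)) Q l" "f \<in> Q"
  shows "\<exists>P. prime_chain (mfps_on V :: ('k, 'v) mfps set) P l"
proof -
  let ?B = "mfps_on (insert v V) :: ('k, 'v) mfps set" and ?A = "mfps_on V :: ('k, 'v) mfps set"
  have "f \<in> ?B" using prime_inD(1)[OF prime_chain_prime] assms(4,5) by blast
  then obtain t t' d where "substitution t" "substitution t'"
    and inv: "\<And>F. mfps_subst t' (mfps_subst t F) = F"
    and on: "\<And>F. F \<in> ?B \<Longrightarrow> mfps_subst t F \<in> ?B" "\<And>F. F \<in> ?B \<Longrightarrow> mfps_subst t' F \<in> ?B"
    and regular: "mfps_nth (mfps_subst t f) (Poly_Mapping.single v d) \<noteq> 0"
      "\<And>j. j < d \<Longrightarrow> mfps_nth (mfps_subst t f) (Poly_Mapping.single v j) = 0"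
    using regular_after_coordinate_change[OF assms(1,3)] by metis
  interpret t: substitution t by fact
  interpret t': substitution t' by fact
  note B = is_subring_mfps_on[of "insert v V"]
  \<comment> \<open>The preimage under the inverse change, so that for \<open>h\<close> in
    \<open>?B\<close>, \<open>mfps_subst t h\<close> lies in \<open>c Q\<close> exactly when
    \<open>h\<close> lies in \<open>Q\<close>.\<close>
  define c where "c = (\<lambda>Q. {F \<in> ?B. mfps_subst t' F \<in> Q})"
  have prime: "prime_in ?B (c Q)" if "prime_in ?B Q" for Q
    unfolding c_def using that B on(2) t'.subst_0 t'.subst_1 t'.subst_add t'.subst_mult
    by (rule prime_in_vimage)
  have restrict: "prime_in ?A (c Q \<inter> ?A)" if "prime_in ?B Q" for Q
  proof -
    have sub: "?A \<subseteq> ?B" by (rule mfps_on_mono) auto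
    then have "prime_in ?A {F \<in> ?A. id F \<in> c Q}"
      by (intro prime_in_vimage[OF prime[OF that] is_subring_mfps_on]) auto
    moreover have "{F \<in> ?A. id F \<in> c Q} = c Q \<inter> ?A" by auto
    ultimately show ?thesis by simp
  qed
  have step: "c Q \<inter> ?A \<subset> c Q' \<inter> ?A"
    if Q: "prime_in ?B Q" "prime_in ?B Q'" "Q \<subset> Q'" "f \<in> Q" for Q Q'
  proof (rule contraction_psubset[OF is_subring_mfps_on B _ prime[OF Q(1)] prime[OF Q(2)], where z = "mfps_X v" and d = d])
    show "?A \<subseteq> ?B" by (rule mfps_on_mono) auto
    show "mfps_X v \<in> ?B" by (simp add: mfps_X_on)
    obtain h where h: "h \<in> Q'" "h \<notin> Q" using Q(3) by blast
    then have "mfps_subst t h \<in> c Q' - c Q"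
      using prime_inD(1)[OF Q(2)] on(1) by (auto simp: c_def inv)
    then show "c Q \<subset> c Q'" using Q(3) by (auto simp: c_def)
    fix F assume F: "F \<in> ?B"
    obtain q where q: "q \<in> ?B"
      "\<And>e. mfps_nth (F - q * mfps_subst t f) (e + Poly_Mapping.single v d) = 0"
      using weierstrass_division[OF F on(1)[OF \<open>f \<in> ?B\<close>] insertI1 regular] by blast
    have qB: "q * mfps_subst t f \<in> ?B"
      using is_subringD(5)[OF B] q(1) on(1) \<open>f \<in> ?B\<close> by blast
    then have "F - q * mfps_subst t f \<in> ?B" using is_subringD(4)[OF B] F by blast
    then obtain k where k: "\<And>j. k j \<in> ?A" "F - q * mfps_subst t f = (\<Sum>j<d. k j * mfps_X v ^ j)"
      using mfps_on_polynomial[OF _ assms(2) q(2)] by blast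
    \<comment> \<open>The multiple of the divisor is pulled back to a multiple of \<open>f\<close>,
      so \<open>F\<close> agrees with its remainder modulo \<open>c Q\<close>.\<close>
    have "mfps_subst t' (q * mfps_subst t f) \<in> Q"
      unfolding t'.subst_mult inv using prime_inD(4)[OF Q(1)] on(2) q(1) Q(4) by blast
    moreover have "F - (\<Sum>j<d. k j * mfps_X v ^ j) = q * mfps_subst t f" unfolding k(2)[symmetric] by simp
    ultimately show "\<exists>k. (\<forall>j. k j \<in> ?A) \<and> F - (\<Sum>j<d. k j * mfps_X v ^ j) \<in> c Q"
      using k(1) qB by (intro exI[of _ k]) (auto simp: c_def)
  qed
  have "prime_chain ?A (c Q \<inter> ?A) l"
    using assms(4,5)
  proof (induction rule: prime_chain.induct)
    case (zero Q)
    then show ?case by (intro prime_chain.zero restrict)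
  next
    case (Suc Q Q' l)
    then show ?case
      by (intro prime_chain.Suc[OF restrict step]) (auto intro: prime_chain_prime)
  qed
  then show ?thesis by blast
qed

text \<open>The second member of a chain contains a nonzero element, so the chain from there on
  contracts to one variable less; only the lowest inclusion is lost. Without variables the ring is a
  field, whose only prime is zero.\<close>

theorem prime_chain_mfps_on_le:
  fixes Q :: "('k::field, 'v::finite) mfps set"
  assumes "infinite (UNIV :: 'k set)" "prime_chain (mfps_on V) Q l"
  shows "l \<le> card V"
  using finite[of V] assms(2)
proof (induction V arbitrary: Q l rule: finite_induct)
  case empty
  show ?case
    using empty
  proof (cases rule: prime_chain.cases)
    case (Suc Q' m)
    then obtain f where f: "f \<in> Q'" "f \<notin> Q" by blast
    have Q': "prime_in (mfps_on {}) Q'" using Suc(4) by (rule prime_chain_prime)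
    have f_const: "f = mfps_const (mfps_nth f 0)"
      using mfps_on_empty prime_inD(1)[OF Q' f(1)] by blast
    moreover have "f \<noteq> 0" using f(2) prime_inD(2)[OF Suc(2)] by blast
    ultimately have "mfps_nth f 0 \<noteq> 0" by auto
    then have "mfps_const (1 / mfps_nth f 0) * f = 1"
      by (subst f_const) (simp flip: mfps_const_mult)
    then have "1 \<in> Q'"
      using prime_inD(4)[OF Q' mfps_const_on f(1)] by metis
    then show ?thesis using prime_inD(5)[OF Q'] by blast
  qed simp
next
  case (insert v V)
  show ?case
    using insert.prems
  proof (cases rule: prime_chain.cases)
    case (Suc Q' m)
    then obtain f where f: "f \<in> Q'" "f \<notin> Q" by blast
    then have "f \<noteq> 0" using prime_inD(2)[OF Suc(2)] by blast
    then obtain P where "prime_chain (mfps_on V :: ('k, 'v) mfps set) P m"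
      using prime_chain_contraction[OF assms(1) insert.hyps(2) _ Suc(4) f(1)] by blast
    then have "m \<le> card V" by (rule insert.IH)
    then show ?thesis using Suc(1) insert.hyps by simp
  qed simp
qed

section \<open>Analytic dependence of too many power series\<close>

subsection \<open>Two groups of variables\<close>

definition exp_pair :: "('n::finite \<Rightarrow>\<^sub>0 nat) \<Rightarrow> ('w::finite \<Rightarrow>\<^sub>0 nat) \<Rightarrow> ('n + 'w \<Rightarrow>\<^sub>0 nat)" where
  "exp_pair g b = exp_of (case_sum (Poly_Mapping.lookup g) (Poly_Mapping.lookup b))"

lemma lookup_exp_pair [simp]:
  "Poly_Mapping.lookup (exp_pair g b) (Inl i) = Poly_Mapping.lookup g i"
  "Poly_Mapping.lookup (exp_pair g b) (Inr j) = Poly_Mapping.lookup b j"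
  by (simp_all add: exp_pair_def)

lemma exp_pair_cases: obtains g b where "E = exp_pair g b"
proof
  show "E = exp_pair (exp_of (Poly_Mapping.lookup E \<circ> Inl)) (exp_of (Poly_Mapping.lookup E \<circ> Inr))"
  proof (rule poly_mapping_eqI)
    fix v
    show "Poly_Mapping.lookup E v = Poly_Mapping.lookup
        (exp_pair (exp_of (Poly_Mapping.lookup E \<circ> Inl)) (exp_of (Poly_Mapping.lookup E \<circ> Inr))) v"
      by (cases v) auto
  qed
qed

lemma exp_pair_eq_iff [simp]: "exp_pair g b = exp_pair g' b' \<longleftrightarrow> g = g' \<and> b = b'"
proof
  assume eq: "exp_pair g b = exp_pair g' b'"
  have "Poly_Mapping.lookup g i = Poly_Mapping.lookup g' i" for i
    using arg_cong[OF eq, of "\<lambda>E. Poly_Mapping.lookup E (Inl i)"] by simp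
  moreover have "Poly_Mapping.lookup b j = Poly_Mapping.lookup b' j" for j
    using arg_cong[OF eq, of "\<lambda>E. Poly_Mapping.lookup E (Inr j)"] by simp
  ultimately show "g = g' \<and> b = b'" by (auto intro: poly_mapping_eqI)
qed simp

lemma exp_pair_add: "exp_pair (g + g') (b + b') = exp_pair g b + exp_pair g' b'"
proof (rule poly_mapping_eqI)
  fix v
  show "Poly_Mapping.lookup (exp_pair (g + g') (b + b')) v
      = Poly_Mapping.lookup (exp_pair g b + exp_pair g' b') v"
    by (cases v) (simp_all add: lookup_add)
qed

lemma exp_pair_0 [simp]: "exp_pair 0 0 = 0"
proof (rule poly_mapping_eqI)
  fix v :: "'a + 'b"
  show "Poly_Mapping.lookup (exp_pair 0 0) v = Poly_Mapping.lookup 0 v" by (cases v) simp_all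
qed

lemma exp_pair_single:
  "exp_pair (Poly_Mapping.single i n) 0 = Poly_Mapping.single (Inl i) n"
  "exp_pair 0 (Poly_Mapping.single j n) = Poly_Mapping.single (Inr j) n"
proof (rule_tac [!] poly_mapping_eqI)
  fix v :: "'a + 'b"
  show "Poly_Mapping.lookup (exp_pair (Poly_Mapping.single i n) 0) v = Poly_Mapping.lookup (Poly_Mapping.single (Inl i) n) v"
    by (cases v) (simp_all add: lookup_single when_def)
next
  fix v :: "'c + 'd"
  show "Poly_Mapping.lookup (exp_pair 0 (Poly_Mapping.single j n)) v = Poly_Mapping.lookup (Poly_Mapping.single (Inr j) n) v"
    by (cases v) (simp_all add: lookup_single when_def)
qed

lemma sum_UNIV_sum_type:
  fixes h :: "'n::finite + 'w::finite \<Rightarrow> 'a::comm_monoid_add"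
  shows "sum h UNIV = (\<Sum>i\<in>UNIV. h (Inl i)) + (\<Sum>j\<in>UNIV. h (Inr j))"
  by (simp add: sum.Plus UNIV_Plus_UNIV[symmetric] del: UNIV_Plus_UNIV)

lemma edeg_exp_pair [simp]: "edeg (exp_pair g b) = edeg g + edeg b"
  by (simp add: edeg_def sum_UNIV_sum_type)

lemma mon_exp_pair: "mon x (exp_pair g b) = mon (\<lambda>i. x (Inl i)) g * mon (\<lambda>j. x (Inr j)) b"
  unfolding mon_def by (simp add: prod.Plus UNIV_Plus_UNIV[symmetric] del: UNIV_Plus_UNIV)

text \<open>Reads a series in both groups of variables as a series in the second group over series
  in the first.\<close>

definition mfps_component :: "('k::comm_ring_1, 'n::finite + 'w::finite) mfps \<Rightarrow> ('w \<Rightarrow>\<^sub>0 nat) \<Rightarrow> ('k, 'n) mfps" where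
  "mfps_component F b = Abs_mfps (\<lambda>g. mfps_nth F (exp_pair g b))"

lemma mfps_nth_component [simp]: "mfps_nth (mfps_component F b) g = mfps_nth F (exp_pair g b)"
  by (simp add: mfps_component_def)

lemma mfps_component_eq_0:
  fixes F :: "('k::comm_ring_1, 'n::finite + 'w::finite) mfps"
  assumes "\<And>b. mfps_component F b = 0"
  shows "F = 0"
proof (rule mfps_eqI)
  fix E :: "'n + 'w \<Rightarrow>\<^sub>0 nat"
  obtain g b where "E = exp_pair g b" by (rule exp_pair_cases)
  then show "mfps_nth F E = mfps_nth 0 E"
    using arg_cong[OF assms[of b], of "\<lambda>F. mfps_nth F g"] by simp
qed

definition mfps_embed :: "('k::comm_ring_1, 'n::finite) mfps \<Rightarrow> ('k, 'n + 'w::finite) mfps" where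
  "mfps_embed = mfps_subst (\<lambda>i. mfps_X (Inl i))"

lemma mfps_X_order_ge: "mfps_X v \<in> mfps_order_ge 1"
  by (rule substitution.x_order[OF substitution_X])

interpretation embed: substitution "\<lambda>i. mfps_X (Inl i)"
  rewrites "mfps_subst (\<lambda>i. mfps_X (Inl i)) = mfps_embed"
proof -
  show "substitution (\<lambda>i. mfps_X (Inl i))" by standard (rule mfps_X_order_ge)
qed (simp only: mfps_embed_def)

lemma mfps_component_embed:
  fixes h :: "('k::comm_ring_1, 'n::finite) mfps" and b :: "'w::finite \<Rightarrow>\<^sub>0 nat"
  shows "mfps_component (mfps_embed h) b = (if b = 0 then h else 0)"
proof (rule mfps_eqI)
  fix g :: "'n \<Rightarrow>\<^sub>0 nat"
  have "mon (\<lambda>i. mfps_X (Inl i) :: ('k, 'n + 'w) mfps) g' = mfps_monom (exp_pair g' (0 :: 'w \<Rightarrow>\<^sub>0 nat))" for g' :: "'n \<Rightarrow>\<^sub>0 nat"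
    using mon_exp_pair[of "mfps_X :: 'n + 'w \<Rightarrow> ('k, 'n + 'w) mfps" g' "0 :: 'w \<Rightarrow>\<^sub>0 nat"] by (simp add: mon_mfps_X)
  then have "mfps_nth (mfps_component (mfps_embed h) b) g
      = (\<Sum>g' | edeg g' \<le> edeg g + edeg b. if g' = g then if b = 0 then mfps_nth h g else 0 else 0)"
    by (subst mfps_nth_component, subst embed.nth_subst_le[of _ "edeg g + edeg b"])
      (auto simp: mfps_nth_monom intro!: sum.cong)
  also have "\<dots> = mfps_nth (if b = 0 then h else 0) g"
    by (simp add: finite_edeg_le)
  finally show "mfps_nth (mfps_component (mfps_embed h) b) g = mfps_nth (if b = 0 then h else 0) g" .
qed

lemma mfps_component_embed_monom:
  fixes h :: "('k::comm_ring_1, 'n::finite) mfps" and b c :: "'w::finite \<Rightarrow>\<^sub>0 nat"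
  shows "mfps_component (mfps_embed h * mfps_monom (exp_pair 0 c)) b = (if b = c then h else 0)"
proof (rule mfps_eqI)
  fix g
  have "mfps_nth (mfps_monom (exp_pair 0 c) * mfps_embed h) (exp_pair g b)
      = mfps_nth (if b = c then h else 0) g"
  proof (cases "\<exists>H. exp_pair g b = exp_pair 0 c + H")
    case True
    then obtain g' b' where "exp_pair g b = exp_pair 0 c + exp_pair g' b'" by (metis exp_pair_cases)
    then have gb: "g = g'" "b = c + b'" by (simp_all flip: exp_pair_add)
    have "mfps_nth (mfps_monom (exp_pair 0 c) * mfps_embed h) (exp_pair 0 c + exp_pair g' b')
        = mfps_nth (mfps_component (mfps_embed h) b') g'"
      by simp
    then show ?thesis unfolding mfps_component_embed by (simp add: gb exp_pair_add[symmetric])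
  next
    case False
    then have "b \<noteq> c" using exp_pair_add[of 0 g c 0] by auto
    then show ?thesis using False by (subst mfps_nth_monom_mult_0) auto
  qed
  then show "mfps_nth (mfps_component (mfps_embed h * mfps_monom (exp_pair 0 c)) b) g
      = mfps_nth (if b = c then h else 0) g"
    by (simp add: mult.commute)
qed

text \<open>One family for all maps used below: with \<open>p\<close> constant, \<open>a j\<close>
  times a single variable is substituted, and the kernel holds the relations between the
  \<open>a j\<close>; with \<open>p\<close> the identity the variables are merely rescaled.\<close>

definition scaling :: "('w::finite \<Rightarrow> ('k::comm_ring_1, 'n::finite) mfps) \<Rightarrow> ('w \<Rightarrow> 'w) \<Rightarrow> 'n + 'w \<Rightarrow> ('k, 'n + 'w) mfps" where
  "scaling a p v = (case v of Inl i \<Rightarrow> mfps_X (Inl i) | Inr j \<Rightarrow> mfps_embed (a j) * mfps_X (Inr (p j)))"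

lemma scaling_simps [simp]:
  "scaling a p (Inl i) = mfps_X (Inl i)"
  "scaling a p (Inr j) = mfps_embed (a j) * mfps_X (Inr (p j))"
  by (simp_all add: scaling_def)

lemma substitution_scaling:
  fixes a :: "'w::finite \<Rightarrow> ('k::comm_ring_1, 'n::finite) mfps"
  shows "substitution (scaling a p)"
proof
  fix v
  have "mfps_nth (mfps_X w :: ('k, 'n + 'w) mfps) 0 = 0" for w
    using mfps_X_order_ge[of w] by (simp only: mfps_order_ge_1_iff)
  then show "scaling a p v \<in> mfps_order_ge 1"
    unfolding mfps_order_ge_1_iff by (cases v) (auto simp: mfps_nth_mult_0)
qed

definition exp_push :: "('w::finite \<Rightarrow> 'w) \<Rightarrow> ('w \<Rightarrow>\<^sub>0 nat) \<Rightarrow> ('w \<Rightarrow>\<^sub>0 nat)" where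
  "exp_push p b = (\<Sum>j\<in>UNIV. Poly_Mapping.single (p j) (Poly_Mapping.lookup b j))"

lemma edeg_exp_push [simp]: "edeg (exp_push p b) = edeg b"
proof -
  have "edeg (\<Sum>j\<in>J. Poly_Mapping.single (p j) (Poly_Mapping.lookup b j)) = (\<Sum>j\<in>J. Poly_Mapping.lookup b j)" for J
    by (induction J rule: infinite_finite_induct) auto
  then show ?thesis by (simp add: exp_push_def edeg_def)
qed

lemma mon_scaling:
  fixes a :: "'w::finite \<Rightarrow> ('k::comm_ring_1, 'n::finite) mfps"
  shows "mon (scaling a p) (exp_pair g b) = mfps_embed (mfps_monom g * mon a b) * mfps_monom (exp_pair 0 (exp_push p b))"
proof -
  have "mon (\<lambda>j. mfps_X (Inr (p j)) :: ('k, 'n + 'w) mfps) b = mfps_monom (exp_pair 0 (exp_push p b))"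
  proof -
    have "(\<Prod>j\<in>J. (mfps_X (Inr (p j)) :: ('k, 'n + 'w) mfps) ^ Poly_Mapping.lookup b j)
        = mfps_monom (exp_pair 0 (\<Sum>j\<in>J. Poly_Mapping.single (p j) (Poly_Mapping.lookup b j)))" for J
    proof (induction J rule: infinite_finite_induct)
      case (insert j J)
      have "(mfps_X (Inr (p j)) :: ('k, 'n + 'w) mfps) ^ Poly_Mapping.lookup b j
          = mfps_monom (exp_pair 0 (Poly_Mapping.single (p j) (Poly_Mapping.lookup b j)))"
        by (simp add: exp_pair_single mon_mfps_X[symmetric])
      then show ?case
        using insert exp_pair_add[of 0 0] by (simp add: mfps_monom_add[symmetric] exp_pair_add[symmetric])
    qed auto
    then show ?thesis by (simp add: mon_def exp_push_def)
  qed
  moreover have "mon (\<lambda>i. mfps_X (Inl i) :: ('k, 'n + 'w) mfps) g = mfps_embed (mfps_monom g)"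
    by (simp add: embed.subst_monom)
  moreover have "mon (\<lambda>j. mfps_embed (a j) :: ('k, 'n + 'w) mfps) b = mfps_embed (mon a b)"
    by (simp add: embed.subst_mon)
  ultimately show ?thesis
    unfolding mon_exp_pair scaling_simps embed.subst_mult
    by (simp add: mon_def power_mult_distrib prod.distrib mult.assoc del: ideal.scale_scale)
qed

text \<open>Renaming variables preserves the degree, so only finitely many \<open>b\<close> land on
  \<open>d\<close>. This is also why the relations obtained later are homogeneous.\<close>

lemma mfps_component_scaling:
  fixes a :: "'w::finite \<Rightarrow> ('k::comm_ring_1, 'n::finite) mfps"
  shows "mfps_component (mfps_subst (scaling a p) F) d
    = (\<Sum>b | exp_push p b = d. mfps_component F b * mon a b)"
proof (rule mfps_eqI)
  fix e :: "'n \<Rightarrow>\<^sub>0 nat"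
  interpret substitution "scaling a p" by (rule substitution_scaling)
  define N where "N = edeg e + edeg d"
  let ?G = "{g :: 'n \<Rightarrow>\<^sub>0 nat. edeg g \<le> N}" and ?B = "{b :: 'w \<Rightarrow>\<^sub>0 nat. edeg b \<le> N}"
  have fin: "finite ?G" "finite ?B" by (rule finite_edeg_le)+
  have B: "{b \<in> ?B. exp_push p b = d} = {b. exp_push p b = d}"
    using edeg_exp_push[of p] by (auto simp: N_def)
  have "mfps_nth (mfps_component (mfps_subst (scaling a p) F) d) e
      = (\<Sum>E\<in>(\<lambda>(b, g). exp_pair g b) ` (?B \<times> ?G). mfps_nth F E * mfps_nth (mon (scaling a p) E) (exp_pair e d))"
    unfolding mfps_nth_component
  proof (rule nth_subst)
    show "{E. edeg E \<le> edeg (exp_pair e d)} \<subseteq> (\<lambda>(b, g). exp_pair g b) ` (?B \<times> ?G)"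
    proof
      fix E :: "'n + 'w \<Rightarrow>\<^sub>0 nat" assume E: "E \<in> {E. edeg E \<le> edeg (exp_pair e d)}"
      obtain g b where gb: "E = exp_pair g b" by (rule exp_pair_cases)
      with E show "E \<in> (\<lambda>(b, g). exp_pair g b) ` (?B \<times> ?G)"
        by (intro image_eqI[of _ _ "(b, g)"]) (auto simp: N_def)
    qed
  qed (use fin in auto)
  also have "\<dots> = (\<Sum>y\<in>?B \<times> ?G. case y of (b, g) \<Rightarrow>
      mfps_nth F (exp_pair g b) * mfps_nth (mon (scaling a p) (exp_pair g b)) (exp_pair e d))"
    by (subst sum.reindex) (auto simp: inj_on_def intro!: sum.cong)
  also have "\<dots> = (\<Sum>b\<in>?B. \<Sum>g\<in>?G.
      mfps_nth F (exp_pair g b) * mfps_nth (mon (scaling a p) (exp_pair g b)) (exp_pair e d))"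
    by (rule sum.cartesian_product[symmetric])
  also have "\<dots> = (\<Sum>b\<in>?B. if exp_push p b = d then mfps_nth (mfps_component F b * mon a b) e else 0)"
  proof (rule sum.cong[OF refl])
    fix b
    have "mfps_nth (mon (scaling a p) (exp_pair g b)) (exp_pair e d)
        = (if exp_push p b = d then mfps_nth (mfps_monom g * mon a b) e else 0)" for g
      using arg_cong[OF mfps_component_embed_monom[of "mfps_monom g * mon a b" "exp_push p b" d],
          of "\<lambda>F. mfps_nth F e"]
      unfolding mfps_nth_component mon_scaling by auto
    then show "(\<Sum>g\<in>?G. mfps_nth F (exp_pair g b) * mfps_nth (mon (scaling a p) (exp_pair g b)) (exp_pair e d))
        = (if exp_push p b = d then mfps_nth (mfps_component F b * mon a b) e else 0)"
      by (simp add: nth_mult_monom_expansion[of e N] N_def)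
  qed
  also have "\<dots> = (\<Sum>b\<in>{b \<in> ?B. exp_push p b = d}. mfps_nth (mfps_component F b * mon a b) e)"
    using fin(2) by (simp only: sum.inter_filter)
  also have "\<dots> = mfps_nth (\<Sum>b | exp_push p b = d. mfps_component F b * mon a b) e"
    unfolding B by (rule mfps_nth_sum[symmetric])
  finally show "mfps_nth (mfps_component (mfps_subst (scaling a p) F) d) e
      = mfps_nth (\<Sum>b | exp_push p b = d. mfps_component F b * mon a b) e" .
qed

subsection \<open>A long chain of primes\<close>

text \<open>The ideal generated by the variables outside \<open>S\<close>, described as the kernel
  of setting them to 0; \<open>S\<close> lists the variables that survive.\<close>

definition off_variables :: "'v set \<Rightarrow> ('k::comm_ring_1, 'v::finite) mfps set" where
  "off_variables S = {F. \<forall>e. Poly_Mapping.keys e \<subseteq> S \<longrightarrow> mfps_nth F e = 0}"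

lemma prime_in_zero: "prime_in UNIV {0 :: ('k::idom, 'v::finite) mfps}"
  using mfps_mult_eq_0 by (auto simp: prime_in_def)

lemma is_subring_UNIV: "is_subring UNIV"
  by (simp add: is_subring_def)

lemma prime_in_off_variables: "prime_in UNIV (off_variables S :: ('k::idom, 'v::finite) mfps set)"
proof -
  define res where "res = (\<lambda>F :: ('k, 'v) mfps. Abs_mfps (\<lambda>e. if Poly_Mapping.keys e \<subseteq> S then mfps_nth F e else 0))"
  have nth: "mfps_nth (res F) e = (if Poly_Mapping.keys e \<subseteq> S then mfps_nth F e else 0)" for F e
    by (simp add: res_def)
  have mult: "res (F * G) = res F * res G" for F G
  proof (rule mfps_eqI)
    fix e
    show "mfps_nth (res (F * G)) e = mfps_nth (res F * res G) e"
    proof (cases "Poly_Mapping.keys e \<subseteq> S")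
      case True
      have "(\<Sum>(p, q) | p + q = e. mfps_nth F p * mfps_nth G q)
          = (\<Sum>(p, q) | p + q = e. mfps_nth (res F) p * mfps_nth (res G) q)"
      proof (rule sum.cong[OF refl])
        fix y assume "y \<in> {(p, q). p + q = e}"
        then obtain p q where y: "y = (p, q)" "p + q = e" by auto
        then have "Poly_Mapping.keys p \<subseteq> S" "Poly_Mapping.keys q \<subseteq> S"
          using True keys_add_nat[of p q] by auto
        then show "(case y of (p, q) \<Rightarrow> mfps_nth F p * mfps_nth G q)
            = (case y of (p, q) \<Rightarrow> mfps_nth (res F) p * mfps_nth (res G) q)"
          by (simp add: nth y)
      qed
      with True show ?thesis by (simp add: nth mfps_nth_mult)
    next
      case False
      have "res F \<in> mfps_on S" "res G \<in> mfps_on S" by (auto simp: mfps_on_def nth)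
      then have "res F * res G \<in> mfps_on S" by (rule mfps_on_mult)
      with False show ?thesis by (simp add: nth mfps_onD)
    qed
  qed
  have "prime_in UNIV {F \<in> UNIV. res F \<in> {0}}"
    by (rule prime_in_vimage[OF prime_in_zero is_subring_UNIV])
       (auto intro!: mfps_eqI simp: nth mfps_nth_one mult)
  moreover have "{F \<in> UNIV. res F \<in> {0}} = off_variables S"
  proof (intro set_eqI iffI)
    fix F assume "F \<in> {F \<in> UNIV. res F \<in> {0}}"
    then have "mfps_nth (res F) e = 0" for e by simp
    then have "Poly_Mapping.keys e \<subseteq> S \<Longrightarrow> mfps_nth F e = 0" for e
      unfolding nth by presburger
    then show "F \<in> off_variables S" by (simp add: off_variables_def)
  qed (auto simp: off_variables_def nth intro!: mfps_eqI)
  ultimately show ?thesis by simp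
qed

text \<open>The empty set gives the maximal ideal. Each variable put into \<open>S\<close> is
  removed from the ideal and adds one strict inclusion at the lower end.\<close>

lemma prime_chain_off_variables:
  "prime_chain UNIV (off_variables S :: ('k::idom, 'v::finite) mfps set) (card S)"
  using finite[of S]
proof (induction S rule: finite_induct)
  case empty
  then show ?case by (auto intro: prime_chain.zero prime_in_off_variables)
next
  case (insert s S)
  have "mfps_X s \<notin> (off_variables (insert s S) :: ('k, 'v) mfps set)"
    by (auto simp: off_variables_def mfps_nth_X)
  moreover have "mfps_X s \<in> (off_variables S :: ('k, 'v) mfps set)"
    using insert.hyps by (auto simp: off_variables_def mfps_nth_X)
  moreover have "off_variables (insert s S) \<subseteq> (off_variables S :: ('k, 'v) mfps set)"
    by (auto simp: off_variables_def)
  ultimately have "off_variables (insert s S) \<subset> (off_variables S :: ('k, 'v) mfps set)" by blast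
  with insert show ?case by (auto intro: prime_chain.Suc prime_in_off_variables)
qed

text \<open>The kernel of the substitution \<open>rees_subst a W\<close> is the saturation by \<open>a None\<close> of the
  ideal generated by the \<open>a None * Y (Some w) - a (Some w) * Y None\<close> with \<open>w \<in> W\<close>; for
  \<open>W = UNIV\<close> it consists of the relations of the Rees algebra of the ideal generated by \<open>a\<close>.\<close>

definition rees_subst ::
  "('w::finite option \<Rightarrow> ('k::comm_ring_1, 'n::finite) mfps) \<Rightarrow> 'w set \<Rightarrow> 'n + 'w option \<Rightarrow> ('k, 'n + 'w option) mfps" where
  "rees_subst a W = scaling (\<lambda>j. if j \<in> Some ` W then a j else a None) (\<lambda>j. if j \<in> Some ` W then None else j)"

definition rees_kernel ::
  "('w::finite option \<Rightarrow> ('k::comm_ring_1, 'n::finite) mfps) \<Rightarrow> 'w set \<Rightarrow> ('k, 'n + 'w option) mfps set" where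
  "rees_kernel a W = {F. mfps_subst (rees_subst a W) F = 0}"

lemma substitution_rees_subst: "substitution (rees_subst a W)"
  unfolding rees_subst_def by (rule substitution_scaling)

lemma prime_in_rees_kernel:
  fixes a :: "'w::finite option \<Rightarrow> ('k::idom, 'n::finite) mfps"
  shows "prime_in UNIV (rees_kernel a W)"
proof -
  interpret substitution "rees_subst a W" by (rule substitution_rees_subst)
  have "prime_in UNIV {F \<in> UNIV. mfps_subst (rees_subst a W) F \<in> {0}}"
    by (rule prime_in_vimage[OF prime_in_zero is_subring_UNIV]) (auto simp: subst_add subst_mult)
  then show ?thesis by (simp add: rees_kernel_def)
qed

lemma mfps_subst_scaling_embed: "mfps_subst (scaling a p) (mfps_embed h) = mfps_embed h"
proof -
  interpret substitution "scaling a p" by (rule substitution_scaling)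
  show ?thesis
    unfolding mfps_embed_def
    by (subst subst_compose[OF embed.substitution_axioms substitution_axioms]) simp
qed

lemma rees_subst_empty_injective:
  fixes a :: "'w::finite option \<Rightarrow> ('k::idom, 'n::finite) mfps"
  assumes "a None \<noteq> 0" "mfps_subst (rees_subst a {}) F = 0"
  shows "F = 0"
proof (rule mfps_component_eq_0)
  fix b :: "'w option \<Rightarrow>\<^sub>0 nat"
  have push: "exp_push (\<lambda>j. j) b = b" for b :: "'w option \<Rightarrow>\<^sub>0 nat"
    by (simp add: exp_push_def sum_single_lookup)
  have mon: "mon (\<lambda>j. a None) b = a None ^ edeg b"
    by (simp add: mon_def edeg_def power_sum)
  have "mfps_component F b * a None ^ edeg b = mfps_component (mfps_subst (rees_subst a {}) F) b"
    by (simp add: rees_subst_def mfps_component_scaling push mon)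
  also have "\<dots> = 0"
    unfolding assms(2) by (rule mfps_eqI) simp
  finally have "mfps_component F b = 0 \<or> a None ^ edeg b = 0" by (rule mfps_mult_eq_0)
  moreover have "a None ^ n \<noteq> 0" for n
    by (induction n) (use assms(1) mfps_mult_eq_0 in auto)
  ultimately show "mfps_component F b = 0" by blast
qed

text \<open>The substitution for \<open>W\<close> followed by that for \<open>{w}\<close> equals the
  one for \<open>insert w W\<close> followed by the one for the empty set, and the latter is
  injective; this gives the inclusion. It is strict because the relation between the variables
  \<open>Some w\<close> and \<open>None\<close> holds only once \<open>w\<close> is
  included.\<close>

lemma rees_kernel_psubset:
  fixes a :: "'w::finite option \<Rightarrow> ('k::idom, 'n::finite) mfps"
  assumes a: "a None \<noteq> 0" and w: "w \<notin> W"
  shows "rees_kernel a W \<subset> rees_kernel a (insert w W)"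
proof -
  interpret W: substitution "rees_subst a W" by (rule substitution_rees_subst)
  interpret wW: substitution "rees_subst a (insert w W)" by (rule substitution_rees_subst)
  interpret e: substitution "rees_subst a {}" by (rule substitution_rees_subst)
  interpret w: substitution "rees_subst a {w}" by (rule substitution_rees_subst)
  have embed: "mfps_subst (rees_subst a V) (mfps_embed h) = mfps_embed h" for V h
    unfolding rees_subst_def by (rule mfps_subst_scaling_embed)
  have eq: "mfps_subst (rees_subst a {w}) (rees_subst a W v)
      = mfps_subst (rees_subst a {}) (rees_subst a (insert w W) v)" for v
  proof (cases v)
    case (Inl i)
    have "rees_subst a V (Inl i) = mfps_X (Inl i)" for V by (simp add: rees_subst_def)
    then show ?thesis by (simp add: Inl)
  next
    case (Inr j)
    have "rees_subst a V (Inr j) = mfps_embed (if j \<in> Some ` V then a j else a None)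
        * mfps_X (Inr (if j \<in> Some ` V then None else j))" for V j
      by (simp add: rees_subst_def)
    then show ?thesis
      using w unfolding Inr by (auto simp: w.subst_mult e.subst_mult embed mult.left_commute simp del: ideal.scale_scale)
  qed
  have "rees_kernel a W \<subseteq> rees_kernel a (insert w W)"
  proof
    fix F assume "F \<in> rees_kernel a W"
    then have "mfps_subst (rees_subst a {w}) (mfps_subst (rees_subst a W) F) = 0"
      by (simp add: rees_kernel_def)
    also have "mfps_subst (rees_subst a {w}) (mfps_subst (rees_subst a W) F)
        = mfps_subst (rees_subst a {}) (mfps_subst (rees_subst a (insert w W)) F)"
      unfolding subst_compose[OF substitution_rees_subst substitution_rees_subst] eq ..
    finally show "F \<in> rees_kernel a (insert w W)"
      unfolding rees_kernel_def using rees_subst_empty_injective[of a, OF a] by blast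
  qed
  moreover define F where "F = mfps_embed (a None) * mfps_X (Inr (Some w)) - mfps_embed (a (Some w)) * mfps_X (Inr None)"
  have "F \<in> rees_kernel a (insert w W)"
    unfolding F_def rees_kernel_def
    by (simp add: wW.subst_minus wW.subst_mult embed) (simp add: rees_subst_def mult.left_commute del: ideal.scale_scale)
  moreover have "Some w \<notin> Some ` W" using w by auto
  have "F \<notin> rees_kernel a W"
  proof
    assume "F \<in> rees_kernel a W"
    then have rel: "mfps_embed (a None) * (mfps_embed (a None) * mfps_X (Inr (Some w)))
        = mfps_embed (a (Some w)) * (mfps_embed (a None) * mfps_X (Inr None))"
      using \<open>Some w \<notin> Some ` W\<close> unfolding F_def rees_kernel_def
      by (simp add: W.subst_minus W.subst_mult embed) (simp add: rees_subst_def)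
    have X: "mfps_X (Inr j) = (mfps_monom (exp_pair 0 (Poly_Mapping.single j 1)) :: ('k, 'n + 'w option) mfps)" for j
      by (simp only: exp_pair_single mfps_monom_single_1)
    have eq: "mfps_embed (a None * a None) * mfps_monom (exp_pair 0 (Poly_Mapping.single (Some w) 1))
        = mfps_embed (a (Some w) * a None) * (mfps_monom (exp_pair 0 (Poly_Mapping.single None 1)) :: ('k, 'n + 'w option) mfps)"
      using rel unfolding X embed.subst_mult mult.assoc .
    have "Poly_Mapping.single (Some w) (1::nat) \<noteq> Poly_Mapping.single None 1"
      by (metis lookup_single_eq lookup_single_not_eq option.distinct(1) zero_neq_one)
    \<comment> \<open>Coefficients of the variable \<open>Some w\<close> are compared; the
      right-hand side does not involve it.\<close>
    then have "a None * a None = 0"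
      using arg_cong[OF eq, of "\<lambda>F. mfps_component F (Poly_Mapping.single (Some w) 1)"]
      unfolding mfps_component_embed_monom by simp
    with a mfps_mult_eq_0 show False by blast
  qed
  ultimately show ?thesis by blast
qed

lemma prime_chain_rees_kernel:
  fixes a :: "'w::finite option \<Rightarrow> ('k::idom, 'n::finite) mfps"
  assumes a: "a None \<noteq> 0" and l: "prime_chain UNIV (rees_kernel a UNIV) l"
  shows "prime_chain UNIV (rees_kernel a {}) (card (UNIV :: 'w set) + l)"
proof -
  \<comment> \<open>The induction runs over the complement, since a chain grows at its lower end,
    where the index set is smallest.\<close>
  have "prime_chain UNIV (rees_kernel a (- C)) (card C + l)" for C
    using finite[of C]
  proof (induction C rule: finite_induct)
    case empty
    then show ?case using l by simp
  next
    case (insert w C)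
    then have "insert w (- insert w C) = - C" by auto
    then have "rees_kernel a (- insert w C) \<subset> rees_kernel a (- C)"
      using rees_kernel_psubset[of a, OF a, of w "- insert w C"] by simp
    with insert show ?case by (auto intro: prime_chain.Suc prime_in_rees_kernel)
  qed
  from this[of UNIV] show ?thesis by simp
qed

theorem homogeneous_relation_with_unit_coefficient:
  fixes a :: "'w::finite option \<Rightarrow> ('k::field, 'n::finite) mfps"
  assumes inf: "infinite (UNIV :: 'k set)" and card: "card (UNIV :: 'n set) \<le> card (UNIV :: 'w set)"
  obtains s c b where "edeg b = s" "mfps_nth (c b) 0 \<noteq> 0" "(\<Sum>b | edeg b = s. c b * mon a b) = 0"
proof (cases "a None = 0")
  case True
  \<comment> \<open>In this case the variable with index \<open>None\<close> is itself a
    relation.\<close>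
  define c :: "('w option \<Rightarrow>\<^sub>0 nat) \<Rightarrow> ('k, 'n) mfps"
    where "c = (\<lambda>b. if b = Poly_Mapping.single None 1 then 1 else 0)"
  have "c b * mon a b = 0" for b using True by (simp add: c_def)
  then have "(\<Sum>b | edeg b = 1. c b * mon a b) = 0" by simp
  then show ?thesis by (intro that[of "Poly_Mapping.single None 1" 1 c]) (auto simp: c_def mfps_nth_one)
next
  case False
  let ?M = "off_variables (range Inr) :: ('k, 'n + 'w option) mfps set"
  have "\<not> rees_kernel a UNIV \<subseteq> ?M"
  proof
    assume sub: "rees_kernel a UNIV \<subseteq> ?M"
    obtain i :: 'n where True by simp
    \<comment> \<open>A variable of the first group shows strictness: it lies in \<open>?M\<close>,
      but the substitution fixes it.\<close>
    have "mfps_X (Inl i) \<in> ?M" by (auto simp: off_variables_def mfps_nth_X)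
    moreover have "mfps_X (Inl i) \<notin> rees_kernel a UNIV"
    proof
      interpret substitution "rees_subst a UNIV" by (rule substitution_rees_subst)
      assume "mfps_X (Inl i) \<in> rees_kernel a UNIV"
      then have "mfps_X (Inl i) = (0 :: ('k, 'n + 'w option) mfps)"
        by (simp add: rees_kernel_def) (simp add: rees_subst_def)
      then have "mfps_nth (mfps_X (Inl i) :: ('k, 'n + 'w option) mfps) (Poly_Mapping.single (Inl i) 1) = 0" by simp
      then show False by (simp add: mfps_nth_X)
    qed
    ultimately have "rees_kernel a UNIV \<subset> ?M" using sub by blast
    then have "prime_chain UNIV (rees_kernel a UNIV) (Suc (card (range (Inr :: 'w option \<Rightarrow> 'n + 'w option))))"
      using prime_chain.Suc[OF prime_in_rees_kernel _ prime_chain_off_variables] by blast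
    then have "prime_chain (mfps_on UNIV) (rees_kernel a {})
        (card (UNIV :: 'w set) + Suc (card (range (Inr :: 'w option \<Rightarrow> 'n + 'w option))))"
      unfolding mfps_on_UNIV by (rule prime_chain_rees_kernel[of a, OF False])
    \<comment> \<open>With w and n for the sizes of \<open>'w\<close> and \<open>'n\<close>, the
      left side is 2 w + 2, while the right side n + w + 1 is at most 2 w + 1.\<close>
    then have "card (UNIV :: 'w set) + Suc (card (range (Inr :: 'w option \<Rightarrow> 'n + 'w option)))
        \<le> card (UNIV :: ('n + 'w option) set)"
      by (rule prime_chain_mfps_on_le[OF inf])
    then show False
      using card by (simp add: card_image UNIV_Plus_UNIV[symmetric] card_Plus del: UNIV_Plus_UNIV)
  qed
  \<comment> \<open>Outside \<open>?M\<close> there is a nonzero coefficient at a monomial free of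
    first-group variables, that is, a component with nonzero constant term.\<close>
  then obtain F E where F: "F \<in> rees_kernel a UNIV"
    and E: "Poly_Mapping.keys E \<subseteq> range Inr" "mfps_nth F E \<noteq> 0"
    by (auto simp: off_variables_def)
  obtain g b where gb: "E = exp_pair g b" by (rule exp_pair_cases)
  have "Poly_Mapping.lookup g i = 0" for i
    using E(1) unfolding gb by (metis Inl_Inr_False in_keys_iff lookup_exp_pair(1) rangeE subsetD)
  then have "g = 0" by (intro poly_mapping_eqI) simp
  have push: "exp_push (\<lambda>_. None) b = Poly_Mapping.single None (edeg b)" for b :: "'w option \<Rightarrow>\<^sub>0 nat"
  proof -
    have "(\<Sum>j\<in>J. Poly_Mapping.single (None :: 'w option) (Poly_Mapping.lookup b j))
        = Poly_Mapping.single None (\<Sum>j\<in>J. Poly_Mapping.lookup b j)" for J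
      by (induction J rule: infinite_finite_induct) (auto simp: single_add)
    then show ?thesis by (simp add: exp_push_def edeg_def)
  qed
  have subst_eq: "rees_subst a UNIV = scaling a (\<lambda>_. None)"
  proof -
    have "j \<in> range Some \<or> j = None" for j :: "'w option" by (cases j) auto
    then show ?thesis unfolding rees_subst_def by (intro arg_cong2[of _ _ _ _ scaling] ext) auto
  qed
  \<comment> \<open>For the full index set all second-group variables merge into one, so a component
    of the image collects exactly the exponents of one degree.\<close>
  have "(\<Sum>b' | edeg b' = edeg b. mfps_component F b' * mon a b')
      = mfps_component (mfps_subst (rees_subst a UNIV) F) (Poly_Mapping.single None (edeg b))"
    unfolding subst_eq mfps_component_scaling push by (intro sum.cong) (auto dest: arg_cong[of _ _ edeg])
  also have "\<dots> = mfps_component (0 :: ('k, 'n + 'w option) mfps) (Poly_Mapping.single None (edeg b))"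
    using F by (simp add: rees_kernel_def)
  also have "\<dots> = 0" by (rule mfps_eqI) simp
  finally have "(\<Sum>b' | edeg b' = edeg b. mfps_component F b' * mon a b') = 0" .
  moreover have "mfps_nth (mfps_component F b) 0 \<noteq> 0" using E(2) gb \<open>g = 0\<close> by simp
  ultimately show ?thesis using that by blast
qed

section \<open>Polynomials and null-forms\<close>

lemma mpoly_eval_superset:
  fixes x :: "'v::finite \<Rightarrow> 'a::comm_ring_1"
  assumes "finite E" "Poly_Mapping.keys P \<subseteq> E"
  shows "mpoly_eval P x = (\<Sum>e\<in>E. Poly_Mapping.lookup P e * mon x e)"
  unfolding mpoly_eval_def mon_keys[symmetric]
  by (rule sum.mono_neutral_left[OF assms]) (auto simp: in_keys_iff)

lemma mpoly_homogeneous_keys: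
  fixes P :: "('a::comm_ring_1, 'v::finite) mpoly"
  assumes "mpoly_homogeneous s P"
  shows "Poly_Mapping.keys P \<subseteq> {e. edeg e = s}"
  using assms by (auto simp: mpoly_homogeneous_def edeg_keys)

lemma mpoly_eval_homogeneous:
  fixes x :: "'v::finite \<Rightarrow> 'a::comm_ring_1"
  assumes "mpoly_homogeneous s P"
  shows "mpoly_eval P x = (\<Sum>e | edeg e = s. Poly_Mapping.lookup P e * mon x e)"
  by (rule mpoly_eval_superset[OF finite_edeg_eq mpoly_homogeneous_keys[OF assms]])

lemma mpoly_eval_scale:
  fixes x :: "'v::finite \<Rightarrow> 'a::comm_ring_1"
  assumes "mpoly_homogeneous s P"
  shows "mpoly_eval P (\<lambda>v. c * x v) = c ^ s * mpoly_eval P x"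
  unfolding mpoly_eval_homogeneous[OF assms] sum_distrib_left
  by (rule sum.cong) (auto simp: mon_scale simp del: ideal.scale_scale)

lemma mpoly_eval_zero [simp]: "mpoly_eval 0 x = 0"
  by (simp add: mpoly_eval_def)

lemma mpoly_eval_add:
  fixes x :: "'v::finite \<Rightarrow> 'a::comm_ring_1"
  shows "mpoly_eval (P + Q) x = mpoly_eval P x + mpoly_eval Q x"
proof -
  let ?E = "Poly_Mapping.keys P \<union> Poly_Mapping.keys Q"
  have "Poly_Mapping.keys (P + Q) \<subseteq> ?E" by (rule keys_add)
  then show ?thesis
    by (simp add: mpoly_eval_superset[of ?E] lookup_add distrib_right sum.distrib)
qed

lemma mpoly_eval_sum:
  fixes x :: "'v::finite \<Rightarrow> 'a::comm_ring_1"
  shows "mpoly_eval (\<Sum>i\<in>I. P i) x = (\<Sum>i\<in>I. mpoly_eval (P i) x)"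
  by (induction I rule: infinite_finite_induct) (auto simp: mpoly_eval_add)

lemma mpoly_eval_single:
  fixes x :: "'v::finite \<Rightarrow> 'a::comm_ring_1"
  shows "mpoly_eval (Poly_Mapping.single e c) x = c * mon x e"
  by (subst mpoly_eval_superset[of "{e}"]) auto

lemma mpoly_eval_mult:
  fixes x :: "'v::finite \<Rightarrow> 'a::comm_ring_1"
  shows "mpoly_eval (P * Q) x = mpoly_eval P x * mpoly_eval Q x"
proof -
  have decomp: "P = (\<Sum>e\<in>Poly_Mapping.keys P. Poly_Mapping.single e (Poly_Mapping.lookup P e))" for P :: "('a, 'v) mpoly"
    by (rule poly_mapping_eqI) (auto simp: lookup_sum lookup_single when_def in_keys_iff)
  let ?p = "Poly_Mapping.lookup P" and ?q = "Poly_Mapping.lookup Q"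
  have "P * Q = (\<Sum>e\<in>Poly_Mapping.keys P. \<Sum>g\<in>Poly_Mapping.keys Q.
      Poly_Mapping.single e (?p e) * Poly_Mapping.single g (?q g))"
    unfolding sum_product[symmetric] decomp[symmetric] ..
  also have "\<dots> = (\<Sum>e\<in>Poly_Mapping.keys P. \<Sum>g\<in>Poly_Mapping.keys Q. Poly_Mapping.single (e + g) (?p e * ?q g))"
    by (simp add: mult_single)
  finally have "mpoly_eval (P * Q) x = (\<Sum>e\<in>Poly_Mapping.keys P. \<Sum>g\<in>Poly_Mapping.keys Q. ?p e * ?q g * mon x (e + g))"
    by (simp add: mpoly_eval_sum mpoly_eval_single)
  also have "\<dots> = (\<Sum>e\<in>Poly_Mapping.keys P. \<Sum>g\<in>Poly_Mapping.keys Q. (?p e * mon x e) * (?q g * mon x g))"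
    by (intro sum.cong refl) (simp only: mon_add mult_ac)
  also have "\<dots> = (\<Sum>e\<in>Poly_Mapping.keys P. ?p e * mon x e) * (\<Sum>g\<in>Poly_Mapping.keys Q. ?q g * mon x g)"
    by (rule sum_product[symmetric])
  finally show ?thesis by (simp add: mpoly_eval_superset[OF finite_keys order_refl])
qed

definition mpoly_of_coeffs :: "nat \<Rightarrow> (('v::finite \<Rightarrow>\<^sub>0 nat) \<Rightarrow> 'a) \<Rightarrow> ('a::comm_ring_1, 'v) mpoly" where
  "mpoly_of_coeffs s c = Abs_poly_mapping (\<lambda>e. if edeg e = s then c e else 0)"

lemma lookup_mpoly_of_coeffs:
  "Poly_Mapping.lookup (mpoly_of_coeffs s c) e = (if edeg e = s then c e else 0)"
proof -
  have "finite {e. (if edeg e = s then c e else 0) \<noteq> 0}"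
    by (rule finite_subset[OF _ finite_edeg_eq[of s]]) auto
  then show ?thesis by (simp add: mpoly_of_coeffs_def)
qed

lemma mpoly_homogeneous_of_coeffs: "mpoly_homogeneous s (mpoly_of_coeffs s c)"
  unfolding mpoly_homogeneous_def edeg_keys[symmetric]
  by (auto simp: in_keys_iff lookup_mpoly_of_coeffs split: if_splits)

lemma mpoly_eval_of_coeffs: "mpoly_eval (mpoly_of_coeffs s c) x = (\<Sum>e | edeg e = s. c e * mon x e)"
  unfolding mpoly_eval_homogeneous[OF mpoly_homogeneous_of_coeffs]
  by (rule sum.cong) (auto simp: lookup_mpoly_of_coeffs)

section \<open>The maximal ideal and sources of null-forms\<close>

lemma mfps_max_ideal_iff:
  fixes F :: "('k::comm_ring_1, 'n::finite) mfps"
  shows "F \<in> mfps_max_ideal \<longleftrightarrow> mfps_nth F 0 = 0"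
proof
  assume "F \<in> mfps_max_ideal"
  then show "mfps_nth F 0 = 0"
    unfolding mfps_max_ideal_def
  proof (induction F rule: ideal.span_induct_alt)
    case (step c x y)
    have "mfps_nth (mfps_X i :: ('k, 'n) mfps) 0 = 0" for i
      using mfps_X_order_ge[of i] by (simp only: mfps_order_ge_1_iff)
    with step show ?case by (auto simp: mfps_nth_mult_0)
  qed simp
next
  assume F: "mfps_nth F 0 = 0"
  \<comment> \<open>Each nonconstant monomial is assigned to one variable dividing it, so that
    \<open>F\<close> splits without overlap into multiples of the variables.\<close>
  define sel where "sel = (\<lambda>e :: 'n \<Rightarrow>\<^sub>0 nat. SOME i. i \<in> Poly_Mapping.keys e)"
  have sel: "sel e \<in> Poly_Mapping.keys e" if "e \<noteq> 0" for e
    unfolding sel_def some_in_eq using that by simp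
  define G where "G = (\<lambda>i. Abs_mfps (\<lambda>e. if sel (Poly_Mapping.single i 1 + e) = i then mfps_nth F (Poly_Mapping.single i 1 + e) else 0))"
  have "F = (\<Sum>i\<in>UNIV. G i * mfps_X i)"
  proof (rule mfps_eqI)
    fix e
    have "mfps_nth (mfps_monom (Poly_Mapping.single i 1) * G i) e = (if e \<noteq> 0 \<and> sel e = i then mfps_nth F e else 0)" for i
    proof (cases "\<exists>h. e = Poly_Mapping.single i 1 + h")
      case True
      then obtain h where h: "e = Poly_Mapping.single i 1 + h" by blast
      then have "edeg e \<noteq> 0" by simp
      then have "e \<noteq> 0" by (metis edeg_zero)
      then show ?thesis unfolding h mfps_nth_monom_mult_add by (simp add: G_def)
    next
      case False
      then have "\<not> 1 \<le> Poly_Mapping.lookup e i"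
        using exp_single_split[of 1 e i] by (metis add.commute)
      then have "i \<notin> Poly_Mapping.keys e" by (simp add: in_keys_iff)
      then have "\<not> (e \<noteq> 0 \<and> sel e = i)" using sel by blast
      with False show ?thesis by (subst mfps_nth_monom_mult_0) auto
    qed
    then have "mfps_nth (\<Sum>i\<in>UNIV. G i * mfps_X i) e = (\<Sum>i\<in>UNIV. if i = sel e then if e = 0 then 0 else mfps_nth F e else 0)"
      unfolding mfps_nth_sum mfps_monom_single_1 by (intro sum.cong) (auto simp: mult.commute)
    then show "mfps_nth F e = mfps_nth (\<Sum>i\<in>UNIV. G i * mfps_X i) e" using F by simp
  qed
  also have "\<dots> \<in> mfps_max_ideal"
    unfolding mfps_max_ideal_def by (intro ideal.span_sum ideal.span_scale ideal.span_base) auto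
  finally show "F \<in> mfps_max_ideal" .
qed

text \<open>The value 0 lies in every ideal, so an exact relation reduces to a null-form whatever
  the powers of the Tjurina ideal are.\<close>

lemma null_form_of_relation:
  fixes f :: "('k::comm_ring_1, 'n::finite) mfps"
  assumes "(\<Sum>e | edeg e = s. c e * mon (tjurina_gens f) e) = 0"
  shows "null_form f s (mpoly_of_coeffs s (\<lambda>e. mfps_nth (c e) 0))"
  unfolding null_form_def
proof (intro conjI exI[of _ "mpoly_of_coeffs s c"] allI)
  show "mpoly_eval (mpoly_of_coeffs s c) (tjurina_gens f) \<in> ideal_mult mfps_max_ideal (ideal_power (tjurina_ideal f) s)"
    unfolding mpoly_eval_of_coeffs assms by (simp add: ideal_mult_def ideal.span_zero)
qed (auto simp: mpoly_homogeneous_of_coeffs lookup_mpoly_of_coeffs mfps_max_ideal_iff mfps_nth_const)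

text \<open>Evaluation at a point is a ring homomorphism, so if all generators vanished there, the
  whole ideal would.\<close>

lemma null_form_ideal_nonvanishing:
  fixes x :: "'n::finite option \<Rightarrow> 'k::comm_ring_1"
  assumes "G \<in> null_form_ideal h" "mpoly_eval G x \<noteq> 0"
  obtains s \<phi> where "null_form h s \<phi>" "mpoly_eval \<phi> x \<noteq> 0"
proof (rule ccontr)
  assume "\<not> thesis"
  with that have zero: "\<And>\<phi> s. null_form h s \<phi> \<Longrightarrow> mpoly_eval \<phi> x = 0" by blast
  have "mpoly_eval G x = 0"
    using assms(1) unfolding null_form_ideal_def
    by (induction G rule: ideal.span_induct_alt) (auto simp: mpoly_eval_add mpoly_eval_mult zero)
  with assms(2) show False ..
qed

section \<open>Reductions of the Tjurina ideal\<close>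

text \<open>In a splitting \<open>p + q = e + single i 1\<close> the exponents of \<open>i\<close>
  in \<open>p\<close> and \<open>q\<close> add up to the factor \<open>lookup e i + 1\<close>;
  distributing it gives the two terms, in any characteristic.\<close>

lemma mfps_pderiv_mult: "mfps_pderiv i (u * f) = u * mfps_pderiv i f + mfps_pderiv i u * f"
proof (rule mfps_eqI)
  fix e
  let ?s = "Poly_Mapping.single i (1::nat)"
  let ?l = "\<lambda>p. Poly_Mapping.lookup p i"
  \<comment> \<open>Terms in which \<open>p\<close> has exponent 0 at \<open>i\<close> carry the
    factor 0; in the others one \<open>i\<close> is taken out of \<open>p\<close>, which yields a
    coefficient of the derivative.\<close>
  have half: "(\<Sum>(p, q) | p + q = e + ?s. of_nat (?l p) * mfps_nth u p * mfps_nth f q)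
      = mfps_nth (mfps_pderiv i u * f) e" for u f :: "('a, 'b) mfps"
  proof -
    have "(\<Sum>(p, q) | p + q = e + ?s. of_nat (?l p) * mfps_nth u p * mfps_nth f q)
        = (\<Sum>(p, q) | p + q = e + ?s \<and> ?l p \<noteq> 0. of_nat (?l p) * mfps_nth u p * mfps_nth f q)"
      by (rule sum.mono_neutral_right)
        (auto simp: finite_add_decomps, metis mult_zero_left neq0_conv of_nat_0)
    also have "\<dots> = (\<Sum>(p, q) | p + q = e. of_nat (?l p + 1) * mfps_nth u (p + ?s) * mfps_nth f q)"
    proof (rule sum.reindex_bij_witness[where i = "\<lambda>(p, q). (p + ?s, q)" and j = "\<lambda>(p, q). (p - ?s, q)"])
      fix y assume "y \<in> {(p, q). p + q = e + ?s \<and> ?l p \<noteq> 0}"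
      then obtain p q where y: "y = (p, q)" "p + q = e + ?s" "?l p \<noteq> 0" by auto
      then obtain p' where p': "p = p' + ?s" using exp_single_split[of 1 p i] by auto
      then have "p' + q + ?s = e + ?s" using y(2) by (simp add: add_ac)
      then have "p' + q = e" by simp
      then show "(case case y of (p, q) \<Rightarrow> (p - ?s, q) of (p, q) \<Rightarrow> (p + ?s, q)) = y"
        "(case y of (p, q) \<Rightarrow> (p - ?s, q)) \<in> {(p, q). p + q = e}"
        "(case case y of (p, q) \<Rightarrow> (p - ?s, q) of (p, q) \<Rightarrow> of_nat (?l p + 1) * mfps_nth u (p + ?s) * mfps_nth f q)
          = (case y of (p, q) \<Rightarrow> of_nat (?l p) * mfps_nth u p * mfps_nth f q)"
        using y p' by (auto simp: lookup_add)
    qed (auto simp: lookup_add add_ac)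
    finally show ?thesis by (simp add: mfps_nth_mult mfps_pderiv_def)
  qed
  have swap: "(\<Sum>(p, q) | p + q = e + ?s. of_nat (?l q) * mfps_nth u p * mfps_nth f q)
      = (\<Sum>(p, q) | p + q = e + ?s. of_nat (?l p) * mfps_nth f p * mfps_nth u q)"
    by (rule sum.reindex_bij_witness[where i = prod.swap and j = prod.swap]) (auto simp: ac_simps simp del: ideal.scale_scale)
  have "mfps_nth (mfps_pderiv i (u * f)) e
      = (\<Sum>(p, q) | p + q = e + ?s. of_nat (?l e + 1) * (mfps_nth u p * mfps_nth f q))"
    by (simp add: mfps_pderiv_def mfps_nth_mult sum_distrib_left case_prod_unfold)
  also have "\<dots> = (\<Sum>(p, q) | p + q = e + ?s.
      of_nat (?l q) * mfps_nth u p * mfps_nth f q + of_nat (?l p) * mfps_nth u p * mfps_nth f q)"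
  proof (rule sum.cong[OF refl])
    fix y assume "y \<in> {(p, q). p + q = e + ?s}"
    then obtain p q where y: "y = (p, q)" "p + q = e + ?s" by auto
    have "?l e + 1 = ?l q + ?l p"
      using arg_cong[OF y(2), of ?l] by (simp add: lookup_add)
    then have "(of_nat (?l e + 1) :: 'a) = of_nat (?l q) + of_nat (?l p)" by (simp only: of_nat_add)
    then show "(case y of (p, q) \<Rightarrow> of_nat (?l e + 1) * (mfps_nth u p * mfps_nth f q))
        = (case y of (p, q) \<Rightarrow> of_nat (?l q) * mfps_nth u p * mfps_nth f q + of_nat (?l p) * mfps_nth u p * mfps_nth f q)"
      unfolding y prod.case by (simp only: distrib_right mult.assoc)
  qed
  also have "\<dots> = mfps_nth (mfps_pderiv i f * u) e + mfps_nth (mfps_pderiv i u * f) e"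
    unfolding half[symmetric] swap[symmetric] by (simp add: sum.distrib case_prod_unfold)
  finally show "mfps_nth (mfps_pderiv i (u * f)) e = mfps_nth (u * mfps_pderiv i f + mfps_pderiv i u * f) e"
    by (simp add: mult.commute)
qed

text \<open>The square of the maximal ideal has no terms of degree below 2, so it cannot affect
  constant and linear coefficients.\<close>

lemma has_linear_partD:
  assumes "has_linear_part u \<alpha>"
  shows "mfps_nth u 0 = \<alpha> None" "mfps_nth (mfps_pderiv i u) 0 = \<alpha> (Some i)"
proof -
  let ?L = "mfps_const (\<alpha> None) + (\<Sum>i\<in>UNIV. mfps_const (\<alpha> (Some i)) * mfps_X i)"
  have max: "x \<in> mfps_order_ge 1" if "x \<in> mfps_max_ideal" for x :: "('a, 'b) mfps"
    using that unfolding mfps_max_ideal_iff mfps_order_ge_1_iff .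
  have "x \<in> mfps_order_ge n" if "x \<in> ideal_power mfps_max_ideal n" for n and x :: "('a, 'b) mfps"
    using that
  proof (induction n arbitrary: x)
    case 0
    then show ?case by (simp add: mfps_order_ge_def)
  next
    case (Suc n)
    from Suc.prems show ?case
      unfolding ideal_power.simps ideal_mult_def
    proof (induction x rule: ideal.span_induct_alt)
      case base
      then show ?case by (simp add: mfps_order_ge_def)
    next
      case (step c x y)
      then obtain a b where x: "x = a * b" "a \<in> mfps_max_ideal" "b \<in> ideal_power mfps_max_ideal n" by blast
      then have "c * x \<in> mfps_order_ge (0 + (1 + n))"
        unfolding x(1) by (intro mfps_order_ge_mult Suc.IH max) (auto simp: mfps_order_ge_def)
      with step(2) show ?case by (auto simp: mfps_order_ge_def)
    qed
  qed
  then have "u - ?L \<in> mfps_order_ge 2"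
    using assms unfolding has_linear_part_def by blast
  then have eq: "mfps_nth u e = mfps_nth ?L e" if "edeg e < 2" for e
    using mfps_order_geD[of "u - ?L" 2 e] that by simp
  have single: "Poly_Mapping.single i (Suc 0) = Poly_Mapping.single j (Suc 0) \<longleftrightarrow> j = i" for i j :: 'b
    by (metis lookup_single_eq lookup_single_not_eq nat.distinct(1))
  have nonzero: "Poly_Mapping.single i (Suc 0) \<noteq> 0" "0 \<noteq> Poly_Mapping.single i (Suc 0)" for i :: 'b
    by (metis lookup_single_eq lookup_zero nat.distinct(1))+
  show "mfps_nth u 0 = \<alpha> None"
    using eq[of 0] by (simp add: mfps_nth_sum mfps_nth_const mfps_nth_X nonzero)
  have "mfps_nth u (Poly_Mapping.single i (Suc 0)) = (\<Sum>j\<in>UNIV. \<alpha> (Some j) * (if j = i then 1 else 0))"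
    using eq[of "Poly_Mapping.single i (Suc 0)"]
    by (simp add: mfps_nth_sum mfps_nth_const mfps_nth_X nonzero single)
  also have "\<dots> = (\<Sum>j\<in>UNIV. if j = i then \<alpha> (Some i) else 0)"
    by (rule sum.cong) auto
  finally have "mfps_nth u (Poly_Mapping.single i (Suc 0)) = \<alpha> (Some i)" by simp
  then show "mfps_nth (mfps_pderiv i u) 0 = \<alpha> (Some i)"
    by (simp add: mfps_pderiv_def)
qed

section \<open>Powers of an ideal enlarged by one element\<close>

lemma ideal_power_subspace:
  "0 \<in> ideal_power I s"
  "x \<in> ideal_power I s \<Longrightarrow> y \<in> ideal_power I s \<Longrightarrow> x + y \<in> ideal_power I s"
  "x \<in> ideal_power I s \<Longrightarrow> c * x \<in> ideal_power I s"
  by (cases s; auto simp: ideal_mult_def intro: ideal.span_zero ideal.span_add ideal.span_scale)+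

lemma ideal_power_Suc_mult: "x \<in> I \<Longrightarrow> y \<in> ideal_power I s \<Longrightarrow> x * y \<in> ideal_power I (Suc s)"
  by (auto simp: ideal_mult_def intro: ideal.span_base)

text \<open>\<open>mixed_powers J x s\<close> is the ideal \<open>\<Sum>i=1..s. J ^ i * x ^ (s - i)\<close>, that is,
  \<open>J * (J + \<langle>x\<rangle>) ^ (s - 1)\<close>.\<close>

primrec mixed_powers :: "'a::comm_ring_1 set \<Rightarrow> 'a \<Rightarrow> nat \<Rightarrow> 'a set" where
  "mixed_powers J x 0 = {0}"
| "mixed_powers J x (Suc s) = {x * k + j | k j. k \<in> mixed_powers J x s \<and> j \<in> ideal_power J (Suc s)}"

lemma mixed_powers_zero: "0 \<in> mixed_powers J x s"
proof (induction s)
  case (Suc s)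
  then have "x * 0 + 0 \<in> mixed_powers J x (Suc s)"
    using ideal_power_subspace(1) unfolding mixed_powers.simps by blast
  then show ?case by simp
qed simp

lemma mixed_powers_add:
  "k \<in> mixed_powers J x s \<Longrightarrow> k' \<in> mixed_powers J x s \<Longrightarrow> k + k' \<in> mixed_powers J x s"
proof (induction s arbitrary: k k')
  case (Suc s)
  then obtain l j l' j' where k: "k = x * l + j" "l \<in> mixed_powers J x s" "j \<in> ideal_power J (Suc s)"
    and k': "k' = x * l' + j'" "l' \<in> mixed_powers J x s" "j' \<in> ideal_power J (Suc s)"
    unfolding mixed_powers.simps by blast
  have "k + k' = x * (l + l') + (j + j')" by (simp add: k k' distrib_left)
  then show ?case
    using Suc.IH[OF k(2) k'(2)] ideal_power_subspace(2)[OF k(3) k'(3)] unfolding mixed_powers.simps by blast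
qed simp

lemma mixed_powers_scale: "k \<in> mixed_powers J x s \<Longrightarrow> c * k \<in> mixed_powers J x s"
proof (induction s arbitrary: k)
  case (Suc s)
  then obtain l j where k: "k = x * l + j" "l \<in> mixed_powers J x s" "j \<in> ideal_power J (Suc s)"
    unfolding mixed_powers.simps by blast
  have "c * k = x * (c * l) + c * j" unfolding k(1) by (simp only: distrib_left mult.left_commute)
  then show ?case
    using Suc.IH[OF k(2)] ideal_power_subspace(3)[OF k(3)] unfolding mixed_powers.simps by blast
qed simp

lemma mixed_powers_shift:
  assumes "k \<in> mixed_powers J x s"
  shows "x * k \<in> mixed_powers J x (Suc s)"
proof -
  have "x * k + 0 \<in> mixed_powers J x (Suc s)"
    using assms ideal_power_subspace(1) unfolding mixed_powers.simps by blast
  then show ?thesis by simp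
qed

lemma mixed_powers_mult:
  assumes "j \<in> J"
  shows "k \<in> mixed_powers J x s \<Longrightarrow> j * k \<in> mixed_powers J x (Suc s)"
proof (induction s arbitrary: k)
  case 0
  then show ?case using mixed_powers_zero[of J x "Suc 0"] by simp
next
  case (Suc s)
  then obtain l i where k: "k = x * l + i" "l \<in> mixed_powers J x s" "i \<in> ideal_power J (Suc s)"
    unfolding mixed_powers.simps(2)[of J x s] by blast
  have "j * k = x * (j * l) + j * i" unfolding k(1) by (simp only: distrib_left mult.left_commute)
  then show ?case
    using Suc.IH[OF k(2)] ideal_power_Suc_mult[OF assms k(3)] unfolding mixed_powers.simps(2)[of J x "Suc s"] by blast
qed

lemma mixed_powers_power:
  assumes "j \<in> J"
  shows "j * x ^ s \<in> mixed_powers J x (Suc s)"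
proof (induction s)
  case 0
  have "j * 1 \<in> ideal_power J (Suc 0)" by (rule ideal_power_Suc_mult[OF assms]) simp
  then have "x * 0 + j * 1 \<in> mixed_powers J x (Suc 0)" unfolding mixed_powers.simps by blast
  then show ?case by simp
next
  case (Suc s)
  have "j * x ^ Suc s = x * (j * x ^ s)" by (simp only: power_Suc mult.left_commute)
  then show ?case using mixed_powers_shift[OF Suc] by (simp only:)
qed

lemma mixed_powers_sum:
  assumes "k \<in> mixed_powers J x s"
  obtains c where "\<forall>i. c i \<in> ideal_power J i" "k = (\<Sum>i=1..s. c i * x ^ (s - i))"
proof -
  have "\<exists>c. (\<forall>i. c i \<in> ideal_power J i) \<and> k = (\<Sum>i=1..s. c i * x ^ (s - i))"
    using assms
  proof (induction s arbitrary: k)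
    case 0
    then show ?case using ideal_power_subspace(1)[of J] by (intro exI[of _ "\<lambda>_. 0"]) simp
  next
    case (Suc s)
    then obtain l j where k: "k = x * l + j" "l \<in> mixed_powers J x s" "j \<in> ideal_power J (Suc s)"
      unfolding mixed_powers.simps by blast
    obtain c where c: "\<forall>i. c i \<in> ideal_power J i" "l = (\<Sum>i=1..s. c i * x ^ (s - i))"
      using Suc.IH[OF k(2)] by blast
    define c' where "c' = c(Suc s := j)"
    have "x * l = (\<Sum>i=1..s. c' i * x ^ (Suc s - i))"
      unfolding c(2) sum_distrib_left
    proof (rule sum.cong[OF refl])
      fix i assume "i \<in> {1..s}"
      then have "Suc s - i = Suc (s - i)" "c' i = c i" by (auto simp: c'_def)
      then show "x * (c i * x ^ (s - i)) = c' i * x ^ (Suc s - i)"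
        by (simp only: power_Suc mult.left_commute)
    qed
    then have "k = (\<Sum>i=1..Suc s. c' i * x ^ (Suc s - i))" by (simp add: k(1) c'_def)
    moreover have "\<forall>i. c' i \<in> ideal_power J i" using c(1) k(3) by (simp add: c'_def del: ideal_power.simps)
    ultimately show ?case by blast
  qed
  then show ?thesis using that by blast
qed

text \<open>Congruence of \<open>y\<close> and \<open>r * x ^ s\<close> modulo
  \<open>J * (J + <x>) ^ (s - 1)\<close>; at \<open>s = 0\<close> the modulus is zero and it is
  equality. Only the coefficient of the pure power of \<open>x\<close> is tracked.\<close>

definition expands :: "'a::comm_ring_1 set \<Rightarrow> 'a \<Rightarrow> nat \<Rightarrow> 'a \<Rightarrow> 'a \<Rightarrow> bool" where
  "expands J x s r y \<longleftrightarrow> y - r * x ^ s \<in> mixed_powers J x s"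

lemma expands_add: "expands J x s r y \<Longrightarrow> expands J x s r' y' \<Longrightarrow> expands J x s (r + r') (y + y')"
  using mixed_powers_add[of "y - r * x ^ s" J x s "y' - r' * x ^ s"]
  by (simp add: expands_def distrib_right add_diff_add)

lemma expands_scale: "expands J x s r y \<Longrightarrow> expands J x s (c * r) (c * y)"
  using mixed_powers_scale[of "y - r * x ^ s" J x s c] by (simp add: expands_def right_diff_distrib)

lemma expands_zero: "expands J x s 0 0"
  by (simp add: expands_def mixed_powers_zero)

lemma expands_sum: "(\<And>i. i \<in> I \<Longrightarrow> expands J x s (r i) (y i)) \<Longrightarrow> expands J x s (sum r I) (sum y I)"
  by (induction I rule: infinite_finite_induct) (auto simp: expands_zero expands_add)

lemma expands_mult:
  assumes "expands J x s r y" "j \<in> J"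
  shows "expands J x (Suc s) (r' * r) ((r' * x + j) * y)"
proof -
  define k where "k = y - r * x ^ s"
  have k: "k \<in> mixed_powers J x s" using assms(1) by (simp add: k_def expands_def)
  have y: "y = r * x ^ s + k" by (simp add: k_def)
  have "(r' * x + j) * y - r' * r * x ^ Suc s = r' * (x * k) + (r * (j * x ^ s) + j * k)"
    unfolding y by (simp add: algebra_simps del: ideal.scale_scale)
  also have "\<dots> \<in> mixed_powers J x (Suc s)"
    by (intro mixed_powers_add mixed_powers_scale mixed_powers_shift mixed_powers_power mixed_powers_mult k assms(2))
  finally show ?thesis by (simp add: expands_def)
qed

lemma expands_mon:
  assumes "\<And>v. j v \<in> J"
  shows "expands J x (edeg e) (mon r e) (mon (\<lambda>v. r v * x + j v) e)"
proof (induction e rule: mon_induct)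
  case zero
  then show ?case by (simp add: expands_def)
next
  case (step e v)
  then show ?case
    using expands_mult[OF step assms[of v], of "r v"] by (simp add: mon_add mult.commute)
qed

lemma expands_ideal_power:
  assumes "\<And>y. y \<in> I \<Longrightarrow> \<exists>r. \<exists>j\<in>J. y = r * x + j"
  shows "y \<in> ideal_power I s \<Longrightarrow> \<exists>r. expands J x s r y"
proof (induction s arbitrary: y)
  case 0
  then show ?case by (intro exI[of _ y]) (simp add: expands_def)
next
  case (Suc s)
  from Suc.prems show ?case
    unfolding ideal_power.simps ideal_mult_def
  proof (induction y rule: ideal.span_induct_alt)
    case base
    then show ?case using expands_zero by blast
  next
    case (step c a b)
    then obtain p q where pq: "a = p * q" "p \<in> I" "q \<in> ideal_power I s" by blast
    obtain r' j where p: "p = r' * x + j" "j \<in> J" using assms[OF pq(2)] by blast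
    obtain r where "expands J x s r q" using Suc.IH[OF pq(3)] by blast
    then have "expands J x (Suc s) (c * (r' * r)) (c * a)"
      unfolding pq(1) p(1) by (intro expands_scale expands_mult p(2))
    with step(2) show ?case using expands_add by blast
  qed
qed

text \<open>A factor from \<open>ideal_gen M\<close> passes to the coefficient of
  \<open>x ^ s\<close>; for the maximal ideal that coefficient is then a non-unit.\<close>

lemma expands_ideal_mult_power:
  assumes "\<And>y. y \<in> I \<Longrightarrow> \<exists>r. \<exists>j\<in>J. y = r * x + j"
    and "y \<in> ideal_mult (ideal_gen M) (ideal_power I s)"
  shows "\<exists>r \<in> ideal_gen M. expands J x s r y"
  using assms(2) unfolding ideal_mult_def
proof (induction y rule: ideal.span_induct_alt)
  case base
  then show ?case using expands_zero ideal.span_zero by blast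
next
  case (step c a b)
  then obtain p q where pq: "a = p * q" "p \<in> ideal_gen M" "q \<in> ideal_power I s" by blast
  obtain r where r: "expands J x s r q" using expands_ideal_power[OF assms(1) pq(3)] by blast
  obtain r' where r': "r' \<in> ideal_gen M" "expands J x s r' b" using step(2) by blast
  have "expands J x s (c * (p * r) + r') (c * a + b)"
    unfolding pq(1) by (intro expands_add expands_scale r r')
  moreover have "c * (p * r) + r' \<in> ideal_gen M"
    using ideal.span_add[OF ideal.span_scale[OF pq(2), of "c * r"] r'(1)] by (simp only: mult_ac)
  ultimately show ?case by blast
qed

text \<open>Membership is an integral equation for \<open>x\<close>; multiplied by
  \<open>u ^ s\<close>, with the powers of \<open>u\<close> distributed, it becomes one for
  \<open>u * x\<close>.\<close>

lemma integral_closure_if_power_in_mixed_powers: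
  assumes "x ^ s \<in> mixed_powers J x s" "s > 0"
  shows "u * x \<in> integral_closure J"
proof -
  obtain c where c: "\<forall>i. c i \<in> ideal_power J i" "x ^ s = (\<Sum>i=1..s. c i * x ^ (s - i))"
    by (rule mixed_powers_sum[OF assms(1)])
  have "(u * x) ^ s + (\<Sum>i=1..s. - (u ^ i) * c i * (u * x) ^ (s - i)) = 0"
  proof -
    have "(\<Sum>i=1..s. - (u ^ i) * c i * (u * x) ^ (s - i)) = (\<Sum>i=1..s. - (u ^ s) * (c i * x ^ (s - i)))"
    proof (rule sum.cong[OF refl])
      fix i assume "i \<in> {1..s}"
      then have "u ^ s = u ^ i * u ^ (s - i)" by (simp flip: power_add)
      then show "- (u ^ i) * c i * (u * x) ^ (s - i) = - (u ^ s) * (c i * x ^ (s - i))"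
        by (simp add: power_mult_distrib mult_ac del: ideal.scale_scale)
    qed
    also have "\<dots> = - (u ^ s) * x ^ s" by (subst c(2)) (simp only: sum_distrib_left)
    finally show ?thesis by (simp add: power_mult_distrib)
  qed
  moreover have "\<forall>i\<in>{1..s}. - (u ^ i) * c i \<in> ideal_power J i"
    using c(1) ideal_power_subspace(3) by blast
  ultimately show ?thesis
    unfolding integral_closure_def using assms(2)
    by (intro CollectI exI[of _ s] exI[of _ "\<lambda>i. - (u ^ i) * c i"] conjI)
qed

lemma jacobian_ideal_base: "mfps_pderiv i h \<in> jacobian_ideal h"
  unfolding jacobian_ideal_def by (rule ideal.span_base) auto

lemma tjurina_gens_simps [simp]:
  "tjurina_gens f None = f" "tjurina_gens f (Some i) = mfps_pderiv i f"
  by (simp_all add: tjurina_gens_def)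

theorem integral_if_null_form:
  fixes f u :: "('k::field, 'n::finite) mfps"
  assumes \<alpha>0: "\<alpha> None \<noteq> 0" and u: "has_linear_part u \<alpha>"
    and null: "null_form f s \<phi>"
    and \<phi>: "mpoly_eval \<phi> (\<lambda>j. case j of None \<Rightarrow> \<alpha> None | Some i \<Rightarrow> - \<alpha> (Some i)) \<noteq> 0"
  shows "u * f \<in> integral_closure (jacobian_ideal (u * f))"
proof -
  let ?J = "jacobian_ideal (u * f)"
  note u0 = has_linear_partD[OF u]
  obtain w where w: "w * u = 1" using mfps_unit[of u] u0(1) \<alpha>0 by metis
  have w0: "mfps_nth w 0 * \<alpha> None = 1"
    using arg_cong[OF w, of "\<lambda>F. mfps_nth F 0"] by (simp add: mfps_nth_mult_0 u0 mfps_nth_one)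
  \<comment> \<open>The product rule solved for the derivatives of \<open>f\<close>, with
    \<open>w\<close> inverse to \<open>u\<close>: modulo \<open>?J\<close>, each generator is a
    multiple \<open>r v * f\<close>.\<close>
  define r where "r = (\<lambda>j. case j of None \<Rightarrow> 1 | Some i \<Rightarrow> - (w * mfps_pderiv i u))"
  define j where "j = (\<lambda>j. case j of None \<Rightarrow> 0 | Some i \<Rightarrow> w * mfps_pderiv i (u * f))"
  have jJ: "j v \<in> ?J" for v
    using jacobian_ideal_base[of _ "u * f"] unfolding jacobian_ideal_def j_def
    by (cases v) (auto intro: ideal.span_zero ideal.span_scale)
  have gens: "tjurina_gens f v = r v * f + j v" for v
  proof (cases v)
    case (Some i)
    have "w * mfps_pderiv i (u * f) = (w * u) * mfps_pderiv i f + w * mfps_pderiv i u * f"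
      unfolding mfps_pderiv_mult by (simp only: distrib_left mult.assoc)
    then show ?thesis by (simp add: Some r_def j_def w)
  qed (simp add: r_def j_def)
  have J_add: "a + b \<in> ?J" if "a \<in> ?J" "b \<in> ?J" for a b
    using that unfolding jacobian_ideal_def by (rule ideal.span_add)
  have J_scale: "c * b \<in> ?J" if "b \<in> ?J" for b c
    using that unfolding jacobian_ideal_def by (rule ideal.span_scale)
  have T: "\<exists>r. \<exists>j\<in>?J. y = r * f + j" if "y \<in> tjurina_ideal f" for y
  proof -
    obtain a b where y: "y = a + b" "a \<in> ideal_gen {f}" "b \<in> jacobian_ideal f"
      using \<open>y \<in> tjurina_ideal f\<close> unfolding tjurina_ideal_def ideal_sum_def by blast
    obtain c where a: "a = c * f" using y(2) by (auto simp: ideal.span_singleton)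
    have "\<exists>r. \<exists>j\<in>?J. b = r * f + j"
      using y(3) unfolding jacobian_ideal_def[of f]
    proof (induction b rule: ideal.span_induct_alt)
      case base
      have "0 \<in> ?J" unfolding jacobian_ideal_def by (rule ideal.span_zero)
      then show ?case by (intro exI[of _ 0]) auto
    next
      case (step c x y)
      obtain i where x: "x = r (Some i) * f + j (Some i)" using step(1) gens[of "Some _"] by auto
      obtain r' j' where y: "y = r' * f + j'" "j' \<in> ?J" using step(2) by blast
      have "c * x + y = (c * r (Some i) + r') * f + (c * j (Some i) + j')"
        unfolding x y(1) by (simp add: algebra_simps del: ideal.scale_scale)
      then show ?case using J_add[OF J_scale[OF jJ] y(2)] by blast
    qed
    then obtain r j where "j \<in> ?J" "b = r * f + j" by blast
    then show ?thesis using y(1) a by (intro exI[of _ "c + r"] bexI[of _ j]) (auto simp: distrib_right)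
  qed
  obtain F where F: "mpoly_homogeneous s F"
    "\<And>e. Poly_Mapping.lookup F e - mfps_const (Poly_Mapping.lookup \<phi> e) \<in> mfps_max_ideal"
    "mpoly_eval F (tjurina_gens f) \<in> ideal_mult mfps_max_ideal (ideal_power (tjurina_ideal f) s)"
    using null unfolding null_form_def by blast
  have \<phi>_hom: "mpoly_homogeneous s \<phi>" using null unfolding null_form_def by blast
  obtain \<mu> where \<mu>: "\<mu> \<in> mfps_max_ideal" "expands ?J f s \<mu> (mpoly_eval F (tjurina_gens f))"
    using expands_ideal_mult_power[OF T] F(3) unfolding mfps_max_ideal_def by blast
  have "expands ?J f s (Poly_Mapping.lookup F e * mon r e) (Poly_Mapping.lookup F e * mon (tjurina_gens f) e)"
    if "edeg e = s" for e
    using expands_scale[OF expands_mon[of j ?J f e r, OF jJ]] that by (simp add: gens[abs_def])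
  then have "expands ?J f s (mpoly_eval F r) (mpoly_eval F (tjurina_gens f))"
    unfolding mpoly_eval_homogeneous[OF F(1)] by (intro expands_sum) auto
  \<comment> \<open>The same value expands with coefficient \<open>mpoly_eval F r\<close>, by
    substitution, and with the non-unit \<open>\<mu>\<close>, by the null-form condition; so 0
    expands with their difference.\<close>
  then have "expands ?J f s (mpoly_eval F r + (- 1) * \<mu>) (mpoly_eval F (tjurina_gens f) + (- 1) * mpoly_eval F (tjurina_gens f))"
    by (intro expands_add expands_scale \<mu>(2))
  then have in_mixed: "(mpoly_eval F r - \<mu>) * f ^ s \<in> mixed_powers ?J f s"
    using mixed_powers_scale[of _ ?J f s "- 1"] by (fastforce simp: expands_def)
  have "mfps_nth (mpoly_eval F r) 0 = (\<Sum>e | edeg e = s. Poly_Mapping.lookup \<phi> e * mon (\<lambda>v. mfps_nth (r v) 0) e)"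
    unfolding mpoly_eval_homogeneous[OF F(1)] mfps_nth_sum mfps_nth_mult_0 mon_def mfps_nth_prod_0 mfps_nth_power_0
    using F(2) by (intro sum.cong) (simp_all add: mfps_max_ideal_iff mfps_nth_const)
  also have "\<dots> = mpoly_eval \<phi> (\<lambda>v. mfps_nth (r v) 0)"
    by (rule mpoly_eval_homogeneous[OF \<phi>_hom, symmetric])
  \<comment> \<open>The constant terms of \<open>r\<close> are coordinates of the same projective
    point, scaled by the inverse of \<open>\<alpha> None\<close>; by homogeneity the factor does not
    affect non-vanishing.\<close>
  also have "(\<lambda>v. mfps_nth (r v) 0) = (\<lambda>v. mfps_nth w 0 * (case v of None \<Rightarrow> \<alpha> None | Some i \<Rightarrow> - \<alpha> (Some i)))"
    by (rule ext) (auto simp: r_def w0 mfps_nth_one mfps_nth_mult_0 u0 split: option.split)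
  also have "mpoly_eval \<phi> \<dots> \<noteq> 0"
    unfolding mpoly_eval_scale[OF \<phi>_hom] using w0 \<phi> by auto
  finally have "mfps_nth (mpoly_eval F r - \<mu>) 0 \<noteq> 0"
    using \<mu>(1) by (simp add: mfps_max_ideal_iff)
  then obtain q where "q * (mpoly_eval F r - \<mu>) = 1" using mfps_unit by blast
  then have power: "f ^ s \<in> mixed_powers ?J f s"
    using mixed_powers_scale[OF in_mixed, of q] by (simp add: mult.assoc[symmetric])
  \<comment> \<open>At \<open>s = 0\<close> the ideal \<open>mixed_powers\<close> is zero, while
    \<open>f ^ 0 = 1\<close>.\<close>
  moreover have "s > 0"
  proof (rule ccontr)
    assume "\<not> s > 0"
    with power have "(1 :: ('k, 'n) mfps) = 0" by simp
    then show False by simp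
  qed
  ultimately show ?thesis by (rule integral_closure_if_power_in_mixed_powers)
qed


text \<open>Pairs of values at \<open>a\<close> and at \<open>b\<close> of one and the same form of degree \<open>s\<close>.\<close>

definition form_values ::
  "('v::finite \<Rightarrow> 'a::comm_ring_1) \<Rightarrow> ('v \<Rightarrow> 'a) \<Rightarrow> nat \<Rightarrow> ('a \<times> 'a) set" where
  "form_values a b s = {(\<Sum>e | edeg e = s. c e * mon a e, \<Sum>e | edeg e = s. c e * mon b e) | c. True}"

lemma form_values_add:
  assumes "(x, y) \<in> form_values a b s" "(x', y') \<in> form_values a b s"
  shows "(x + x', y + y') \<in> form_values a b s"
proof -
  obtain c c' where "x = (\<Sum>e | edeg e = s. c e * mon a e)" "y = (\<Sum>e | edeg e = s. c e * mon b e)"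
    "x' = (\<Sum>e | edeg e = s. c' e * mon a e)" "y' = (\<Sum>e | edeg e = s. c' e * mon b e)"
    using assms unfolding form_values_def by blast
  then show ?thesis unfolding form_values_def
    by (intro CollectI exI[of _ "\<lambda>e. c e + c' e"]) (simp add: distrib_right sum.distrib)
qed

lemma form_values_scale:
  assumes "(x, y) \<in> form_values a b s"
  shows "(c * x, c * y) \<in> form_values a b s"
proof -
  obtain c' where "x = (\<Sum>e | edeg e = s. c' e * mon a e)" "y = (\<Sum>e | edeg e = s. c' e * mon b e)"
    using assms unfolding form_values_def by blast
  then show ?thesis unfolding form_values_def
    by (intro CollectI exI[of _ "\<lambda>e. c * c' e"]) (simp only: sum_distrib_left mult.assoc)
qed

lemma form_values_zero: "(0, 0) \<in> form_values a b s"
  unfolding form_values_def by (intro CollectI exI[of _ "\<lambda>_. 0"]) simp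

lemma form_values_sum:
  assumes "\<And>i. i \<in> I \<Longrightarrow> (x i, y i) \<in> form_values a b s"
  shows "(sum x I, sum y I) \<in> form_values a b s"
  using assms by (induction I rule: infinite_finite_induct) (auto simp: form_values_zero form_values_add)

lemma form_values_mon:
  fixes a b :: "'v::finite \<Rightarrow> 'a::comm_ring_1"
  assumes "edeg e = s"
  shows "(mon a e, mon b e) \<in> form_values a b s"
proof -
  have "(\<Sum>g | edeg g = s. (if g = e then 1 else 0) * mon a g) = mon a e" for a :: "'v \<Rightarrow> 'a"
  proof -
    have "(\<Sum>g | edeg g = s. (if g = e then 1 else 0) * mon a g) = (\<Sum>g | edeg g = s. if g = e then mon a e else 0)"
      by (rule sum.cong) auto
    then show ?thesis using assms by (simp add: finite_edeg_eq)
  qed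
  then show ?thesis unfolding form_values_def
    by (intro CollectI exI[of _ "\<lambda>g. if g = e then 1 else 0"]) simp
qed

lemma form_values_variable: "(a v, b v) \<in> form_values a b 1"
  using form_values_mon[of "Poly_Mapping.single v 1" 1 a b] by simp

lemma form_values_const: "(x, x) \<in> form_values a b 0"
  using form_values_scale[OF form_values_mon[of 0 0 a b], of x] by simp

lemma form_values_mult:
  fixes a b :: "'v::finite \<Rightarrow> 'a::comm_ring_1"
  assumes "(x, y) \<in> form_values a b s" "(x', y') \<in> form_values a b s'"
  shows "(x * x', y * y') \<in> form_values a b (s + s')"
proof -
  obtain c c' where c: "x = (\<Sum>e | edeg e = s. c e * mon a e)" "y = (\<Sum>e | edeg e = s. c e * mon b e)"
    "x' = (\<Sum>e | edeg e = s'. c' e * mon a e)" "y' = (\<Sum>e | edeg e = s'. c' e * mon b e)"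
    using assms unfolding form_values_def by blast
  have "(\<Sum>e | edeg e = s. c e * mon a e) * (\<Sum>e | edeg e = s'. c' e * mon a e)
    = (\<Sum>e | edeg e = s. \<Sum>g | edeg g = s'. c e * c' g * mon a (e + g))" for a :: "'v \<Rightarrow> 'a"
    unfolding sum_product by (intro sum.cong refl) (simp only: mon_add mult_ac)
  then show ?thesis
    unfolding c by (simp only:) (intro form_values_sum form_values_scale form_values_mon; simp)
qed

lemma form_values_power:
  assumes "(x, y) \<in> form_values a b s"
  shows "(x ^ n, y ^ n) \<in> form_values a b (n * s)"
  by (induction n) (auto simp: form_values_const intro: form_values_mult[OF assms])

text \<open>Every element of \<open>jacobian_ideal (u * f)\<close> is the value of a linear form
  whose reduction vanishes at the point, so the coefficients of the integral equation come from
  forms with that property. The lifted equation takes its value at the point from the leading term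
  alone.\<close>

theorem null_form_if_integral:
  fixes f u :: "('k::field, 'n::finite) mfps"
  assumes \<alpha>0: "\<alpha> None \<noteq> 0" and u: "has_linear_part u \<alpha>"
    and int: "u * f \<in> integral_closure (jacobian_ideal (u * f))"
  obtains s \<phi> where "null_form f s \<phi>"
    "mpoly_eval \<phi> (\<lambda>j. case j of None \<Rightarrow> \<alpha> None | Some i \<Rightarrow> - \<alpha> (Some i)) \<noteq> 0"
proof -
  let ?J = "jacobian_ideal (u * f)"
  let ?pt = "\<lambda>j. case j of None \<Rightarrow> \<alpha> None | Some i \<Rightarrow> - \<alpha> (Some i)"
  \<comment> \<open>The second member of a pair evaluates the form at constants, so its constant
    term is the value of the reduced form at the point.\<close>
  let ?V = "form_values (tjurina_gens f) (\<lambda>j. mfps_const (?pt j))"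
  note u0 = has_linear_partD[OF u]
  have J: "\<exists>y. (x, y) \<in> ?V 1 \<and> mfps_nth y 0 = 0" if "x \<in> ?J" for x
    using that unfolding jacobian_ideal_def
  proof (induction x rule: ideal.span_induct_alt)
    case base
    show ?case using form_values_zero by (intro exI[of _ 0]) auto
  next
    case (step c x z)
    obtain y where y: "(z, y) \<in> ?V 1" "mfps_nth y 0 = 0" using step(2) by blast
    obtain i where x: "x = u * mfps_pderiv i f + mfps_pderiv i u * f"
      using step(1) unfolding mfps_pderiv_mult by blast
    \<comment> \<open>The value of the lift u Y_i + u_i Y_0 of a generator; its constant term is
      \<alpha>_0 (-\<alpha>_i) + \<alpha>_i \<alpha>_0 = 0.\<close>
    let ?y = "u * mfps_const (?pt (Some i)) + mfps_pderiv i u * mfps_const (?pt None)"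
    note var = form_values_variable[of "tjurina_gens f" _ "\<lambda>j. mfps_const (?pt j)"]
    have "(x, ?y) \<in> ?V 1"
      using form_values_add[OF form_values_scale[OF var[of "Some i"], of u]
          form_values_scale[OF var[of None], of "mfps_pderiv i u"]]
      unfolding x tjurina_gens_simps .
    moreover have "mfps_nth ?y 0 = 0" by (simp add: mfps_nth_mult_0 u0 mfps_nth_const mult.commute)
    ultimately show ?case
      using form_values_add[OF form_values_scale y(1)] y(2)
      by (intro exI[of _ "c * ?y + y"]) (simp add: mfps_nth_mult_0)
  qed
  have J_power: "\<exists>y. (x, y) \<in> ?V i \<and> (i > 0 \<longrightarrow> mfps_nth y 0 = 0)" if "x \<in> ideal_power ?J i" for x i
    using that
  proof (induction i arbitrary: x)
    case 0
    show ?case using form_values_const by blast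
  next
    case (Suc i)
    from Suc.prems show ?case unfolding ideal_power.simps ideal_mult_def
    proof (induction x rule: ideal.span_induct_alt)
      case base
      show ?case using form_values_zero by (intro exI[of _ 0]) auto
    next
      case (step c x z)
      obtain p q where pq: "x = p * q" "p \<in> ?J" "q \<in> ideal_power ?J i" using step(1) by blast
      obtain y1 where y1: "(p, y1) \<in> ?V 1" "mfps_nth y1 0 = 0" using J[OF pq(2)] by blast
      obtain y2 where y2: "(q, y2) \<in> ?V i" using Suc.IH[OF pq(3)] by blast
      obtain y where y: "(z, y) \<in> ?V (Suc i)" "mfps_nth y 0 = 0" using step(2) by blast
      have "(c * x + z, c * (y1 * y2) + y) \<in> ?V (Suc i)"
        using form_values_mult[OF y1(1) y2] y(1) unfolding pq(1)
        by (intro form_values_add form_values_scale) simp_all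
      then show ?case using y1(2) y(2) by (intro exI[of _ "c * (y1 * y2) + y"]) (simp add: mfps_nth_mult_0)
    qed
  qed
  obtain d c where d: "d > 0" "\<And>i. i \<in> {1..d} \<Longrightarrow> c i \<in> ideal_power ?J i"
    "(u * f) ^ d + (\<Sum>i=1..d. c i * (u * f) ^ (d - i)) = 0"
    using int unfolding integral_closure_def by blast
  have "\<forall>i\<in>{1..d}. \<exists>y. (c i, y) \<in> ?V i \<and> mfps_nth y 0 = 0"
    using J_power[OF d(2)] by fastforce
  then obtain y where y: "\<And>i. i \<in> {1..d} \<Longrightarrow> (c i, y i) \<in> ?V i" "\<And>i. i \<in> {1..d} \<Longrightarrow> mfps_nth (y i) 0 = 0"
    by metis
  let ?z = "u * mfps_const (?pt None)"
  have z: "((u * f) ^ n, ?z ^ n) \<in> ?V n" for n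
    using form_values_power[OF form_values_scale[OF form_values_variable[of "tjurina_gens f" None
        "\<lambda>j. mfps_const (?pt j)"], of u], of n]
    by simp
  let ?Y = "?z ^ d + (\<Sum>i=1..d. y i * ?z ^ (d - i))"
  have "((u * f) ^ d + (\<Sum>i=1..d. c i * (u * f) ^ (d - i)), ?Y) \<in> ?V d"
  proof (intro form_values_add z form_values_sum)
    show "(c i * (u * f) ^ (d - i), y i * ?z ^ (d - i)) \<in> ?V d" if "i \<in> {1..d}" for i
      using form_values_mult[OF y(1)[OF that] z[of "d - i"]] that by simp
  qed
  then obtain h where h: "(\<Sum>e | edeg e = d. h e * mon (tjurina_gens f) e) = 0"
    "?Y = (\<Sum>e | edeg e = d. h e * mon (\<lambda>j. mfps_const (?pt j)) e)"
    unfolding d(3) form_values_def by auto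
  let ?\<phi> = "mpoly_of_coeffs d (\<lambda>e. mfps_nth (h e) 0)"
  have "mpoly_eval ?\<phi> ?pt = mfps_nth ?Y 0"
    unfolding h(2) mpoly_eval_of_coeffs mfps_nth_sum mfps_const_mon[symmetric]
    by (simp add: mfps_nth_mult_0 mfps_nth_const)
  \<comment> \<open>One factor \<open>\<alpha> None\<close> is the constant term of
    \<open>u\<close>, the other the coordinate \<open>None\<close> of the point.\<close>
  also have "\<dots> = (\<alpha> None * \<alpha> None) ^ d"
    using y(2) by (simp add: mfps_nth_sum mfps_nth_mult_0 mfps_nth_power_0 mfps_nth_const u0)
  also have "\<dots> \<noteq> 0" using \<alpha>0 by simp
  finally show ?thesis by (rule that[OF null_form_of_relation[OF h(1)]])
qed

section \<open>The criterion and its generic validity\<close>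

theorem integral_iff:
  fixes f u :: "('k::field, 'n::finite) mfps"
  assumes "\<alpha> None \<noteq> 0" "has_linear_part u \<alpha>"
  shows "u * f \<in> integral_closure (jacobian_ideal (u * f)) \<longleftrightarrow>
    (\<exists>G\<in>null_form_ideal f. mpoly_eval G (\<lambda>j. case j of None \<Rightarrow> \<alpha> None | Some i \<Rightarrow> - \<alpha> (Some i)) \<noteq> 0)"
proof
  assume "u * f \<in> integral_closure (jacobian_ideal (u * f))"
  then obtain s \<phi> where "null_form f s \<phi>"
    "mpoly_eval \<phi> (\<lambda>j. case j of None \<Rightarrow> \<alpha> None | Some i \<Rightarrow> - \<alpha> (Some i)) \<noteq> 0"
    using null_form_if_integral[OF assms] by blast
  moreover from this(1) have "\<phi> \<in> null_form_ideal f"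
    unfolding null_form_ideal_def by (intro ideal.span_base) blast
  ultimately show "\<exists>G\<in>null_form_ideal f. mpoly_eval G (\<lambda>j. case j of None \<Rightarrow> \<alpha> None | Some i \<Rightarrow> - \<alpha> (Some i)) \<noteq> 0"
    by blast
next
  assume "\<exists>G\<in>null_form_ideal f. mpoly_eval G (\<lambda>j. case j of None \<Rightarrow> \<alpha> None | Some i \<Rightarrow> - \<alpha> (Some i)) \<noteq> 0"
  then show "u * f \<in> integral_closure (jacobian_ideal (u * f))"
    using null_form_ideal_nonvanishing integral_if_null_form[OF assms] by metis
qed

text \<open>A relation between the \<open>n + 1\<close> generators with a unit coefficient reduces
  to a nonzero null-form; the open set is where it does not vanish, up to signs of the
  coordinates.\<close>

theorem generic_nonvanishing:
  fixes f :: "('k::field, 'n::finite) mfps"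
  assumes inf: "infinite (UNIV :: 'k set)"
  obtains U :: "('n option \<Rightarrow> 'k) set set" where "proj_zariski_open U" "U \<noteq> {}"
    "\<And>\<alpha>. proj_point \<alpha> \<in> U \<Longrightarrow>
      \<exists>G\<in>null_form_ideal f. mpoly_eval G (\<lambda>j. case j of None \<Rightarrow> \<alpha> None | Some i \<Rightarrow> - \<alpha> (Some i)) \<noteq> 0"
proof -
  obtain s c b where b: "edeg b = s" "mfps_nth (c b) 0 \<noteq> 0"
    and rel: "(\<Sum>b | edeg b = s. c b * mon (tjurina_gens f) b) = 0"
    using homogeneous_relation_with_unit_coefficient[OF inf order_refl, of "tjurina_gens f"] by blast
  define \<phi> where "\<phi> = mpoly_of_coeffs s (\<lambda>e. mfps_nth (c e) 0)"
  have \<phi>: "null_form f s \<phi>" unfolding \<phi>_def by (rule null_form_of_relation[OF rel])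
  \<comment> \<open>The criterion evaluates at a point with changed signs, while the open set is
    described by \<open>\<alpha>\<close> itself; the signs are moved into the coefficients, which
    stay nonzero.\<close>
  define \<epsilon> :: "'n option \<Rightarrow> 'k" where "\<epsilon> = (\<lambda>j. case j of None \<Rightarrow> 1 | Some i \<Rightarrow> - 1)"
  define \<psi> where "\<psi> = mpoly_of_coeffs s (\<lambda>e. mfps_nth (c e) 0 * mon \<epsilon> e)"
  have \<psi>_eval: "mpoly_eval \<psi> x = mpoly_eval \<phi> (\<lambda>j. case j of None \<Rightarrow> x None | Some i \<Rightarrow> - x (Some i))" for x
  proof -
    have "mon (\<lambda>j. case j of None \<Rightarrow> x None | Some i \<Rightarrow> - x (Some i)) e = mon \<epsilon> e * mon x e" for e
      unfolding mon_def prod.distrib[symmetric] power_mult_distrib[symmetric]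
      by (intro prod.cong) (auto simp: \<epsilon>_def split: option.split)
    then show ?thesis by (simp add: \<phi>_def \<psi>_def mpoly_eval_of_coeffs)
  qed
  have \<psi>_hom: "mpoly_homogeneous s \<psi>" unfolding \<psi>_def by (rule mpoly_homogeneous_of_coeffs)
  let ?U = "proj_space - proj_zero_set {\<psi>}"
  have "mon \<epsilon> b \<noteq> 0" by (auto simp: mon_def \<epsilon>_def split: option.split)
  with b have "mfps_nth (c b) 0 * mon \<epsilon> b \<noteq> 0" by simp
  then obtain x where x: "\<And>v. x v \<noteq> 0" "(\<Sum>e | edeg e = s. mfps_nth (c e) 0 * mon \<epsilon> e * mon x e) \<noteq> 0"
    using exists_nonvanishing[OF inf finite_edeg_eq[of s], of b "\<lambda>e. mfps_nth (c e) 0 * mon \<epsilon> e"] b(1) by blast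
  show ?thesis
  proof
    show "proj_zariski_open ?U" unfolding proj_zariski_open_def using \<psi>_hom by blast
    have "x \<in> proj_point x" unfolding proj_point_def by (intro CollectI exI[of _ 1]) simp
    moreover have "mpoly_eval \<psi> x \<noteq> 0" using x(2) by (simp add: \<psi>_def mpoly_eval_of_coeffs)
    moreover have "x \<noteq> (\<lambda>_. 0)" using x(1) by auto
    then have "proj_point x \<in> proj_space" unfolding proj_space_def by blast
    ultimately have "proj_point x \<in> ?U" by (auto simp: proj_zero_set_def)
    then show "?U \<noteq> {}" by blast
    show "\<exists>G\<in>null_form_ideal f. mpoly_eval G (\<lambda>j. case j of None \<Rightarrow> \<alpha> None | Some i \<Rightarrow> - \<alpha> (Some i)) \<noteq> 0"
      if U: "proj_point \<alpha> \<in> ?U" for \<alpha>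
    proof
      show "\<phi> \<in> null_form_ideal f"
        unfolding null_form_ideal_def using \<phi> by (intro ideal.span_base) blast
      obtain y where "y \<in> proj_point \<alpha>" "mpoly_eval \<psi> y \<noteq> 0"
        using U by (auto simp: proj_zero_set_def)
      \<comment> \<open>The class supplies only some multiple of \<open>\<alpha>\<close>;
        homogeneity carries non-vanishing back to \<open>\<alpha>\<close>.\<close>
      then obtain q where "mpoly_eval \<psi> (\<lambda>v. q * \<alpha> v) \<noteq> 0" unfolding proj_point_def by blast
      then show "mpoly_eval \<phi> (\<lambda>j. case j of None \<Rightarrow> \<alpha> None | Some i \<Rightarrow> - \<alpha> (Some i)) \<noteq> 0"
        unfolding mpoly_eval_scale[OF \<psi>_hom] \<psi>_eval by auto
    qed
  qed
qed

theorem theorem3p4: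
  fixes f :: "('k::alg_closed_field, 'n::finite) mfps"
  assumes "f \<in> mfps_max_ideal"
  shows "(\<forall>(u :: ('k, 'n) mfps) (\<alpha> :: 'n option \<Rightarrow> 'k).
            u dvd 1 \<and> \<alpha> None \<noteq> 0 \<and> has_linear_part u \<alpha> \<longrightarrow>
            (u * f \<in> integral_closure (jacobian_ideal (u * f)) \<longleftrightarrow>
             (\<exists>G\<in>null_form_ideal f.
                mpoly_eval G (\<lambda>j. case j of None \<Rightarrow> \<alpha> None | Some i \<Rightarrow> - \<alpha> (Some i)) \<noteq> 0))) \<and>
         (\<exists>U :: ('n option \<Rightarrow> 'k) set set. proj_zariski_open U \<and> U \<noteq> {} \<and>
            (\<forall>(u :: ('k, 'n) mfps) (\<alpha> :: 'n option \<Rightarrow> 'k).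
              u dvd 1 \<and> \<alpha> None \<noteq> 0 \<and> has_linear_part u \<alpha> \<and> proj_point \<alpha> \<in> U \<longrightarrow>
              u * f \<in> integral_closure (jacobian_ideal (u * f))))"
proof (intro conjI allI impI)
  fix u :: "('k, 'n) mfps" and \<alpha> :: "'n option \<Rightarrow> 'k"
  assume "u dvd 1 \<and> \<alpha> None \<noteq> 0 \<and> has_linear_part u \<alpha>"
  then show "u * f \<in> integral_closure (jacobian_ideal (u * f)) \<longleftrightarrow>
      (\<exists>G\<in>null_form_ideal f.
        mpoly_eval G (\<lambda>j. case j of None \<Rightarrow> \<alpha> None | Some i \<Rightarrow> - \<alpha> (Some i)) \<noteq> 0)"
    by (intro integral_iff) auto
next
  obtain U :: "('n option \<Rightarrow> 'k) set set" where "proj_zariski_open U" "U \<noteq> {}"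
    and U: "\<And>\<alpha>. proj_point \<alpha> \<in> U \<Longrightarrow>
      \<exists>G\<in>null_form_ideal f. mpoly_eval G (\<lambda>j. case j of None \<Rightarrow> \<alpha> None | Some i \<Rightarrow> - \<alpha> (Some i)) \<noteq> 0"
    using generic_nonvanishing[OF infinite_UNIV_alg_closed, of f] by blast
  moreover have "u * f \<in> integral_closure (jacobian_ideal (u * f))"
    if "\<alpha> None \<noteq> 0" "has_linear_part u \<alpha>" "proj_point \<alpha> \<in> U" for u \<alpha>
    using integral_iff[OF that(1,2), of f] U[OF that(3)] by blast
  ultimately show "\<exists>U :: ('n option \<Rightarrow> 'k) set set. proj_zariski_open U \<and> U \<noteq> {} \<and>
      (\<forall>(u :: ('k, 'n) mfps) (\<alpha> :: 'n option \<Rightarrow> 'k).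
        u dvd 1 \<and> \<alpha> None \<noteq> 0 \<and> has_linear_part u \<alpha> \<and> proj_point \<alpha> \<in> U \<longrightarrow>
        u * f \<in> integral_closure (jacobian_ideal (u * f)))"
    by blast
qed

end
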